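(* Let $E$ be an admissible $*$-tring and $\gamma\in\mathcal{SN}(E)$. Then $E_\gamma^l$ and $E_\gamma^r$ are Morita-Rieffel equivalent $C^*$-algebras.
   Context: A $*$-ternary ring ($*$-tring) is a complex vector space $E$ with a map $(\cdot,\cdot,\cdot):E\times E\times E\to E$, linear in the first and third variables and conjugate linear in the second, such that $((x,y,z),u,v)=(x,(u,z,y),v)=(x,y,(z,u,v))$ for all $x,y,z,u,v\in E$. It is admissible if $(x,x,x)=0$ implies $x=0$. A $C^*$-seminorm on $E$ is a seminorm $\gamma$ with $\gamma((x,y,z))\le\gamma(x)\gamma(y)\gamma(z)$ and $\gamma((x,x,x))=\gamma(x)^3$; $\mathcal{SN}(E)$ is the set of all of them. A $C^*$-tring is a $*$-tring that is a Banach space under a $C^*$-norm (a $C^*$-seminorm that is a norm). For an admissible $*$-tring $F$: $F_0^r$ is the linear span of the maps $\langle y,z\rangle_r:x\mapsto(x,y,z)$, a $*$-algebra with product opposite to composition and involution determined by $\langle y,z\rangle_r^*=\langle z,y\rangle_r$, acting on $F$ on the right by evaluation; $F_0^l$ is the linear span of the maps $\langle x,y\rangle_l:z\mapsto(x,y,z)$, a $*$-algebra under composition with involution determined by $\langle x,y\rangle_l^*=\langle y,x\rangle_l$, acting on $F$ on the left. If $(F,\gamma)$ is a $C^*$-tring, $F^r$ and $F^l$ are the $C^*$-algebras obtained by completing $F_0^r$ and $F_0^l$ in the operator norms $\gamma^r(a)=\sup\{\gamma(xa):\gamma(x)\le1\}$ and $\gamma^l(a)=\sup\{\gamma(ax):\gamma(x)\le1\}$.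 For $\gamma\in\mathcal{SN}(E)$, $N_\gamma=\{x:\gamma(x)=0\}$ and $E_\gamma$ is the Hausdorff completion of $(E,\gamma)$, i.e. the completion of $E/N_\gamma$ in the norm induced by $\gamma$; it is a $C^*$-tring with the induced operations. $E_\gamma^r$ and $E_\gamma^l$ denote $(E_\gamma)^r$ and $(E_\gamma)^l$. *)

theory Defs
  imports Complex_Main "HOL-Algebra.Module"
begin

section \<open>Complex vector spaces and seminorms\<close>

definition complex_field :: "complex ring"
  where "complex_field = \<lparr>carrier = UNIV, mult = (*), one = 1, zero = 0, add = (+)\<rparr>"

lemma cring_complex_field: "cring complex_field"
proof (rule cringI)
  show "abelian_group complex_field"
    by (rule abelian_groupI)
      (auto simp: complex_field_def algebra_simps intro: exI[of _ "- x" for x])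
  show "comm_monoid complex_field"
    by (rule comm_monoidI) (auto simp: complex_field_def)
qed (auto simp: complex_field_def algebra_simps)

text \<open>
  A complex vector space is a \<^locale>\<open>module\<close> over \<^const>\<open>complex_field\<close>. The underlying record
  type also carries the fields \<^const>\<open>mult\<close> and \<^const>\<open>one\<close>, on which the locale imposes
  nothing. Below, \<^const>\<open>mult\<close> is the product of (in general non-unital) algebras and is
  unused for mere vector spaces; \<^const>\<open>one\<close> is never used.
\<close>

definition seminorm_on :: "(complex, 'a, 'm) module_scheme \<Rightarrow> ('a \<Rightarrow> real) \<Rightarrow> bool"
  where "seminorm_on V p \<longleftrightarrow>
    (\<forall>x\<in>carrier V. 0 \<le> p x) \<and>
    (\<forall>x\<in>carrier V. \<forall>y\<in>carrier V. p (x \<oplus>\<^bsub>V\<^esub> y) \<le> p x + p y) \<and>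
    (\<forall>c. \<forall>x\<in>carrier V. p (c \<odot>\<^bsub>V\<^esub> x) = cmod c * p x)"

definition norm_on :: "(complex, 'a, 'm) module_scheme \<Rightarrow> ('a \<Rightarrow> real) \<Rightarrow> bool"
  where "norm_on V p \<longleftrightarrow> seminorm_on V p \<and> (\<forall>x\<in>carrier V. p x = 0 \<longrightarrow> x = \<zero>\<^bsub>V\<^esub>)"

definition cauchy_in :: "(complex, 'a, 'm) module_scheme \<Rightarrow> ('a \<Rightarrow> real) \<Rightarrow> (nat \<Rightarrow> 'a) \<Rightarrow> bool"
  where "cauchy_in V p s \<longleftrightarrow>
    (\<forall>n. s n \<in> carrier V) \<and>
    (\<forall>e>0. \<exists>N. \<forall>m\<ge>N. \<forall>n\<ge>N. p (s m \<ominus>\<^bsub>V\<^esub> s n) < e)"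

definition complete_in :: "(complex, 'a, 'm) module_scheme \<Rightarrow> ('a \<Rightarrow> real) \<Rightarrow> bool"
  where "complete_in V p \<longleftrightarrow>
    (\<forall>s. cauchy_in V p s \<longrightarrow> (\<exists>x\<in>carrier V. (\<lambda>n. p (s n \<ominus>\<^bsub>V\<^esub> x)) \<longlonglongrightarrow> 0))"

definition lin_span :: "(complex, 'a, 'm) module_scheme \<Rightarrow> 'a set \<Rightarrow> 'a set"
  where "lin_span V S = \<Inter> {W. submodule W complex_field V \<and> S \<subseteq> W}"


section \<open>Hausdorff completions\<close>

text \<open>
  The Hausdorff completion of a seminormed space \<open>(V, p)\<close>: Cauchy sequences modulo sequences on
  which \<open>p\<close> tends to \<open>0\<close>. This identifies the points of \<open>V\<close> modulo the null space of \<open>p\<close> and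
  completes in one step. Operations are computed termwise on representatives.
\<close>

definition completion_rel ::
    "(complex, 'a, 'm) module_scheme \<Rightarrow> ('a \<Rightarrow> real) \<Rightarrow> ((nat \<Rightarrow> 'a) \<times> (nat \<Rightarrow> 'a)) set"
  where "completion_rel V p =
    {(s, t). cauchy_in V p s \<and> cauchy_in V p t \<and> (\<lambda>n. p (s n \<ominus>\<^bsub>V\<^esub> t n)) \<longlonglongrightarrow> 0}"

definition completion_carrier ::
    "(complex, 'a, 'm) module_scheme \<Rightarrow> ('a \<Rightarrow> real) \<Rightarrow> (nat \<Rightarrow> 'a) set set"
  where "completion_carrier V p = {s. cauchy_in V p s} // completion_rel V p"

definition completion_class ::
    "(complex, 'a, 'm) module_scheme \<Rightarrow> ('a \<Rightarrow> real) \<Rightarrow> (nat \<Rightarrow> 'a) \<Rightarrow> (nat \<Rightarrow> 'a) set"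
  where "completion_class V p s = completion_rel V p `` {s}"

definition rep :: "(nat \<Rightarrow> 'a) set \<Rightarrow> nat \<Rightarrow> 'a"
  where "rep X = (SOME s. s \<in> X)"

definition completion_norm :: "('a \<Rightarrow> real) \<Rightarrow> (nat \<Rightarrow> 'a) set \<Rightarrow> real"
  where "completion_norm p X = lim (\<lambda>n. p (rep X n))"


section \<open>Ternary rings\<close>

record 'a tring = "(complex, 'a) module" +
  tprod :: "'a \<Rightarrow> 'a \<Rightarrow> 'a \<Rightarrow> 'a"

locale star_tring = module complex_field E for E :: "('a, 'm) tring_scheme" (structure) +
  assumes tprod_closed:
      "\<lbrakk>x \<in> carrier E; y \<in> carrier E; z \<in> carrier E\<rbrakk> \<Longrightarrow> tprod E x y z \<in> carrier E"
    and tprod_add1: "\<lbrakk>x \<in> carrier E; x' \<in> carrier E; y \<in> carrier E; z \<in> carrier E\<rbrakk> \<Longrightarrow>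
      tprod E (x \<oplus>\<^bsub>E\<^esub> x') y z = tprod E x y z \<oplus>\<^bsub>E\<^esub> tprod E x' y z"
    and tprod_add2: "\<lbrakk>x \<in> carrier E; y \<in> carrier E; y' \<in> carrier E; z \<in> carrier E\<rbrakk> \<Longrightarrow>
      tprod E x (y \<oplus>\<^bsub>E\<^esub> y') z = tprod E x y z \<oplus>\<^bsub>E\<^esub> tprod E x y' z"
    and tprod_add3: "\<lbrakk>x \<in> carrier E; y \<in> carrier E; z \<in> carrier E; z' \<in> carrier E\<rbrakk> \<Longrightarrow>
      tprod E x y (z \<oplus>\<^bsub>E\<^esub> z') = tprod E x y z \<oplus>\<^bsub>E\<^esub> tprod E x y z'"
    and tprod_smult1: "\<lbrakk>x \<in> carrier E; y \<in> carrier E; z \<in> carrier E\<rbrakk> \<Longrightarrow>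
      tprod E (c \<odot>\<^bsub>E\<^esub> x) y z = c \<odot>\<^bsub>E\<^esub> tprod E x y z"
    and tprod_smult2: "\<lbrakk>x \<in> carrier E; y \<in> carrier E; z \<in> carrier E\<rbrakk> \<Longrightarrow>
      tprod E x (c \<odot>\<^bsub>E\<^esub> y) z = cnj c \<odot>\<^bsub>E\<^esub> tprod E x y z"
    and tprod_smult3: "\<lbrakk>x \<in> carrier E; y \<in> carrier E; z \<in> carrier E\<rbrakk> \<Longrightarrow>
      tprod E x y (c \<odot>\<^bsub>E\<^esub> z) = c \<odot>\<^bsub>E\<^esub> tprod E x y z"
    and tprod_assoc12: "\<lbrakk>x \<in> carrier E; y \<in> carrier E; z \<in> carrier E; u \<in> carrier E; v \<in> carrier E\<rbrakk> \<Longrightarrow>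
      tprod E (tprod E x y z) u v = tprod E x (tprod E u z y) v"
    and tprod_assoc13: "\<lbrakk>x \<in> carrier E; y \<in> carrier E; z \<in> carrier E; u \<in> carrier E; v \<in> carrier E\<rbrakk> \<Longrightarrow>
      tprod E (tprod E x y z) u v = tprod E x y (tprod E z u v)"

locale admissible_star_tring = star_tring +
  assumes admissible: "\<lbrakk>x \<in> carrier E; tprod E x x x = \<zero>\<^bsub>E\<^esub>\<rbrakk> \<Longrightarrow> x = \<zero>\<^bsub>E\<^esub>"

definition SN :: "('a, 'm) tring_scheme \<Rightarrow> ('a \<Rightarrow> real) set"
  where "SN E = {\<gamma>. seminorm_on E \<gamma> \<and>
    (\<forall>x\<in>carrier E. \<forall>y\<in>carrier E. \<forall>z\<in>carrier E. \<gamma> (tprod E x y z) \<le> \<gamma> x * \<gamma> y * \<gamma> z) \<and>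
    (\<forall>x\<in>carrier E. \<gamma> (tprod E x x x) = \<gamma> x ^ 3)}"

definition tring_completion ::
    "('a, 'm) tring_scheme \<Rightarrow> ('a \<Rightarrow> real) \<Rightarrow> (nat \<Rightarrow> 'a) set tring"
  where "tring_completion E \<gamma> =
    \<lparr>carrier = completion_carrier E \<gamma>,
     mult = undefined,
     one = undefined,
     zero = completion_class E \<gamma> (\<lambda>n. \<zero>\<^bsub>E\<^esub>),
     add = (\<lambda>X Y. completion_class E \<gamma> (\<lambda>n. rep X n \<oplus>\<^bsub>E\<^esub> rep Y n)),
     smult = (\<lambda>c X. completion_class E \<gamma> (\<lambda>n. c \<odot>\<^bsub>E\<^esub> rep X n)),
     tprod = (\<lambda>X Y Z. completion_class E \<gamma> (\<lambda>n. tprod E (rep X n) (rep Y n) (rep Z n)))\<rparr>"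


section \<open>C*-algebras\<close>

record 'a normed_star_alg = "(complex, 'a) module" +
  star :: "'a \<Rightarrow> 'a"
  nrm :: "'a \<Rightarrow> real"

locale cstar_algebra = module complex_field A
  for A :: "('a, 'm) normed_star_alg_scheme" (structure) +
  assumes mult_closed:
      "\<lbrakk>a \<in> carrier A; b \<in> carrier A\<rbrakk> \<Longrightarrow> a \<otimes>\<^bsub>A\<^esub> b \<in> carrier A"
    and mult_assoc: "\<lbrakk>a \<in> carrier A; b \<in> carrier A; c \<in> carrier A\<rbrakk> \<Longrightarrow>
      (a \<otimes>\<^bsub>A\<^esub> b) \<otimes>\<^bsub>A\<^esub> c = a \<otimes>\<^bsub>A\<^esub> (b \<otimes>\<^bsub>A\<^esub> c)"
    and mult_l_distr: "\<lbrakk>a \<in> carrier A; b \<in> carrier A; c \<in> carrier A\<rbrakk> \<Longrightarrow>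
      (a \<oplus>\<^bsub>A\<^esub> b) \<otimes>\<^bsub>A\<^esub> c = (a \<otimes>\<^bsub>A\<^esub> c) \<oplus>\<^bsub>A\<^esub> (b \<otimes>\<^bsub>A\<^esub> c)"
    and mult_r_distr: "\<lbrakk>a \<in> carrier A; b \<in> carrier A; c \<in> carrier A\<rbrakk> \<Longrightarrow>
      a \<otimes>\<^bsub>A\<^esub> (b \<oplus>\<^bsub>A\<^esub> c) = (a \<otimes>\<^bsub>A\<^esub> b) \<oplus>\<^bsub>A\<^esub> (a \<otimes>\<^bsub>A\<^esub> c)"
    and mult_smult_l: "\<lbrakk>a \<in> carrier A; b \<in> carrier A\<rbrakk> \<Longrightarrow>
      (k \<odot>\<^bsub>A\<^esub> a) \<otimes>\<^bsub>A\<^esub> b = k \<odot>\<^bsub>A\<^esub> (a \<otimes>\<^bsub>A\<^esub> b)"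
    and mult_smult_r: "\<lbrakk>a \<in> carrier A; b \<in> carrier A\<rbrakk> \<Longrightarrow>
      a \<otimes>\<^bsub>A\<^esub> (k \<odot>\<^bsub>A\<^esub> b) = k \<odot>\<^bsub>A\<^esub> (a \<otimes>\<^bsub>A\<^esub> b)"
    and star_closed: "a \<in> carrier A \<Longrightarrow> star A a \<in> carrier A"
    and star_add: "\<lbrakk>a \<in> carrier A; b \<in> carrier A\<rbrakk> \<Longrightarrow>
      star A (a \<oplus>\<^bsub>A\<^esub> b) = star A a \<oplus>\<^bsub>A\<^esub> star A b"
    and star_smult: "a \<in> carrier A \<Longrightarrow> star A (k \<odot>\<^bsub>A\<^esub> a) = cnj k \<odot>\<^bsub>A\<^esub> star A a"
    and star_mult: "\<lbrakk>a \<in> carrier A; b \<in> carrier A\<rbrakk> \<Longrightarrow>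
      star A (a \<otimes>\<^bsub>A\<^esub> b) = star A b \<otimes>\<^bsub>A\<^esub> star A a"
    and star_star: "a \<in> carrier A \<Longrightarrow> star A (star A a) = a"
    and norm_nrm: "norm_on A (nrm A)"
    and nrm_mult: "\<lbrakk>a \<in> carrier A; b \<in> carrier A\<rbrakk> \<Longrightarrow> nrm A (a \<otimes>\<^bsub>A\<^esub> b) \<le> nrm A a * nrm A b"
    and complete: "complete_in A (nrm A)"
    and cstar_identity: "a \<in> carrier A \<Longrightarrow> nrm A (star A a \<otimes>\<^bsub>A\<^esub> a) = (nrm A a)\<^sup>2"

definition positive_in :: "('a, 'm) normed_star_alg_scheme \<Rightarrow> 'a \<Rightarrow> bool"
  where "positive_in A a \<longleftrightarrow> (\<exists>b\<in>carrier A. a = star A b \<otimes>\<^bsub>A\<^esub> b)"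

definition alg_completion ::
    "('a, 'm) normed_star_alg_scheme \<Rightarrow> (nat \<Rightarrow> 'a) set normed_star_alg"
  where "alg_completion A =
    \<lparr>carrier = completion_carrier A (nrm A),
     mult = (\<lambda>X Y. completion_class A (nrm A) (\<lambda>n. rep X n \<otimes>\<^bsub>A\<^esub> rep Y n)),
     one = undefined,
     zero = completion_class A (nrm A) (\<lambda>n. \<zero>\<^bsub>A\<^esub>),
     add = (\<lambda>X Y. completion_class A (nrm A) (\<lambda>n. rep X n \<oplus>\<^bsub>A\<^esub> rep Y n)),
     smult = (\<lambda>c X. completion_class A (nrm A) (\<lambda>n. c \<odot>\<^bsub>A\<^esub> rep X n)),
     star = (\<lambda>X. completion_class A (nrm A) (\<lambda>n. star A (rep X n))),
     nrm = completion_norm (nrm A)\<rparr>"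


section \<open>The left and right algebras of a ternary ring\<close>

text \<open>
  Maps on \<open>F\<close> are represented extensionally (\<^const>\<open>undefined\<close> off the carrier), so that
  equality of functions is equality of maps on the carrier.
\<close>

definition map_space :: "('a, 'm) tring_scheme \<Rightarrow> (complex, 'a \<Rightarrow> 'a) module"
  where "map_space F =
    \<lparr>carrier = carrier F \<rightarrow>\<^sub>E carrier F,
     mult = undefined,
     one = undefined,
     zero = (\<lambda>x\<in>carrier F. \<zero>\<^bsub>F\<^esub>),
     add = (\<lambda>f g. \<lambda>x\<in>carrier F. f x \<oplus>\<^bsub>F\<^esub> g x),
     smult = (\<lambda>c f. \<lambda>x\<in>carrier F. c \<odot>\<^bsub>F\<^esub> f x)\<rparr>"

definition ip_r :: "('a, 'm) tring_scheme \<Rightarrow> 'a \<Rightarrow> 'a \<Rightarrow> 'a \<Rightarrow> 'a"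
  where "ip_r F y z = (\<lambda>x\<in>carrier F. tprod F x y z)"

definition ip_l :: "('a, 'm) tring_scheme \<Rightarrow> 'a \<Rightarrow> 'a \<Rightarrow> 'a \<Rightarrow> 'a"
  where "ip_l F x y = (\<lambda>z\<in>carrier F. tprod F x y z)"

definition span_r :: "('a, 'm) tring_scheme \<Rightarrow> ('a \<Rightarrow> 'a) set"
  where "span_r F = lin_span (map_space F) {ip_r F y z | y z. y \<in> carrier F \<and> z \<in> carrier F}"

definition span_l :: "('a, 'm) tring_scheme \<Rightarrow> ('a \<Rightarrow> 'a) set"
  where "span_l F = lin_span (map_space F) {ip_l F x y | x y. x \<in> carrier F \<and> y \<in> carrier F}"

definition conj_linear_on ::
    "(complex, 'a, 'm) module_scheme \<Rightarrow> 'a set \<Rightarrow> ('a \<Rightarrow> 'a) \<Rightarrow> bool"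
  where "conj_linear_on V W f \<longleftrightarrow>
    (\<forall>a\<in>W. f a \<in> W) \<and>
    (\<forall>a\<in>W. \<forall>b\<in>W. f (a \<oplus>\<^bsub>V\<^esub> b) = f a \<oplus>\<^bsub>V\<^esub> f b) \<and>
    (\<forall>c. \<forall>a\<in>W. f (c \<odot>\<^bsub>V\<^esub> a) = cnj c \<odot>\<^bsub>V\<^esub> f a)"

text \<open>
  The conditions below determine the involutions on the spans. Choice is used rather than
  definite description only because values outside the span are not determined.
\<close>

definition star_r :: "('a, 'm) tring_scheme \<Rightarrow> ('a \<Rightarrow> 'a) \<Rightarrow> ('a \<Rightarrow> 'a)"
  where "star_r F = (SOME f. conj_linear_on (map_space F) (span_r F) f \<and>
    (\<forall>y\<in>carrier F. \<forall>z\<in>carrier F. f (ip_r F y z) = ip_r F z y))"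

definition star_l :: "('a, 'm) tring_scheme \<Rightarrow> ('a \<Rightarrow> 'a) \<Rightarrow> ('a \<Rightarrow> 'a)"
  where "star_l F = (SOME f. conj_linear_on (map_space F) (span_l F) f \<and>
    (\<forall>x\<in>carrier F. \<forall>y\<in>carrier F. f (ip_l F x y) = ip_l F y x))"

definition op_norm :: "('a, 'm) tring_scheme \<Rightarrow> ('a \<Rightarrow> real) \<Rightarrow> ('a \<Rightarrow> 'a) \<Rightarrow> real"
  where "op_norm F \<gamma> a = Sup {\<gamma> (a x) | x. x \<in> carrier F \<and> \<gamma> x \<le> 1}"

text \<open>In the right algebra, \<open>x(ab) = (xa)b\<close>: the product is opposite to composition.\<close>

definition right_alg0 :: "('a, 'm) tring_scheme \<Rightarrow> ('a \<Rightarrow> real) \<Rightarrow> ('a \<Rightarrow> 'a) normed_star_alg"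
  where "right_alg0 F \<gamma> =
    \<lparr>carrier = span_r F,
     mult = (\<lambda>a b. compose (carrier F) b a),
     one = undefined,
     zero = \<zero>\<^bsub>map_space F\<^esub>,
     add = add (map_space F),
     smult = smult (map_space F),
     star = star_r F,
     nrm = op_norm F \<gamma>\<rparr>"

definition left_alg0 :: "('a, 'm) tring_scheme \<Rightarrow> ('a \<Rightarrow> real) \<Rightarrow> ('a \<Rightarrow> 'a) normed_star_alg"
  where "left_alg0 F \<gamma> =
    \<lparr>carrier = span_l F,
     mult = (\<lambda>a b. compose (carrier F) a b),
     one = undefined,
     zero = \<zero>\<^bsub>map_space F\<^esub>,
     add = add (map_space F),
     smult = smult (map_space F),
     star = star_l F,
     nrm = op_norm F \<gamma>\<rparr>"

definition right_alg ::
    "('a, 'm) tring_scheme \<Rightarrow> ('a \<Rightarrow> real) \<Rightarrow> (nat \<Rightarrow> 'a \<Rightarrow> 'a) set normed_star_alg"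
  where "right_alg F \<gamma> = alg_completion (right_alg0 F \<gamma>)"

definition left_alg ::
    "('a, 'm) tring_scheme \<Rightarrow> ('a \<Rightarrow> real) \<Rightarrow> (nat \<Rightarrow> 'a \<Rightarrow> 'a) set normed_star_alg"
  where "left_alg F \<gamma> = alg_completion (left_alg0 F \<gamma>)"


section \<open>Morita-Rieffel equivalence\<close>

locale full_left_hilbert_module = A: cstar_algebra A + X: module complex_field X
  for A :: "('a, 'm) normed_star_alg_scheme"
    and X :: "(complex, 'x, 'n) module_scheme" +
  fixes lact :: "'a \<Rightarrow> 'x \<Rightarrow> 'x" and lip :: "'x \<Rightarrow> 'x \<Rightarrow> 'a"
  assumes lact_closed: "\<lbrakk>a \<in> carrier A; x \<in> carrier X\<rbrakk> \<Longrightarrow> lact a x \<in> carrier X"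
    and lact_add_l: "\<lbrakk>a \<in> carrier A; b \<in> carrier A; x \<in> carrier X\<rbrakk> \<Longrightarrow>
      lact (a \<oplus>\<^bsub>A\<^esub> b) x = lact a x \<oplus>\<^bsub>X\<^esub> lact b x"
    and lact_add_r: "\<lbrakk>a \<in> carrier A; x \<in> carrier X; y \<in> carrier X\<rbrakk> \<Longrightarrow>
      lact a (x \<oplus>\<^bsub>X\<^esub> y) = lact a x \<oplus>\<^bsub>X\<^esub> lact a y"
    and lact_smult_l: "\<lbrakk>a \<in> carrier A; x \<in> carrier X\<rbrakk> \<Longrightarrow>
      lact (k \<odot>\<^bsub>A\<^esub> a) x = k \<odot>\<^bsub>X\<^esub> lact a x"
    and lact_smult_r: "\<lbrakk>a \<in> carrier A; x \<in> carrier X\<rbrakk> \<Longrightarrow>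
      lact a (k \<odot>\<^bsub>X\<^esub> x) = k \<odot>\<^bsub>X\<^esub> lact a x"
    and lact_mult: "\<lbrakk>a \<in> carrier A; b \<in> carrier A; x \<in> carrier X\<rbrakk> \<Longrightarrow>
      lact (a \<otimes>\<^bsub>A\<^esub> b) x = lact a (lact b x)"
    and lip_closed: "\<lbrakk>x \<in> carrier X; y \<in> carrier X\<rbrakk> \<Longrightarrow> lip x y \<in> carrier A"
    and lip_add: "\<lbrakk>x \<in> carrier X; y \<in> carrier X; z \<in> carrier X\<rbrakk> \<Longrightarrow>
      lip (x \<oplus>\<^bsub>X\<^esub> y) z = lip x z \<oplus>\<^bsub>A\<^esub> lip y z"
    and lip_smult: "\<lbrakk>x \<in> carrier X; y \<in> carrier X\<rbrakk> \<Longrightarrow>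
      lip (k \<odot>\<^bsub>X\<^esub> x) y = k \<odot>\<^bsub>A\<^esub> lip x y"
    and lip_lact: "\<lbrakk>a \<in> carrier A; x \<in> carrier X; y \<in> carrier X\<rbrakk> \<Longrightarrow>
      lip (lact a x) y = a \<otimes>\<^bsub>A\<^esub> lip x y"
    and lip_star: "\<lbrakk>x \<in> carrier X; y \<in> carrier X\<rbrakk> \<Longrightarrow> star A (lip x y) = lip y x"
    and lip_positive: "x \<in> carrier X \<Longrightarrow> positive_in A (lip x x)"
    and lip_definite: "\<lbrakk>x \<in> carrier X; lip x x = \<zero>\<^bsub>A\<^esub>\<rbrakk> \<Longrightarrow> x = \<zero>\<^bsub>X\<^esub>"
    and lip_complete: "complete_in X (\<lambda>x. sqrt (nrm A (lip x x)))"
    and lip_full: "\<lbrakk>a \<in> carrier A; 0 < e\<rbrakk> \<Longrightarrow>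
      \<exists>b\<in>lin_span A {lip x y | x y. x \<in> carrier X \<and> y \<in> carrier X}. nrm A (a \<ominus>\<^bsub>A\<^esub> b) < e"

locale full_right_hilbert_module = B: cstar_algebra B + X: module complex_field X
  for B :: "('b, 'm) normed_star_alg_scheme"
    and X :: "(complex, 'x, 'n) module_scheme" +
  fixes ract :: "'x \<Rightarrow> 'b \<Rightarrow> 'x" and rip :: "'x \<Rightarrow> 'x \<Rightarrow> 'b"
  assumes ract_closed: "\<lbrakk>x \<in> carrier X; b \<in> carrier B\<rbrakk> \<Longrightarrow> ract x b \<in> carrier X"
    and ract_add_l: "\<lbrakk>x \<in> carrier X; y \<in> carrier X; b \<in> carrier B\<rbrakk> \<Longrightarrow>
      ract (x \<oplus>\<^bsub>X\<^esub> y) b = ract x b \<oplus>\<^bsub>X\<^esub> ract y b"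
    and ract_add_r: "\<lbrakk>x \<in> carrier X; b \<in> carrier B; c \<in> carrier B\<rbrakk> \<Longrightarrow>
      ract x (b \<oplus>\<^bsub>B\<^esub> c) = ract x b \<oplus>\<^bsub>X\<^esub> ract x c"
    and ract_smult_l: "\<lbrakk>x \<in> carrier X; b \<in> carrier B\<rbrakk> \<Longrightarrow>
      ract (k \<odot>\<^bsub>X\<^esub> x) b = k \<odot>\<^bsub>X\<^esub> ract x b"
    and ract_smult_r: "\<lbrakk>x \<in> carrier X; b \<in> carrier B\<rbrakk> \<Longrightarrow>
      ract x (k \<odot>\<^bsub>B\<^esub> b) = k \<odot>\<^bsub>X\<^esub> ract x b"
    and ract_mult: "\<lbrakk>x \<in> carrier X; b \<in> carrier B; c \<in> carrier B\<rbrakk> \<Longrightarrow>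
      ract x (b \<otimes>\<^bsub>B\<^esub> c) = ract (ract x b) c"
    and rip_closed: "\<lbrakk>x \<in> carrier X; y \<in> carrier X\<rbrakk> \<Longrightarrow> rip x y \<in> carrier B"
    and rip_add: "\<lbrakk>x \<in> carrier X; y \<in> carrier X; z \<in> carrier X\<rbrakk> \<Longrightarrow>
      rip x (y \<oplus>\<^bsub>X\<^esub> z) = rip x y \<oplus>\<^bsub>B\<^esub> rip x z"
    and rip_smult: "\<lbrakk>x \<in> carrier X; y \<in> carrier X\<rbrakk> \<Longrightarrow>
      rip x (k \<odot>\<^bsub>X\<^esub> y) = k \<odot>\<^bsub>B\<^esub> rip x y"
    and rip_ract: "\<lbrakk>x \<in> carrier X; y \<in> carrier X; b \<in> carrier B\<rbrakk> \<Longrightarrow>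
      rip x (ract y b) = rip x y \<otimes>\<^bsub>B\<^esub> b"
    and rip_star: "\<lbrakk>x \<in> carrier X; y \<in> carrier X\<rbrakk> \<Longrightarrow> star B (rip x y) = rip y x"
    and rip_positive: "x \<in> carrier X \<Longrightarrow> positive_in B (rip x x)"
    and rip_definite: "\<lbrakk>x \<in> carrier X; rip x x = \<zero>\<^bsub>B\<^esub>\<rbrakk> \<Longrightarrow> x = \<zero>\<^bsub>X\<^esub>"
    and rip_complete: "complete_in X (\<lambda>x. sqrt (nrm B (rip x x)))"
    and rip_full: "\<lbrakk>b \<in> carrier B; 0 < e\<rbrakk> \<Longrightarrow>
      \<exists>c\<in>lin_span B {rip x y | x y. x \<in> carrier X \<and> y \<in> carrier X}. nrm B (b \<ominus>\<^bsub>B\<^esub> c) < e"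

locale imprimitivity_bimodule =
  full_left_hilbert_module A X lact lip + full_right_hilbert_module B X ract rip
  for A :: "('a, 'm) normed_star_alg_scheme"
    and B :: "('b, 'n) normed_star_alg_scheme"
    and X :: "(complex, 'x, 'k) module_scheme"
    and lact lip ract rip +
  assumes lact_ract: "\<lbrakk>a \<in> carrier A; x \<in> carrier X; b \<in> carrier B\<rbrakk> \<Longrightarrow>
      ract (lact a x) b = lact a (ract x b)"
    and rip_lact: "\<lbrakk>a \<in> carrier A; x \<in> carrier X; y \<in> carrier X\<rbrakk> \<Longrightarrow>
      rip (lact a x) y = rip x (lact (star A a) y)"
    and lip_ract: "\<lbrakk>x \<in> carrier X; b \<in> carrier B; y \<in> carrier X\<rbrakk> \<Longrightarrow>
      lip (ract x b) y = lip x (ract y (star B b))"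
    and lip_rip: "\<lbrakk>x \<in> carrier X; y \<in> carrier X; z \<in> carrier X\<rbrakk> \<Longrightarrow>
      lact (lip x y) z = ract x (rip y z)"

text \<open>
  HOL cannot quantify over types inside a formula, so the type \<open>'x\<close> in which the carrier of the
  bimodule is sought is a parameter. Existence within a given type entails existence outright.
\<close>

definition morita_rieffel_equivalent ::
    "'x itself \<Rightarrow> ('a, 'm) normed_star_alg_scheme \<Rightarrow> ('b, 'n) normed_star_alg_scheme \<Rightarrow> bool"
  where "morita_rieffel_equivalent (_ :: 'x itself) A B \<longleftrightarrow>
    cstar_algebra A \<and> cstar_algebra B \<and>
    (\<exists>(X :: (complex, 'x) module) lact lip ract rip.
      imprimitivity_bimodule A B X lact lip ract rip)"

end

theory Submission
  imports Defs "HOL-Analysis.Analysis" "HOL-Real_Asymp.Real_Asymp"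
begin

text \<open>
  The inner products \<open>\<langle>x, y\<rangle>\<^sub>l\<close>, \<open>\<langle>x, y\<rangle>\<^sub>r\<close> of a C*-tring \<open>F\<close> need not be positive: replacing the ternary
  product by its negative gives a C*-tring again. As in Zettl's theorem, \<open>F\<close> splits into
  a part where they are positive and a part where they are negative. For a single \<open>x\<close> the splitting
  comes from the sign of the selfadjoint multiplier \<open>\<langle>x, x\<rangle>\<^sub>r\<close>, which needs only square roots and resolvents;
  that the two parts are orthogonal subspaces follows from Kaplansky's argument that \<open>c\<^sup>* c\<close>
  cannot be the negative of a square. If \<open>sg\<close> is the involution of \<open>F\<close> that is \<open>1\<close> on the positive and \<open>-1\<close> on the negative
  part, then \<open>sg\<close> can be moved through all arguments of the ternary product, so \<open>F\<close> with
  the inner products \<open>\<langle>x, sg y\<rangle>\<^sub>l\<close> and \<open>\<langle>sg x, y\<rangle>\<^sub>r\<close> is an imprimitivity bimodule.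
\<close>

section \<open>Unital C*-algebras\<close>

text \<open>The sign of a selfadjoint multiplier is discontinuous at 0 and is in general no
  multiplier itself. What does exist is its product with \<open>x\<close>, since \<open>x\<close> is
  small wherever its inner product with itself is: \<open>x\<close> is factored through a power of a
  root of the absolute value, and the sign is absorbed by the powers that are left. A sign read off
  from the right inner product must be valid for the left one as well, so it is certified by a
  single element \<open>p\<close>, whose cube \<open>(p, p, p)\<close> ties the squares of both its
  inner products to those of the signed element. That sums of positive elements are positive is not
  visible from such certificates; it is settled only after orthogonality, by which each part is the
  annihilator of the other. Orthogonality comes from looking at one element from both sides: the
  opposite product exchanges left and right, and a further minus sign exchanges positive and
  negative. The opposite product also yields the right Hilbert module from the left one.\<close>

text \<open>Real algebras are used, because the library has no class of complex normed algebras; the central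
  element \<open>imu\<close> is the imaginary unit. The zero algebra is admitted.\<close>

class unital_cstar = real_normed_algebra + monoid_mult + banach +
  fixes adj :: "'a \<Rightarrow> 'a" and imu :: "'a"
  assumes adj_add: "adj (a + b) = adj a + adj b"
    and adj_scaleR: "adj (r *\<^sub>R a) = r *\<^sub>R adj a"
    and adj_mult: "adj (a * b) = adj b * adj a"
    and adj_adj [simp]: "adj (adj a) = a"
    and norm_adj_mult: "norm (adj a * a) = (norm a)\<^sup>2"
    and imu_imu [simp]: "imu * imu = - 1"
    and imu_commute: "imu * a = a * imu"
    and adj_imu [simp]: "adj imu = - imu"

section \<open>The involution and the norm\<close>

lemma adj_one [simp]: "adj (1::'a::unital_cstar) = 1"
  by (metis adj_adj adj_mult mult_1_left mult_1_right)

lemma adj_zero [simp]: "adj (0::'a::unital_cstar) = 0"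
  using adj_add[of "0::'a" 0] by simp

lemma adj_minus: "adj (- a :: 'a::unital_cstar) = - adj a"
  using adj_add[of a "- a"] by (simp add: eq_neg_iff_add_eq_0 add.commute)

lemma adj_diff: "adj (a - b :: 'a::unital_cstar) = adj a - adj b"
  using adj_add[of a "- b"] by (simp add: adj_minus)

lemma adj_power: "adj (a ^ n :: 'a::unital_cstar) = adj a ^ n"
  by (induction n) (simp_all add: adj_mult power_commutes)

lemma norm_adj [simp]: "norm (adj a) = norm (a::'a::unital_cstar)"
proof -
  have le: "norm b \<le> norm (adj b)" for b :: 'a
  proof (cases "b = 0")
    case False
    have "norm b * norm b \<le> norm (adj b) * norm b"
      using norm_adj_mult[of b] norm_mult_ineq[of "adj b" b] by (simp add: power2_eq_square)
    then show ?thesis using False by simp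
  qed simp
  show ?thesis using le[of a] le[of "adj a"] by simp
qed

text \<open>In the zero algebra \<open>1 = 0\<close>, so equality cannot be claimed.\<close>

lemma norm_one_le: "norm (1::'a::unital_cstar) \<le> 1"
  using norm_adj_mult[of "1::'a"] by (cases "norm (1::'a) = 0") (simp_all add: power2_eq_square)

lemma norm_power_le: "norm (a ^ n) \<le> norm (a::'a::unital_cstar) ^ n"
proof (induction n)
  case (Suc n)
  then show ?case
    using norm_mult_ineq[of a "a ^ n"] by (simp add: mult_left_mono order_trans)
qed (simp add: norm_one_le)

lemma adj_mult_eq_0: "adj a * a = 0 \<Longrightarrow> a = (0::'a::unital_cstar)"
  using norm_adj_mult[of a] by simp

lemma norm_square_sa: "adj a = a \<Longrightarrow> norm (a * a) = (norm (a::'a::unital_cstar))\<^sup>2"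
  using norm_adj_mult[of a] by simp

lemma bounded_linear_adj: "bounded_linear (adj :: 'a::unital_cstar \<Rightarrow> 'a)"
  by (rule bounded_linear_intro[where K = 1]) (simp_all add: adj_add adj_scaleR)

lemmas tendsto_adj = bounded_linear.tendsto[OF bounded_linear_adj]

text \<open>The iterates converge to \<open>1 - sqrt (1 - q)\<close>.\<close>

primrec sqrt_iter :: "'a::unital_cstar \<Rightarrow> nat \<Rightarrow> 'a" where
  "sqrt_iter q 0 = 0"
| "sqrt_iter q (Suc n) = (1/2) *\<^sub>R (q + sqrt_iter q n * sqrt_iter q n)"

text \<open>The iteration for the scalar \<open>q = 1\<close>. It increases within the unit interval
  and dominates both the iterates and their increments for every \<open>q\<close> in the unit
  ball.\<close>

primrec sqrt_maj :: "nat \<Rightarrow> real" where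
  "sqrt_maj 0 = 0"
| "sqrt_maj (Suc n) = (1 + sqrt_maj n * sqrt_maj n) / 2"

lemma sqrt_maj_bounds: "0 \<le> sqrt_maj n \<and> sqrt_maj n \<le> 1 \<and> sqrt_maj n \<le> sqrt_maj (Suc n)"
proof -
  have b: "0 \<le> sqrt_maj n \<and> sqrt_maj n \<le> 1" for n
    by (induction n) (auto intro: mult_le_one)
  \<comment> \<open>The increment of the scalar iteration is half of this square.\<close>
  have "(1 - sqrt_maj n)\<^sup>2 \<ge> 0" by simp
  then have "sqrt_maj n \<le> sqrt_maj (Suc n)" by (simp add: power2_eq_square algebra_simps)
  with b show ?thesis by blast
qed

text \<open>The increment of a square is split as \<open>(z - y) * z + y * (z - y)\<close>, which
  needs no commutativity; each summand is dominated by the corresponding one of the scalar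
  iteration.\<close>

lemma sqrt_iter_bounds:
  fixes q :: "'a::unital_cstar"
  assumes "norm q \<le> 1"
  shows "norm (sqrt_iter q n) \<le> sqrt_maj n \<and>
    norm (sqrt_iter q (Suc n) - sqrt_iter q n) \<le> sqrt_maj (Suc n) - sqrt_maj n"
proof -
  have b: "norm (sqrt_iter q n) \<le> sqrt_maj n" for n
  proof (induction n)
    case (Suc n)
    have "norm (sqrt_iter q n * sqrt_iter q n) \<le> sqrt_maj n * sqrt_maj n"
      by (rule order_trans[OF norm_mult_ineq mult_mono[OF Suc Suc]]) (auto simp: sqrt_maj_bounds)
    with assms norm_triangle_ineq[of q "sqrt_iter q n * sqrt_iter q n"] show ?case by simp
  qed simp
  have "norm (sqrt_iter q (Suc n) - sqrt_iter q n) \<le> sqrt_maj (Suc n) - sqrt_maj n"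
  proof (induction n)
    case (Suc n)
    let ?y = "sqrt_iter q n" and ?z = "sqrt_iter q (Suc n)"
    let ?c = "sqrt_maj n" and ?d = "sqrt_maj (Suc n)"
    have "sqrt_iter q (Suc (Suc n)) - ?z = (1/2) *\<^sub>R ((?z - ?y) * ?z + ?y * (?z - ?y))"
      by (simp only: sqrt_iter.simps(2)[of q "Suc n"] sqrt_iter.simps(2)[of q n] flip: scaleR_diff_right)
         (simp add: algebra_simps del: sqrt_iter.simps)
    moreover have "norm ((?z - ?y) * ?z) \<le> (?d - ?c) * ?d"
      by (rule order_trans[OF norm_mult_ineq mult_mono[OF Suc b]])
         (use sqrt_maj_bounds[of n] in auto)
    moreover have "norm (?y * (?z - ?y)) \<le> ?c * (?d - ?c)"
      by (rule order_trans[OF norm_mult_ineq mult_mono[OF b Suc]])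
         (use sqrt_maj_bounds[of n] in auto)
    ultimately have "norm (sqrt_iter q (Suc (Suc n)) - ?z) \<le> ((?d - ?c) * ?d + ?c * (?d - ?c)) / 2"
      using norm_triangle_ineq[of "(?z - ?y) * ?z" "?y * (?z - ?y)"] 
      by (simp del: sqrt_iter.simps sqrt_maj.simps)
    also have "\<dots> = (1 + ?d * ?d) / 2 - (1 + ?c * ?c) / 2" by (simp add: field_simps del: sqrt_maj.simps)
    finally show ?case by (simp only: sqrt_maj.simps(2)[of "Suc n"] sqrt_maj.simps(2)[of n])
  qed (use assms in simp)
  with b show ?thesis by blast
qed

text \<open>The limit \<open>y\<close> satisfies \<open>2 y = q + y * y\<close>, that is,
  \<open>(1 - y) * (1 - y) = 1 - q\<close>. Selfadjointness and commutation hold for all iterates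
  and pass to the limit; they stand in for functional calculus, and the bound on
  \<open>1 - r\<close> permits extracting a root of \<open>r\<close> again.\<close>

lemma sqrt_one_minus:
  fixes q :: "'a::unital_cstar"
  assumes "norm q \<le> 1"
  obtains r where "r * r = 1 - q" "norm (1 - r) \<le> 1" "adj q = q \<Longrightarrow> adj r = r"
    "\<And>b. b * q = q * b \<Longrightarrow> b * r = r * b"
proof -
  let ?y = "sqrt_iter q"
  \<comment> \<open>Telescoping against the convergent scalar iteration will make the iterates
    Cauchy.\<close>
  have diff: "norm (?y (n + k) - ?y n) \<le> sqrt_maj (n + k) - sqrt_maj n" for n k
  proof (induction k)
    case (Suc k)
    have "norm (?y (n + Suc k) - ?y n) \<le> norm (?y (Suc (n + k)) - ?y (n + k)) + norm (?y (n + k) - ?y n)"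
      using norm_triangle_ineq[of "?y (Suc (n + k)) - ?y (n + k)" "?y (n + k) - ?y n"] 
      by (simp del: sqrt_iter.simps)
    with Suc sqrt_iter_bounds[OF assms, of "n + k"] show ?case
      by (simp del: sqrt_iter.simps sqrt_maj.simps)
  qed simp
  have "convergent sqrt_maj"
    by (rule Bseq_monoseq_convergent)
       (auto simp: Bseq_def monoseq_Suc sqrt_maj_bounds simp del: sqrt_maj.simps intro!: exI[of _ 1])
  then have C: "Cauchy sqrt_maj" by (rule convergent_Cauchy)
  have "Cauchy ?y"
  proof (rule CauchyI)
    fix e :: real assume "e > 0"
    with C obtain M where M: "\<And>m n. m \<ge> M \<Longrightarrow> n \<ge> M \<Longrightarrow> norm (sqrt_maj m - sqrt_maj n) < e"
      using CauchyD by blast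
    have "norm (?y m - ?y n) < e" if "m \<ge> n" "n \<ge> M" for m n
      using diff[of n "m - n"] that M[of m n] by simp
    then have "norm (?y m - ?y n) < e" if "m \<ge> M" "n \<ge> M" for m n
      using that by (metis nle_le norm_minus_commute)
    then show "\<exists>M. \<forall>m\<ge>M. \<forall>n\<ge>M. norm (?y m - ?y n) < e" by blast
  qed
  then obtain y where y: "?y \<longlonglongrightarrow> y" using convergent_eq_Cauchy by blast
  have "(\<lambda>n. ?y (Suc n)) \<longlonglongrightarrow> (1/2) *\<^sub>R (q + y * y)"
    unfolding sqrt_iter.simps by (intro tendsto_intros y)
  then have eq: "y = (1/2) *\<^sub>R (q + y * y)"
    using LIMSEQ_unique LIMSEQ_Suc[OF y] by blast
  have "y + y = q + y * y"
    by (subst (1 2) eq) (simp flip: scaleR_left_distrib)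
  then have "(1 - y) * (1 - y) = 1 - q" by (simp add: algebra_simps)
  moreover have "norm (?y n) \<le> 1" for n
    using sqrt_iter_bounds[OF assms, of n] sqrt_maj_bounds[of n] by linarith
  then have "norm (1 - (1 - y)) \<le> 1"
    by (auto intro: LIMSEQ_le_const2[OF tendsto_norm[OF y]])
  moreover have "adj (1 - y) = 1 - y" if "adj q = q"
  proof -
    have "adj (?y n) = ?y n" for n
      by (induction n) (simp_all add: adj_add adj_scaleR adj_mult that)
    then have "?y \<longlonglongrightarrow> adj y" using tendsto_adj[OF y] by simp
    then show ?thesis using y LIMSEQ_unique by (auto simp: adj_diff)
  qed
  moreover have "b * (1 - y) = (1 - y) * b" if "b * q = q * b" for b
  proof -
    have "b * ?y n = ?y n * b" for n
    proof (induction n)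
      case (Suc n)
      then have "b * (?y n * ?y n) = (?y n * ?y n) * b" by (metis mult.assoc)
      then show ?case by (simp add: that algebra_simps)
    qed simp
    moreover have "(\<lambda>n. b * ?y n) \<longlonglongrightarrow> b * y" "(\<lambda>n. ?y n * b) \<longlonglongrightarrow> y * b"
      by (intro tendsto_intros y)+
    ultimately show ?thesis using LIMSEQ_unique by (simp add: algebra_simps)
  qed
  ultimately show ?thesis using that[of "1 - y"] by blast
qed

section \<open>Positive elements and their square roots\<close>

lemma imu_mult_square: "imu * a * (imu * a) = - (a * a :: 'a::unital_cstar)"
proof -
  have "imu * a * (imu * a) = imu * (a * imu) * a" by (simp add: mult.assoc)
  also have "\<dots> = imu * imu * a * a" by (simp only: imu_commute[of a, symmetric] mult.assoc)
  finally show ?thesis by simp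
qed

text \<open>\<open>h + i sqrt (1 - h\<^sup>2)\<close> is unitary.\<close>

lemma norm_one_minus_square:
  fixes h :: "'a::unital_cstar"
  assumes sa: "adj h = h" and h: "norm h \<le> 1"
  shows "norm (1 - h * h) \<le> 1"
proof -
  have "norm (h * h) \<le> 1" using h norm_mult_ineq[of h h] by (meson mult_le_one norm_ge_zero order_trans)
  then obtain r where r: "r * r = 1 - h * h" "adj (h * h) = h * h \<Longrightarrow> adj r = r"
    "\<And>b. b * (h * h) = h * h * b \<Longrightarrow> b * r = r * b"
    using sqrt_one_minus by metis
  have ra: "adj r = r" using r(2) sa by (simp add: adj_mult)
  have hr: "h * r = r * h" using r(3)[of h] by (simp add: mult.assoc)
  let ?u = "h + imu * r"
  have au: "adj ?u = h - imu * r" by (simp add: adj_add adj_mult sa ra imu_commute)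
  have "imu * r * (imu * r) = - (r * r)"
    by (rule imu_mult_square)
  moreover have "h * (imu * r) = imu * r * h" by (metis hr imu_commute mult.assoc)
  ultimately have "adj ?u * ?u = 1"
    unfolding au by (simp add: algebra_simps r(1))
  then have "(norm ?u)\<^sup>2 = norm (1::'a)" using norm_adj_mult[of ?u] by simp
  then have u: "norm ?u \<le> 1" using norm_one_le[where 'a='a] by - (rule power2_le_imp_le, simp_all)
  \<comment> \<open>As the imaginary part of the contraction \<open>?u\<close>, this is a
    contraction; its square is \<open>- (1 - h * h)\<close>, whose norm is to be bounded.\<close>
  have "imu * r = (1/2) *\<^sub>R (?u - adj ?u)" unfolding au by (simp flip: scaleR_2)
  from arg_cong[OF this, of norm] have "norm (imu * r) = norm (?u - adj ?u) / 2"
    by (simp only: norm_scaleR)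
  then have "norm (imu * r) \<le> 1"
    using u norm_triangle_ineq4[of ?u "adj ?u"] by (simp only: norm_adj)
  then have "norm (imu * r * (imu * r)) \<le> 1"
    using norm_mult_ineq[of "imu * r" "imu * r"] by (meson mult_le_one norm_ge_zero order_trans)
  then show ?thesis using \<open>imu * r * (imu * r) = - (r * r)\<close> r(1)
    by (simp add: norm_minus_commute)
qed

text \<open>The norm condition replaces nonnegativity of the spectrum; it is evidently stable under sums.\<close>

definition cpos :: "'a::unital_cstar \<Rightarrow> bool"
  where "cpos a \<longleftrightarrow> adj a = a \<and> (\<exists>L>0. norm (L *\<^sub>R 1 - a) \<le> L)"

lemma cpos_add: "cpos a \<Longrightarrow> cpos b \<Longrightarrow> cpos (a + b)"
proof -
  assume "cpos a" "cpos b"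
  then obtain K L where "K > 0" "L > 0" "norm (K *\<^sub>R 1 - a) \<le> K" "norm (L *\<^sub>R 1 - b) \<le> L"
    and sa: "adj a = a" "adj b = b"
    unfolding cpos_def by blast
  then have "norm ((K + L) *\<^sub>R 1 - (a + b)) \<le> K + L"
    using norm_triangle_ineq[of "K *\<^sub>R 1 - a" "L *\<^sub>R 1 - b"] by (simp add: algebra_simps)
  with sa \<open>K > 0\<close> \<open>L > 0\<close> show ?thesis 
    unfolding cpos_def by (auto simp: adj_add intro!: exI[of _ "K + L"])
qed

text \<open>After scaling \<open>h\<close> into the unit ball this is
  \<open>norm_one_minus_square\<close>. The witness for \<open>L\<close> is the square of the
  scaling factor \<open>N\<close>; the 1 added to the norm keeps \<open>N\<close> positive for
  \<open>h = 0\<close>.\<close>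

lemma cpos_square:
  assumes "adj h = h" shows "cpos (h * h)"
proof -
  define N where "N = norm h + 1"
  have N: "N > 0" unfolding N_def by (simp add: add_nonneg_pos)
  let ?h = "(1 / N) *\<^sub>R h"
  have "norm (1 - ?h * ?h) \<le> 1"
    by (rule norm_one_minus_square) (use N in \<open>auto simp: adj_scaleR assms N_def\<close>)
  then have "norm ((N * N) *\<^sub>R (1 - ?h * ?h)) \<le> N * N"
    using N by simp
  then have "norm ((N * N) *\<^sub>R 1 - h * h) \<le> N * N"
    using N by (simp add: scaleR_diff_right)
  then show ?thesis unfolding cpos_def using N assms
    by (auto simp: adj_mult intro!: exI[of _ "N * N"])
qed

text \<open>Divided by \<open>L\<close>, the norm condition says that \<open>1 - a / L\<close> is a
  contraction, which is all that \<open>sqrt_one_minus\<close> asks for.\<close>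

lemma cpos_sqrt:
  assumes "cpos a"
  obtains r where "r * r = a" "adj r = r" "\<And>b. b * a = a * b \<Longrightarrow> b * r = r * b"
proof -
  obtain L where L: "L > 0" "norm (L *\<^sub>R 1 - a) \<le> L" and sa: "adj a = a"
    using assms unfolding cpos_def by blast
  let ?q = "1 - (1 / L) *\<^sub>R a"
  have "?q = (1 / L) *\<^sub>R (L *\<^sub>R 1 - a)" using L by (simp add: scaleR_diff_right)
  then have "norm ?q \<le> 1" using L by simp
  then obtain r where r: "r * r = 1 - ?q" "adj ?q = ?q \<Longrightarrow> adj r = r"
    "\<And>b. b * ?q = ?q * b \<Longrightarrow> b * r = r * b"
    using sqrt_one_minus by metis
  show ?thesis
  proof (rule that[of "sqrt L *\<^sub>R r"])
    show "sqrt L *\<^sub>R r * sqrt L *\<^sub>R r = a" using r(1) L by simp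
    show "adj (sqrt L *\<^sub>R r) = sqrt L *\<^sub>R r" using r(2) sa by (simp add: adj_scaleR adj_diff)
    show "b * sqrt L *\<^sub>R r = sqrt L *\<^sub>R r * b" if "b * a = a * b" for b
      using r(3)[of b] that by (simp add: algebra_simps)
  qed
qed

text \<open>The roots \<open>r\<close> of \<open>a\<close> and \<open>s\<close> of
  \<open>- a\<close> commute, so \<open>u = r + imu * s\<close> has
  \<open>adj u * u = r * r + s * s = 0\<close>. Hence \<open>u\<close> vanishes, and with it its
  real part \<open>r\<close>.\<close>

lemma cpos_antisym:
  assumes "cpos a" "cpos (- a)" shows "a = 0"
proof -
  obtain r where r: "r * r = a" "adj r = r" "\<And>b. b * a = a * b \<Longrightarrow> b * r = r * b"
    using cpos_sqrt[OF assms(1)] by metis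
  obtain s where s: "s * s = - a" "adj s = s" "\<And>b. b * - a = - a * b \<Longrightarrow> b * s = s * b"
    using cpos_sqrt[OF assms(2)] by metis
  have "r * a = a * r" using r(1) by (metis mult.assoc)
  then have rs: "r * s = s * r" using s(3)[of r] by simp
  let ?u = "r + imu * s"
  have au: "adj ?u = r - imu * s" by (simp add: adj_add adj_mult r(2) s(2) imu_commute)
  have "imu * s * (imu * s) = - (s * s)"
    by (rule imu_mult_square)
  moreover have "r * (imu * s) = imu * s * r" by (metis rs imu_commute mult.assoc)
  ultimately have "adj ?u * ?u = r * r + s * s" unfolding au by (simp add: algebra_simps)
  then have "adj ?u * ?u = 0" using r(1) s(1) by simp
  then have u: "?u = 0" by (rule adj_mult_eq_0)
  from arg_cong[OF u, of adj] have "adj ?u = 0" by simp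
  with u have "(r + imu * s) + (r - imu * s) = 0" unfolding au by simp
  then have "r + r = 0" by simp
  then have "r = 0" by (simp flip: scaleR_2)
  then show ?thesis using r(1) by simp
qed

text \<open>The powers of \<open>y = K + d d\<^sup>*\<close> grow at most like \<open>n K ^ n\<close>, because \<open>y ^ n d d\<^sup>* = d (K + d\<^sup>* d) ^ n d\<^sup>*\<close>,
  while \<open>norm (y ^ 2 ^ n) = norm y ^ 2 ^ n\<close> by the C*-identity.\<close>

lemma norm_shift_swap:
  fixes d :: "'a::unital_cstar"
  assumes K: "K > 0" and le: "norm (K *\<^sub>R 1 + adj d * d) \<le> K"
  shows "norm (K *\<^sub>R 1 + d * adj d) \<le> K"
proof (rule ccontr)
  let ?x = "K *\<^sub>R 1 + adj d * d" and ?y = "K *\<^sub>R 1 + d * adj d"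
  define C where "C = (norm d)\<^sup>2"
  have comm: "?y ^ n * d = d * ?x ^ n" for n
  proof (induction n)
    case (Suc n)
    have "?y ^ Suc n * d = ?y * (?y ^ n * d)" by (simp add: mult.assoc)
    also have "\<dots> = ?y * d * ?x ^ n" by (simp add: Suc mult.assoc)
    also have "?y * d = d * ?x" by (simp add: algebra_simps)
    finally show ?case by (simp add: mult.assoc)
  qed simp
  have b: "norm (?y ^ n * (d * adj d)) \<le> C * K ^ n" for n
  proof -
    have "?y ^ n * (d * adj d) = d * ?x ^ n * adj d" by (metis comm mult.assoc)
    also have "norm \<dots> \<le> norm d * norm (?x ^ n) * norm (adj d)"
      by (meson mult_right_mono norm_ge_zero norm_mult_ineq order_trans)
    also have "\<dots> \<le> norm d * K ^ n * norm d"
      using order_trans[OF norm_power_le[of ?x n] power_mono[OF le]]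
      by (simp add: mult_left_mono mult_right_mono)
    finally show ?thesis by (simp add: C_def power2_eq_square mult_ac)
  qed
  have b2: "norm (?y ^ n) \<le> K ^ n * (1 + real n * C / K)" for n
  proof (induction n)
    case 0 then show ?case by (simp add: norm_one_le)
  next
    case (Suc n)
    have "?y ^ Suc n = K *\<^sub>R ?y ^ n + ?y ^ n * (d * adj d)"
      by (simp add: power_commutes[symmetric] algebra_simps del: power_commutes)
    moreover have "norm (K *\<^sub>R ?y ^ n) \<le> K * (K ^ n * (1 + real n * C / K))"
      using mult_left_mono[OF Suc, of K] K by (simp only: norm_scaleR) simp
    ultimately have "norm (?y ^ Suc n) \<le> K * (K ^ n * (1 + real n * C / K)) + C * K ^ n"
      using norm_triangle_ineq[of "K *\<^sub>R ?y ^ n" "?y ^ n * (d * adj d)"] b[of n] 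
      by (simp only:)
    also have "\<dots> = K ^ Suc n * (1 + real (Suc n) * C / K)" using K by (simp add: field_simps)
    finally show ?case .
  qed
  have sa: "adj (?y ^ n) = ?y ^ n" for n
    by (simp add: adj_power adj_add adj_scaleR adj_mult)
  have b3: "norm (?y ^ (2 ^ n)) = norm ?y ^ (2 ^ n)" for n
  proof (induction n)
    case (Suc n)
    have "norm (?y ^ (2 ^ Suc n)) = norm (?y ^ (2 ^ n) * ?y ^ (2 ^ n))"
      by (metis mult_2 power_Suc power_add)
    also have "\<dots> = (norm ?y ^ (2 ^ n))\<^sup>2" using norm_square_sa[OF sa] Suc by simp
    finally show ?case by (simp add: power_mult[symmetric] mult.commute)
  qed simp
  assume "\<not> norm ?y \<le> K"
  \<comment> \<open>By \<open>b2\<close> and \<open>b3\<close> the powers \<open>g ^ (2 ^ n)\<close>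
    would grow at most linearly in \<open>2 ^ n\<close>, which is false for
    \<open>g > 1\<close>.\<close>
  define g where "g = norm ?y / K"
  have g: "g > 1" using \<open>\<not> norm ?y \<le> K\<close> K by (simp add: g_def)
  have "g ^ (2 ^ n) \<le> 1 + real (2 ^ n) * C / K" for n
    using b2[of "2 ^ n"] b3[of n] K by (simp add: g_def power_divide field_simps)
  then have "g ^ (2 ^ n) / 2 ^ n \<le> 1 + C / K" for n
  proof -
    have "g ^ (2 ^ n) \<le> 2 ^ n * (1 + C / K)"
      using \<open>g ^ (2 ^ n) \<le> 1 + real (2 ^ n) * C / K\<close> 
      by (simp add: algebra_simps) (meson add_right_mono one_le_numeral one_le_power order_trans)
    then show ?thesis by (simp add: field_simps)
  qed
  moreover have "filterlim (\<lambda>n. g ^ n / real n) at_top sequentially"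
    using g by real_asymp
  then have "filterlim (\<lambda>n. g ^ (2 ^ n) / real (2 ^ n)) at_top sequentially"
    by (rule filterlim_compose) (rule filterlim_subseq, rule strict_monoI, simp)
  then obtain n where "g ^ (2 ^ n) / real (2 ^ n) > 1 + C / K"
    by (metis (no_types, lifting) eventually_sequentially filterlim_at_top_dense order_refl)
  ultimately show False by (metis not_less of_nat_numeral of_nat_power)
qed

text \<open>\<open>- c c\<^sup>*\<close> is positive along with \<open>- c\<^sup>* c\<close>, but \<open>c c\<^sup>* + c\<^sup>* c\<close> is a sum of squares of selfadjoint elements.\<close>

lemma kaplansky:
  fixes c :: "'a::unital_cstar"
  assumes eq: "adj c * c = - (r * r)" and r: "adj r = r"
  shows "c = 0"
proof -
  obtain L where L: "L > 0" "norm (L *\<^sub>R 1 - r * r) \<le> L"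
    using cpos_square[OF r] unfolding cpos_def by blast
  \<comment> \<open>\<open>norm_shift_swap\<close> does the work of the fact that
    \<open>adj c * c\<close> and \<open>c * adj c\<close> have the same nonzero spectrum.\<close>
  then have "norm (L *\<^sub>R 1 + c * adj c) \<le> L"
    by (intro norm_shift_swap) (simp_all add: eq)
  then have neg: "cpos (- (c * adj c))"
    unfolding cpos_def using L by (auto simp: adj_minus adj_mult)
  \<comment> \<open>\<open>h\<close> is the real part of \<open>c\<close>, and \<open>k\<close> is
    its imaginary part up to sign; in \<open>c * adj c + adj c * c\<close> the mixed terms cancel
    and \<open>2 (h * h + k * k)\<close> remains.\<close>
  define h where "h = (1/2) *\<^sub>R (c + adj c)"
  define k where "k = (1/2) *\<^sub>R (imu * (c - adj c))"
  have h: "adj h = h" by (simp add: h_def adj_scaleR adj_add add.commute)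
  have k: "adj k = k" by (simp add: k_def adj_scaleR adj_diff adj_mult imu_commute algebra_simps)
  let ?d = "c - adj c"
  have "h * h + k * k = (1/4) *\<^sub>R ((c + adj c) * (c + adj c) + imu * ?d * (imu * ?d))"
    unfolding h_def k_def mult_scaleR_left mult_scaleR_right scaleR_scaleR
      scaleR_right_distrib[of "1/4"]
    by simp
  also have "(c + adj c) * (c + adj c) + imu * ?d * (imu * ?d) = 2 *\<^sub>R (c * adj c + adj c * c)"
    unfolding imu_mult_square scaleR_2 by (simp add: algebra_simps)
  finally have "(h * h + k * k) + (h * h + k * k) = c * adj c + adj c * c"
    by (simp flip: scaleR_left_distrib)
  then have "h * h + h * h + (k * k + k * k) = c * adj c + adj c * c" by (simp add: ac_simps)
  \<comment> \<open>Since \<open>- (adj c * c) = r * r\<close>, solving for \<open>c * adj c\<close>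
    leaves a sum of squares, so that \<open>c * adj c\<close> and its negative are both
    positive.\<close>
  then have "c * adj c = h * h + h * h + (k * k + k * k) + r * r" using eq by simp
  then have "cpos (c * adj c)" by (metis cpos_add cpos_square h k r)
  then have "c * adj c = 0" using cpos_antisym neg by blast
  then show ?thesis using adj_mult_eq_0[of "adj c"] by (metis adj_adj adj_zero)
qed

text \<open>\<open>R\<close> is the inverse of \<open>l + e\<close>. The equation
  \<open>(1 + e) R = 1 + (1 - l) R\<close> makes it the fixed point of a contraction with factor
  \<open>1 / (1 + e)\<close>; the bound on \<open>1 - l\<close> plays the part of positivity of
  \<open>l\<close>.\<close>

lemma resolvent:
  fixes l :: "'a::unital_cstar"
  assumes l: "norm (1 - l) \<le> 1" and e: "e > 0"
  obtains R where "l * R = 1 - e *\<^sub>R R" "norm (e *\<^sub>R R) \<le> 1"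
    "\<And>b. b * l = l * b \<Longrightarrow> b * R = R * b" "adj l = l \<Longrightarrow> adj R = R"
proof -
  let ?q = "1 - l"
  define f where "f X = (1 / (1 + e)) *\<^sub>R (1 + ?q * X)" for X
  have dist: "norm (f X - f Y) \<le> (1 / (1 + e)) * norm (X - Y)" for X Y
  proof -
    have "f X - f Y = (1 / (1 + e)) *\<^sub>R (?q * (X - Y))"
      by (simp add: f_def algebra_simps flip: scaleR_diff_right)
    moreover have "norm (?q * (X - Y)) \<le> 1 * norm (X - Y)"
      using norm_mult_ineq l by (meson mult_right_mono norm_ge_zero order_trans)
    ultimately show ?thesis using e by (simp add: divide_right_mono)
  qed
  \<comment> \<open>The homogeneous equation has only the zero solution. Below, the commutator of
    \<open>b\<close> with \<open>R\<close> and the difference \<open>adj R - R\<close> are shown to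
    solve it.\<close>
  have uniq: "D = 0" if "D = (1 / (1 + e)) *\<^sub>R (?q * D)" for D
  proof -
    have "norm D \<le> (1 / (1 + e)) * norm D"
      using dist[of D 0] that by (simp add: f_def scaleR_right_distrib)
    then show ?thesis using e by (simp add: field_simps mult_le_0_iff)
  qed
  have "\<exists>!X\<in>UNIV. f X = X"
    by (rule Banach_fix[of _ "1 / (1 + e)"]) (use e dist in \<open>auto simp: complete_UNIV dist_norm\<close>)
  then obtain R where "f R = R" by blast
  then have "(1 + e) *\<^sub>R R = (1 + e) *\<^sub>R ((1 / (1 + e)) *\<^sub>R (1 + ?q * R))" unfolding f_def by simp
  then have R: "(1 + e) *\<^sub>R R = 1 + ?q * R" using e by simp
  have lR: "l * R = 1 - e *\<^sub>R R" using R by (simp add: algebra_simps)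
  have comm: "b * R = R * b" if "b * l = l * b" for b
  proof -
    have "b * ((1 + e) *\<^sub>R R) - (1 + e) *\<^sub>R R * b = b * (?q * R) - ?q * R * b" 
      by (simp only: R) (simp add: algebra_simps)
    then have "(1 + e) *\<^sub>R (b * R - R * b) = b * (?q * R) - ?q * R * b"
      by (simp add: scaleR_diff_right)
    also have "b * (?q * R) = ?q * (b * R)"
    proof -
      have "b * ?q = ?q * b" using that by (simp add: algebra_simps)
      then show ?thesis by (metis mult.assoc)
    qed
    finally have fin: "(1 + e) *\<^sub>R (b * R - R * b) = ?q * (b * R - R * b)"
      by (simp add: algebra_simps)
    then have "b * R - R * b = (1 / (1 + e)) *\<^sub>R (?q * (b * R - R * b))"
      using e by (simp add: fin[symmetric])
    then show ?thesis using uniq by fastforce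
  qed
  have "adj R = R" if "adj l = l"
  proof -
    have "(1 + e) *\<^sub>R adj R = adj ((1 + e) *\<^sub>R R)" by (simp add: adj_scaleR)
    also have "\<dots> = 1 + adj R * ?q" by (simp add: R adj_add adj_mult adj_diff that)
    also have "adj R * l = l * adj R"
      using arg_cong[OF comm[of l], of adj] that by (simp add: adj_mult)
    then have "adj R * ?q = ?q * adj R" by (simp add: algebra_simps)
    finally have fin: "(1 + e) *\<^sub>R (adj R - R) = ?q * (adj R - R)"
      using R by (simp add: scaleR_diff_right right_diff_distrib)
    then have "adj R - R = (1 / (1 + e)) *\<^sub>R (?q * (adj R - R))"
      using e by (simp add: fin[symmetric])
    then show ?thesis using uniq by fastforce
  qed
  moreover have "norm (e *\<^sub>R R) \<le> 1"
  proof -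
    have "(1 + e) * norm R \<le> norm (1::'a) + norm (?q * R)"
      using norm_triangle_ineq[of 1 "?q * R"] R[symmetric] e by simp
    also have "norm (?q * R) \<le> 1 * norm R"
      using norm_mult_ineq l by (meson mult_right_mono norm_ge_zero order_trans)
    finally show ?thesis using norm_one_le[where 'a='a] e by (simp add: algebra_simps)
  qed
  ultimately show ?thesis using that lR comm by blast
qed

section \<open>C*-ternary rings as a type class and their multipliers\<close>

text \<open>The structure on a whole type. Complex scalars are split into real ones and the isometry
  \<open>im\<close>, multiplication by the imaginary unit; the minus sign in \<open>tp_im2\<close>
  is conjugate linearity in the middle variable.\<close>

class cstar_triple = banach +
  fixes tp :: "'a \<Rightarrow> 'a \<Rightarrow> 'a \<Rightarrow> 'a" and im :: "'a \<Rightarrow> 'a"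
  assumes tp_add1: "tp (x + x') y z = tp x y z + tp x' y z"
    and tp_add2: "tp x (y + y') z = tp x y z + tp x y' z"
    and tp_add3: "tp x y (z + z') = tp x y z + tp x y z'"
    and tp_scaleR1: "tp (r *\<^sub>R x) y z = r *\<^sub>R tp x y z"
    and tp_scaleR2: "tp x (r *\<^sub>R y) z = r *\<^sub>R tp x y z"
    and tp_scaleR3: "tp x y (r *\<^sub>R z) = r *\<^sub>R tp x y z"
    and im_add: "im (x + y) = im x + im y"
    and im_scaleR: "im (r *\<^sub>R x) = r *\<^sub>R im x"
    and im_im: "im (im x) = - x"
    and norm_im: "norm (im x) = norm x"
    and tp_im1: "tp (im x) y z = im (tp x y z)"
    and tp_im2: "tp x (im y) z = - im (tp x y z)"
    and tp_im3: "tp x y (im z) = im (tp x y z)"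
    and tp_assoc12: "tp (tp x y z) u v = tp x (tp u z y) v"
    and tp_assoc13: "tp (tp x y z) u v = tp x y (tp z u v)"
    and norm_tp: "norm (tp x y z) \<le> norm x * norm y * norm z"
    and norm_tp_cube: "norm (tp x x x) = norm x ^ 3"

lemma tp_zero [simp]:
  fixes x y z :: "'a::cstar_triple"
  shows "tp 0 y z = 0" "tp x 0 z = 0" "tp x y 0 = 0"
  using tp_scaleR1[of 0 x y z] tp_scaleR2[of x 0 y z] tp_scaleR3[of x y 0 z] by simp_all

lemma tp_minus:
  fixes x y z :: "'a::cstar_triple"
  shows "tp (- x) y z = - tp x y z" "tp x (- y) z = - tp x y z" "tp x y (- z) = - tp x y z"
  using tp_scaleR1[of "-1" x y z] tp_scaleR2[of x "-1" y z] tp_scaleR3[of x y "-1" z] by simp_all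

lemma tp_diff:
  fixes x y z :: "'a::cstar_triple"
  shows "tp (x - x') y z = tp x y z - tp x' y z" "tp x (y - y') z = tp x y z - tp x y' z"
    "tp x y (z - z') = tp x y z - tp x y z'"
  using tp_add1[of x "- x'" y z] tp_add2[of x y "- y'" z] tp_add3[of x y z "- z'"]
  by (simp_all add: tp_minus)

lemma tp_cube_eq_0: "tp x x x = 0 \<Longrightarrow> x = (0::'a::cstar_triple)"
  using norm_tp_cube[of x] by simp

lemma bounded_linear_tp1: "bounded_linear (\<lambda>x. tp x y (z::'a::cstar_triple))"
  by (rule bounded_linear_intro[where K = "norm y * norm z"])
     (use norm_tp in \<open>simp_all add: tp_add1 tp_scaleR1 mult.assoc\<close>)

lemma bounded_linear_tp2: "bounded_linear (\<lambda>y. tp x y (z::'a::cstar_triple))"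
  by (rule bounded_linear_intro[where K = "norm x * norm z"])
     (use norm_tp[of x _ z] in \<open>simp_all add: tp_add2 tp_scaleR2 mult_ac\<close>)

lemma bounded_linear_tp3: "bounded_linear (\<lambda>z. tp x y (z::'a::cstar_triple))"
  by (rule bounded_linear_intro[where K = "norm x * norm y"])
     (use norm_tp[of x y] in \<open>simp_all add: tp_add3 tp_scaleR3 mult_ac\<close>)

lemma bounded_linear_im: "bounded_linear (im :: 'a::cstar_triple \<Rightarrow> 'a)"
  by (rule bounded_linear_intro[where K = 1]) (simp_all add: im_add im_scaleR norm_im)

lemmas tendsto_tp1 = bounded_linear.tendsto[OF bounded_linear_tp1]
lemmas tendsto_tp2 = bounded_linear.tendsto[OF bounded_linear_tp2]
lemmas tendsto_tp3 = bounded_linear.tendsto[OF bounded_linear_tp3]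

section \<open>The multiplier algebra\<close>

text \<open>Right multipliers: an adjointable operator is stored together with its adjoint.\<close>

definition adjoint_pair :: "('a::cstar_triple \<Rightarrow>\<^sub>L 'a) \<times> ('a \<Rightarrow>\<^sub>L 'a) \<Rightarrow> bool"
  where "adjoint_pair P \<longleftrightarrow> (\<forall>x y z.
    tp (blinfun_apply (fst P) x) y z = tp x (blinfun_apply (snd P) y) z \<and>
    tp (blinfun_apply (snd P) x) y z = tp x (blinfun_apply (fst P) y) z \<and>
    tp x y (blinfun_apply (fst P) z) = blinfun_apply (fst P) (tp x y z) \<and>
    tp x y (blinfun_apply (snd P) z) = blinfun_apply (snd P) (tp x y z))"

typedef (overloaded) 'a mult_alg = "{P :: ('a::cstar_triple \<Rightarrow>\<^sub>L 'a) \<times> ('a \<Rightarrow>\<^sub>L 'a). adjoint_pair P}"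
  by (rule exI[of _ "(0, 0)"]) (simp add: adjoint_pair_def zero_blinfun.rep_eq)

definition ract_m :: "'a::cstar_triple \<Rightarrow> 'a mult_alg \<Rightarrow> 'a" (infixl "\<lhd>\<^sub>m" 75)
  where "x \<lhd>\<^sub>m a = blinfun_apply (fst (Rep_mult_alg a)) x"

definition ract_adj :: "'a::cstar_triple \<Rightarrow> 'a mult_alg \<Rightarrow> 'a"
  where "ract_adj x a = blinfun_apply (snd (Rep_mult_alg a)) x"

lemma mult_alg_rules:
  "tp (x \<lhd>\<^sub>m a) y z = tp x (ract_adj y a) z"
  "tp (ract_adj x a) y z = tp x (y \<lhd>\<^sub>m a) z"
  "tp x y (z \<lhd>\<^sub>m a) = tp x y z \<lhd>\<^sub>m a"
  "tp x y (ract_adj z a) = ract_adj (tp x y z) a"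
  using Rep_mult_alg[of a] by (simp_all add: adjoint_pair_def ract_m_def ract_adj_def)

lemma ract_adj_unique:
  assumes "\<And>x y z. tp x (f y) z = tp x (g y) (z::'a::cstar_triple)"
  shows "f = g"
proof
  fix y
  have "tp x (f y - g y) z = 0" for x z by (simp add: tp_diff(2) assms)
  then show "f y = g y" using tp_cube_eq_0 by fastforce
qed

lemma tp_left_cancel: "(\<And>y z. tp x y z = tp x' y z) \<Longrightarrow> x = (x'::'a::cstar_triple)"
proof -
  assume h: "\<And>y z. tp x y z = tp x' y z"
  then have "tp (x - x') y z = 0" for y z by (simp add: tp_diff(1))
  then show "x = x'" using tp_cube_eq_0 by fastforce
qed

text \<open>The ternary product is nondegenerate, so the operator determines its adjoint, and the
  second components need not be compared.\<close>

lemma mult_alg_eqI: "(\<And>x. x \<lhd>\<^sub>m a = x \<lhd>\<^sub>m b) \<Longrightarrow> a = (b::'a::cstar_triple mult_alg)"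
proof -
  assume h: "\<And>x. x \<lhd>\<^sub>m a = x \<lhd>\<^sub>m b"
  have "tp x (ract_adj y a) z = tp x (ract_adj y b) z" for x y z
    by (metis h mult_alg_rules(1))
  then have "(\<lambda>y. ract_adj y a) = (\<lambda>y. ract_adj y b)" by (rule ract_adj_unique)
  then have "snd (Rep_mult_alg a) = snd (Rep_mult_alg b)"
    by (intro blinfun_eqI) (metis ract_adj_def)
  moreover have "fst (Rep_mult_alg a) = fst (Rep_mult_alg b)"
    by (intro blinfun_eqI) (metis h ract_m_def)
  ultimately show ?thesis by (metis Rep_mult_alg_inject prod.expand)
qed

text \<open>Unpacks \<open>Abs_mult_alg\<close> once: every operation below is given by a pair of
  functions and obtains both its action and its adjoint action from here.\<close>

lemma mult_alg_exists:
  assumes f: "bounded_linear f" and g: "bounded_linear g"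
    and "\<And>x y z. tp (f x) y z = tp x (g y) z" "\<And>x y z. tp (g x) y z = tp x (f y) (z::'a::cstar_triple)"
    "\<And>x y z. tp x y (f z) = f (tp x y z)" "\<And>x y z. tp x y (g z) = g (tp x y z)"
  shows "x \<lhd>\<^sub>m Abs_mult_alg (Blinfun f, Blinfun g) = f x"
    "ract_adj x (Abs_mult_alg (Blinfun f, Blinfun g)) = g x"
proof -
  have "adjoint_pair (Blinfun f, Blinfun g)"
    by (simp add: adjoint_pair_def bounded_linear_Blinfun_apply f g assms(3-6))
  then show "x \<lhd>\<^sub>m Abs_mult_alg (Blinfun f, Blinfun g) = f x"
    "ract_adj x (Abs_mult_alg (Blinfun f, Blinfun g)) = g x"
    by (simp_all add: ract_m_def ract_adj_def Abs_mult_alg_inverse bounded_linear_Blinfun_apply f g)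
qed

lemma bounded_linear_ract: "bounded_linear (\<lambda>x. x \<lhd>\<^sub>m a)" "bounded_linear (\<lambda>x. ract_adj x a)"
  unfolding ract_m_def ract_adj_def by (rule blinfun.bounded_linear_right)+

instantiation mult_alg :: (cstar_triple) "{real_algebra, monoid_mult}"
begin

definition "0 = Abs_mult_alg (Blinfun (\<lambda>x::'a. 0), Blinfun (\<lambda>x. 0))"
definition "1 = Abs_mult_alg (Blinfun (\<lambda>x::'a. x), Blinfun (\<lambda>x. x))"
definition "a + b = Abs_mult_alg
  (Blinfun (\<lambda>x. x \<lhd>\<^sub>m a + x \<lhd>\<^sub>m b), Blinfun (\<lambda>x. ract_adj x a + ract_adj x b))"
definition "- a = Abs_mult_alg (Blinfun (\<lambda>x. - (x \<lhd>\<^sub>m a)), Blinfun (\<lambda>x. - ract_adj x a))"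
definition "a - b = Abs_mult_alg
  (Blinfun (\<lambda>x. x \<lhd>\<^sub>m a - x \<lhd>\<^sub>m b), Blinfun (\<lambda>x. ract_adj x a - ract_adj x b))"
definition "r *\<^sub>R a = Abs_mult_alg (Blinfun (\<lambda>x. r *\<^sub>R (x \<lhd>\<^sub>m a)), Blinfun (\<lambda>x. r *\<^sub>R ract_adj x a))"
definition "a * b = Abs_mult_alg (Blinfun (\<lambda>x. x \<lhd>\<^sub>m a \<lhd>\<^sub>m b), Blinfun (\<lambda>x. ract_adj (ract_adj x b) a))"

lemmas mult_alg_intros = bounded_linear_zero bounded_linear_ident bounded_linear_add
  bounded_linear_minus bounded_linear_sub bounded_linear_const_scaleR
  bounded_linear_ract bounded_linear_compose[OF bounded_linear_ract(1) bounded_linear_ract(1)]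
  bounded_linear_compose[OF bounded_linear_ract(2) bounded_linear_ract(2)]

lemma ract_zero [simp]: "x \<lhd>\<^sub>m 0 = 0" and ract_adj_zero [simp]: "ract_adj x 0 = 0"
  unfolding zero_mult_alg_def
  by (subst mult_alg_exists; (intro mult_alg_intros)?; simp)+

lemma ract_one [simp]: "x \<lhd>\<^sub>m 1 = x" and ract_adj_one [simp]: "ract_adj x 1 = x"
  unfolding one_mult_alg_def
  by (subst mult_alg_exists; (intro mult_alg_intros)?; simp)+

lemma ract_plus: "x \<lhd>\<^sub>m (a + b) = x \<lhd>\<^sub>m a + x \<lhd>\<^sub>m b"
  and ract_adj_plus: "ract_adj x (a + b) = ract_adj x a + ract_adj x b"
  unfolding plus_mult_alg_def
  by (subst mult_alg_exists; (intro mult_alg_intros)?; simp add: tp_add1 tp_add2 tp_add3 mult_alg_rules)+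

lemma ract_uminus: "x \<lhd>\<^sub>m (- a) = - (x \<lhd>\<^sub>m a)"
  and ract_adj_uminus: "ract_adj x (- a) = - ract_adj x a"
  unfolding uminus_mult_alg_def
  by (subst mult_alg_exists; (intro mult_alg_intros)?; simp add: tp_minus mult_alg_rules)+

lemma ract_minus: "x \<lhd>\<^sub>m (a - b) = x \<lhd>\<^sub>m a - x \<lhd>\<^sub>m b"
  and ract_adj_minus: "ract_adj x (a - b) = ract_adj x a - ract_adj x b"
  unfolding minus_mult_alg_def
  by (subst mult_alg_exists; (intro mult_alg_intros)?; simp add: tp_diff mult_alg_rules)+

lemma ract_scaleR: "x \<lhd>\<^sub>m (r *\<^sub>R a) = r *\<^sub>R (x \<lhd>\<^sub>m a)"
  and ract_adj_scaleR: "ract_adj x (r *\<^sub>R a) = r *\<^sub>R ract_adj x a"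
  unfolding scaleR_mult_alg_def
  by (subst mult_alg_exists; (intro mult_alg_intros)?; simp add: tp_scaleR1 tp_scaleR2 tp_scaleR3 mult_alg_rules)+

lemma ract_times: "x \<lhd>\<^sub>m (a * b) = x \<lhd>\<^sub>m a \<lhd>\<^sub>m b"
  and ract_adj_times: "ract_adj x (a * b) = ract_adj (ract_adj x b) a"
  unfolding times_mult_alg_def
  by (subst mult_alg_exists; (intro mult_alg_intros)?; simp add: mult_alg_rules)+

instance
  by standard
     (auto intro!: mult_alg_eqI simp: ract_plus ract_uminus ract_minus ract_scaleR ract_times
        algebra_simps linear_add[OF bounded_linear.linear[OF bounded_linear_ract(1)]]
        linear_scale[OF bounded_linear.linear[OF bounded_linear_ract(1)]])

end

lemma norm_ract: "norm (x \<lhd>\<^sub>m a) \<le> norm x * norm (fst (Rep_mult_alg a))"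
  unfolding ract_m_def by (metis mult.commute norm_blinfun)

instantiation mult_alg :: (cstar_triple) "{real_normed_algebra}"
begin

definition "norm a = norm (fst (Rep_mult_alg a))" for a :: "'a mult_alg"
definition "dist a b = norm (a - b)" for a :: "'a mult_alg"
definition "sgn a = a /\<^sub>R norm a" for a :: "'a mult_alg"
definition "uniformity = (INF e\<in>{0 <..}. principal {(x, y :: 'a mult_alg). dist x y < e})"
definition "open U = (\<forall>x\<in>U. \<forall>\<^sub>F (x', y) in uniformity. x' = x \<longrightarrow> y \<in> U)"
  for U :: "'a mult_alg set"

lemma norm_mult_alg_le:
  assumes "\<And>x. norm (x \<lhd>\<^sub>m a) \<le> K * norm x" "0 \<le> K"
  shows "norm a \<le> K"
  unfolding norm_mult_alg_def by (rule norm_blinfun_bound) (use assms in \<open>auto simp: ract_m_def\<close>)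

lemma norm_ract_le: "norm (x \<lhd>\<^sub>m a) \<le> norm x * norm a"
  unfolding norm_mult_alg_def by (rule norm_ract)

instance
proof
  fix a b :: "'a mult_alg" and r :: real
  show "norm a = 0 \<longleftrightarrow> a = 0"
  proof
    assume "norm a = 0"
    then have "norm (x \<lhd>\<^sub>m a) \<le> 0" for x using norm_ract_le[of x a] by simp
    then show "a = 0" by (auto intro: mult_alg_eqI)
  next
    assume "a = 0"
    then have "norm a \<le> 0" by (intro norm_mult_alg_le) auto
    then show "norm a = 0" by (simp add: norm_mult_alg_def)
  qed
  have nn: "0 \<le> norm c" for c :: "'a mult_alg" by (simp add: norm_mult_alg_def)
  show "norm (a + b) \<le> norm a + norm b"
  proof (rule norm_mult_alg_le)
    show "norm (x \<lhd>\<^sub>m (a + b)) \<le> (norm a + norm b) * norm x" for x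
      using norm_triangle_ineq[of "x \<lhd>\<^sub>m a" "x \<lhd>\<^sub>m b"] norm_ract_le[of x a] norm_ract_le[of x b]
      by (simp add: ract_plus algebra_simps)
  qed (simp add: nn)
  show "norm (r *\<^sub>R a) = \<bar>r\<bar> * norm a"
  proof (rule antisym)
    have le: "norm (s *\<^sub>R c) \<le> \<bar>s\<bar> * norm c" for s and c :: "'a mult_alg"
      by (rule norm_mult_alg_le)
        (use norm_ract_le[of _ c] in \<open>simp_all add: ract_scaleR nn mult_left_mono mult_ac\<close>)
    then show "norm (r *\<^sub>R a) \<le> \<bar>r\<bar> * norm a" .
    show "\<bar>r\<bar> * norm a \<le> norm (r *\<^sub>R a)"
    proof (cases "r = 0")
      case False
      then show ?thesis using le[of "inverse r" "r *\<^sub>R a"] by (simp add: field_simps)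
    qed (simp add: nn)
  qed
  show "norm (a * b) \<le> norm a * norm b"
  proof (rule norm_mult_alg_le)
    show "norm (x \<lhd>\<^sub>m (a * b)) \<le> norm a * norm b * norm x" for x
      using norm_ract_le[of "x \<lhd>\<^sub>m a" b] mult_right_mono[OF norm_ract_le[of x a] nn[of b]]
      by (simp add: ract_times mult_ac)
  qed (simp add: nn)
qed (simp_all add: dist_mult_alg_def sgn_mult_alg_def uniformity_mult_alg_def open_mult_alg_def)

end

lemmas linear_ract = bounded_linear.linear[OF bounded_linear_ract(1)]
lemmas ract_scaleR_left = linear_scale[OF linear_ract]
lemmas ract_add_left = linear_add[OF linear_ract]

lemma bounded_bilinear_ract: "bounded_bilinear (\<lhd>\<^sub>m)"
  by (rule bounded_bilinear.intro)
     (use norm_ract_le in \<open>auto simp: ract_plus ract_scaleR ract_scaleR_left ract_add_left intro!: exI[of _ 1]\<close>)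

lemmas tendsto_ract = bounded_bilinear.tendsto[OF bounded_bilinear_ract]

lemma ract_im: "im x \<lhd>\<^sub>m a = im (x \<lhd>\<^sub>m a)"
  by (rule tp_left_cancel) (simp add: mult_alg_rules tp_im1)

text \<open>The cube identity replaces the scalar product of Hilbert space:
  \<open>(f x, f x, f x) = f (x, g (f x), x)\<close>, where one \<open>f\<close> is pulled out of
  the third argument and one is moved from the first to the second.\<close>

lemma adjoint_bound:
  assumes f: "\<And>x y z. tp (f x) y z = tp x (g y) (z::'a::cstar_triple)"
    and f3: "\<And>x y z. tp x y (f z) = f (tp x y z)"
    and fK: "\<And>x. norm (f x) \<le> K * norm x"
    and fgM: "\<And>x. norm (g (f x)) \<le> M * norm x" and "0 \<le> K"
  shows "norm (f x) ^ 3 \<le> M * K * norm x ^ 3"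
proof -
  have "tp (f x) (f x) (f x) = f (tp x (g (f x)) x)" by (simp add: f f3)
  then have "norm (f x) ^ 3 = norm (f (tp x (g (f x)) x))" by (metis norm_tp_cube)
  also have "\<dots> \<le> K * norm (tp x (g (f x)) x)" by (rule fK)
  also have "\<dots> \<le> K * (norm x * (M * norm x) * norm x)"
    using assms(5) fgM[of x] norm_tp[of x "g (f x)" x]
    by (meson mult_left_mono mult_right_mono norm_ge_zero order_trans)
  finally show ?thesis by (simp add: power3_eq_cube mult_ac)
qed

instantiation mult_alg :: (cstar_triple) unital_cstar
begin

definition "adj a = Abs_mult_alg (Blinfun (\<lambda>x. ract_adj x a), Blinfun (\<lambda>x. x \<lhd>\<^sub>m a))"
definition "imu = Abs_mult_alg (Blinfun (im :: 'a \<Rightarrow> 'a), Blinfun (\<lambda>x. - im x))"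

lemma ract_adj_eq: "x \<lhd>\<^sub>m adj a = ract_adj x a" and ract_adj_adj: "ract_adj x (adj a) = x \<lhd>\<^sub>m a"
  unfolding adj_mult_alg_def
  by (subst mult_alg_exists; (intro mult_alg_intros)?; simp add: mult_alg_rules)+

lemma ract_imu: "x \<lhd>\<^sub>m imu = im x" and ract_adj_imu: "ract_adj x imu = - im x"
  unfolding imu_mult_alg_def
  by (subst mult_alg_exists; (intro bounded_linear_im bounded_linear_minus)?;
      simp add: tp_im1 tp_im2 tp_im3 tp_minus)+

text \<open>With \<open>K = norm a\<close> and \<open>M = norm (a * adj a)\<close>,
  \<open>adjoint_bound\<close> and a cube root give \<open>norm a ^ 3 <= M * norm a\<close>. For
  operators on the right, \<open>a\<close> followed by its adjoint is
  \<open>a * adj a\<close>.\<close>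

lemma norm_mult_alg_cstar:
  fixes a :: "'a mult_alg"
  shows "(norm a)\<^sup>2 \<le> norm (a * adj a)"
proof (cases "norm a = 0")
  case False
  let ?M = "norm (a * adj a)"
  have le: "norm (x \<lhd>\<^sub>m a) ^ 3 \<le> ?M * norm a * norm x ^ 3" for x
    by (rule adjoint_bound[where g = "\<lambda>x. ract_adj x a"])
      (use norm_ract_le[of _ a] norm_ract_le[of _ "a * adj a"] in
        \<open>auto simp: mult_alg_rules ract_adj_eq ract_times mult_ac\<close>)
  have "norm (x \<lhd>\<^sub>m a) \<le> root 3 (?M * norm a) * norm x" for x
    using real_root_le_mono[OF _ le[of x], of 3]
    by (simp add: real_root_mult real_root_power[symmetric] odd_real_root_power_cancel)
  then have "norm a \<le> root 3 (?M * norm a)"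
    by (rule norm_mult_alg_le) simp
  then have "norm a ^ 3 \<le> root 3 (?M * norm a) ^ 3"
    by (intro power_mono) auto
  then have "norm a ^ 3 \<le> ?M * norm a" by (simp add: odd_real_root_pow)
  then have "norm a * (norm a)\<^sup>2 \<le> norm a * ?M" by (simp add: power3_eq_cube power2_eq_square mult_ac)
  then show ?thesis using False by (simp add: mult_le_cancel_left)
qed simp

lemma norm_mult_alg_adj: "norm (adj a) = norm (a :: 'a mult_alg)"
proof -
  have aa: "adj (adj a) = a" for a :: "'a mult_alg"
    by (rule mult_alg_eqI) (simp add: ract_adj_eq ract_adj_adj)
  have le: "norm b \<le> norm (adj b)" for b :: "'a mult_alg"
  proof (cases "norm b = 0")
    case False
    have "norm b * norm b \<le> norm b * norm (adj b)"
      using norm_mult_alg_cstar[of b] norm_mult_ineq[of b "adj b"] by (simp add: power2_eq_square)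
    then show ?thesis using False by (simp add: mult_le_cancel_left)
  qed simp
  show ?thesis using le[of a] le[of "adj a"] aa by simp
qed

instance
proof
  fix a b :: "'a mult_alg" and r :: real
  show aa: "adj (adj a) = a" for a :: "'a mult_alg"
    by (rule mult_alg_eqI) (simp add: ract_adj_eq ract_adj_adj)
  show "adj (a + b) = adj a + adj b"
    by (rule mult_alg_eqI) (simp add: ract_adj_eq ract_plus ract_adj_plus)
  show "adj (r *\<^sub>R a) = r *\<^sub>R adj a"
    by (rule mult_alg_eqI) (simp add: ract_adj_eq ract_scaleR ract_adj_scaleR)
  show "adj (a * b) = adj b * adj a"
    by (rule mult_alg_eqI) (simp add: ract_adj_eq ract_times ract_adj_times)
  show "imu * imu = - (1 :: 'a mult_alg)"
    by (rule mult_alg_eqI) (simp add: ract_times ract_imu im_im ract_uminus)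
  show "imu * a = a * imu"
    by (rule mult_alg_eqI) (simp add: ract_times ract_imu ract_im)
  show "adj imu = - (imu :: 'a mult_alg)"
    by (rule mult_alg_eqI) (simp add: ract_adj_eq ract_uminus ract_imu ract_adj_imu)
  have "(norm (adj a))\<^sup>2 \<le> norm (adj a * a)"
    using norm_mult_alg_cstar[of "adj a"] by (simp add: aa)
  moreover have "norm (adj a * a) \<le> norm (adj a) * norm a" by (rule norm_mult_ineq)
  ultimately show "norm (adj a * a) = (norm a)\<^sup>2"
    by (simp add: norm_mult_alg_adj power2_eq_square)
next
  fix X :: "nat \<Rightarrow> 'a mult_alg" assume X: "Cauchy X"
  let ?f = "\<lambda>n. fst (Rep_mult_alg (X n))" and ?g = "\<lambda>n. snd (Rep_mult_alg (X n))"
  have f: "norm (fst (Rep_mult_alg a) - fst (Rep_mult_alg b)) = norm (a - b)" for a b :: "'a mult_alg"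
  proof -
    have "fst (Rep_mult_alg (a - b)) = fst (Rep_mult_alg a) - fst (Rep_mult_alg b)"
      by (rule blinfun_eqI) (metis minus_blinfun.rep_eq ract_m_def ract_minus)
    then show ?thesis by (simp add: norm_mult_alg_def)
  qed
  have sf: "snd (Rep_mult_alg a) = fst (Rep_mult_alg (adj a))" for a :: "'a mult_alg"
    by (rule blinfun_eqI) (metis ract_adj_def ract_adj_eq ract_m_def)
  have ad: "adj (a - b) = adj a - adj b" for a b :: "'a mult_alg"
    by (rule mult_alg_eqI) (simp add: ract_adj_eq ract_minus ract_adj_minus)
  have g: "norm (snd (Rep_mult_alg a) - snd (Rep_mult_alg b)) = norm (a - b)" for a b :: "'a mult_alg"
    using f[of "adj a" "adj b"] norm_mult_alg_adj[of "a - b"] by (simp add: sf ad)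
  \<comment> \<open>The involution is isometric, so the adjoints converge along with the operators;
    the identities of an adjoint pair survive the limit.\<close>
  have "Cauchy ?f" "Cauchy ?g"
    using X unfolding Cauchy_iff f g by blast+
  then obtain F G where F: "?f \<longlonglongrightarrow> F" and G: "?g \<longlonglongrightarrow> G"
    using convergent_eq_Cauchy by metis
  have Fx: "(\<lambda>n. x \<lhd>\<^sub>m X n) \<longlonglongrightarrow> blinfun_apply F x" for x
    unfolding ract_m_def by (intro tendsto_intros F)
  have Gx: "(\<lambda>n. ract_adj x (X n)) \<longlonglongrightarrow> blinfun_apply G x" for x
    unfolding ract_adj_def by (intro tendsto_intros G)
  have "adjoint_pair (F, G)"
    unfolding adjoint_pair_def fst_conv snd_conv
  proof (intro allI conjI)
    fix x y z
    show "tp (blinfun_apply F x) y z = tp x (blinfun_apply G y) z"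
      by (rule LIMSEQ_unique[OF tendsto_tp1[OF Fx]]) (simp add: mult_alg_rules tendsto_tp2[OF Gx])
    show "tp (blinfun_apply G x) y z = tp x (blinfun_apply F y) z"
      by (rule LIMSEQ_unique[OF tendsto_tp1[OF Gx]]) (simp add: mult_alg_rules tendsto_tp2[OF Fx])
    show "tp x y (blinfun_apply F z) = blinfun_apply F (tp x y z)"
      by (rule LIMSEQ_unique[OF tendsto_tp3[OF Fx]]) (simp add: mult_alg_rules Fx)
    show "tp x y (blinfun_apply G z) = blinfun_apply G (tp x y z)"
      by (rule LIMSEQ_unique[OF tendsto_tp3[OF Gx]]) (simp add: mult_alg_rules Gx)
  qed
  then have R: "Rep_mult_alg (Abs_mult_alg (F, G)) = (F, G)" by (simp add: Abs_mult_alg_inverse)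
  have "(\<lambda>n. norm (X n - Abs_mult_alg (F, G))) \<longlonglongrightarrow> 0"
    unfolding f[symmetric] R fst_conv using F by (simp add: LIM_zero_iff tendsto_norm_zero)
  then have "X \<longlonglongrightarrow> Abs_mult_alg (F, G)"
    by (simp add: LIM_zero_iff tendsto_norm_zero_iff)
  then show "convergent X" by (rule convergentI)
qed

end

section \<open>Positive and negative parts\<close>

definition ipr :: "'a::cstar_triple \<Rightarrow> 'a \<Rightarrow> 'a mult_alg"
  where "ipr x y = Abs_mult_alg (Blinfun (\<lambda>z. tp z x y), Blinfun (\<lambda>z. tp z y x))"

lemma ract_ipr: "z \<lhd>\<^sub>m ipr x y = tp z x y" and ract_adj_ipr: "ract_adj z (ipr x y) = tp z y x"
  unfolding ipr_def
  by (subst mult_alg_exists; (intro bounded_linear_tp1 tp_assoc12 tp_assoc13[symmetric])?; simp?)+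

lemma adj_ipr: "adj (ipr x y) = ipr y x"
  by (rule mult_alg_eqI) (simp add: ract_adj_eq ract_adj_ipr ract_ipr)

lemma ipr_ract2: "ipr x (y \<lhd>\<^sub>m a) = ipr x y * a"
  by (rule mult_alg_eqI) (simp add: ract_ipr ract_times mult_alg_rules)

lemma ipr_ract1: "ipr (x \<lhd>\<^sub>m a) y = adj a * ipr x y"
  by (rule mult_alg_eqI) (simp add: ract_ipr ract_times mult_alg_rules ract_adj_eq)

lemma ipr_add: "ipr (x + x') y = ipr x y + ipr x' y" "ipr x (y + y') = ipr x y + ipr x y'"
  by (rule mult_alg_eqI; simp add: ract_ipr ract_plus tp_add2 tp_add3)+

lemma ipr_scaleR: "ipr (r *\<^sub>R x) y = r *\<^sub>R ipr x y" "ipr x (r *\<^sub>R y) = r *\<^sub>R ipr x y"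
  by (rule mult_alg_eqI; simp add: ract_ipr ract_scaleR tp_scaleR2 tp_scaleR3)+

lemma norm_ipr_le: "norm (ipr x y) \<le> norm x * norm y"
  by (rule norm_mult_alg_le) (use norm_tp in \<open>simp_all add: ract_ipr mult_ac\<close>)

text \<open>The lower bound comes from letting \<open>ipr x x\<close> act on \<open>x\<close>
  itself, which produces the cube.\<close>

lemma norm_ipr_self: "norm (ipr x x) = (norm x)\<^sup>2"
proof (rule antisym)
  show "norm (ipr x x) \<le> (norm x)\<^sup>2" using norm_ipr_le[of x x] by (simp add: power2_eq_square)
  show "(norm x)\<^sup>2 \<le> norm (ipr x x)"
  proof (cases "norm x = 0")
    case False
    have "norm x * (norm x)\<^sup>2 \<le> norm x * norm (ipr x x)"
      using norm_ract_le[of x "ipr x x"] norm_tp_cube[of x]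
      by (simp add: ract_ipr power3_eq_cube power2_eq_square mult_ac)
    then show ?thesis using False by (simp add: mult_le_cancel_left)
  qed simp
qed

lemma ipr_self_eq_0: "ipr x x = 0 \<Longrightarrow> x = 0"
  using norm_ipr_self[of x] by simp

lemma bounded_bilinear_ipr: "bounded_bilinear ipr"
  by (rule bounded_bilinear.intro)
     (use norm_ipr_le in \<open>auto simp: ipr_add ipr_scaleR intro!: exI[of _ 1]\<close>)

lemmas tendsto_ipr = bounded_bilinear.tendsto[OF bounded_bilinear_ipr]

section \<open>Roots of the inner product and division by them\<close>

lemma commute_left: "a * b = b * a \<Longrightarrow> a * (b * z) = b * (a * (z::'a::semigroup_mult))"
  by (simp flip: mult.assoc)

lemma power_mult_commuting:
  fixes a b :: "'a::monoid_mult"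
  assumes "a * b = b * a" shows "(a * b) ^ n = a ^ n * b ^ n"
proof (induction n)
  case (Suc n)
  have "b * a ^ n = a ^ n * b" using power_commuting_commutes[of a b n] assms by simp
  then show ?case by (simp add: Suc) (metis mult.assoc)
qed simp

text \<open>The hypothesis on \<open>a\<close> recurs for the root \<open>r\<close>, so square roots
  can be iterated without any rescaling.\<close>

lemma root_one_minus:
  fixes a :: "'a::unital_cstar"
  assumes "norm (1 - a) \<le> 1" "adj a = a"
  shows "\<exists>r. r ^ (2 ^ n) = a \<and> norm (1 - r) \<le> 1 \<and> adj r = r \<and> (\<forall>b. b * a = a * b \<longrightarrow> b * r = r * b)"
proof (induction n)
  case 0 then show ?case using assms by (intro exI[of _ a]) simp
next
  case (Suc n)
  then obtain r where r: "r ^ (2 ^ n) = a" "norm (1 - r) \<le> 1" "adj r = r"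
    "\<And>b. b * a = a * b \<Longrightarrow> b * r = r * b" by blast
  obtain s where s: "s * s = 1 - (1 - r)" "norm (1 - s) \<le> 1" "adj (1 - r) = 1 - r \<Longrightarrow> adj s = s"
    "\<And>b. b * (1 - r) = (1 - r) * b \<Longrightarrow> b * s = s * b"
    using sqrt_one_minus[OF r(2)] by metis
  have "s ^ (2 ^ Suc n) = (s * s) ^ (2 ^ n)" by (simp add: power_mult power2_eq_square)
  then have "s ^ (2 ^ Suc n) = a" using s(1) r(1) by simp
  moreover have "adj s = s" using s(3) r(3) by (simp add: adj_diff)
  moreover have "b * s = s * b" if "b * a = a * b" for b
    using s(4)[of b] r(4)[OF that] by (simp add: algebra_simps)
  ultimately show ?case using s(2) by blast
qed

text \<open>\<open>x\<close> is divided by \<open>l ^ 7\<close>, where \<open>l\<close> is the 16th root of the absolute value of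
  \<open>ipr x x\<close>. The 16th root leaves enough room to express \<open>x sgn (ipr x x)\<close> and
  \<open>x \<bar>ipr x x\<bar> powr (-1/4)\<close> through \<open>y\<close>.\<close>

lemma root_division:
  fixes x :: "'a::cstar_triple"
  assumes x: "norm x \<le> 1"
  obtains y l where "x = y \<lhd>\<^sub>m l ^ 7" "adj l = l" "ipr y y * l = l * ipr y y"
    "ipr y y * ipr y y = l ^ 4"
proof -
  define t where "t = ipr x x"
  have ta: "adj t = t" by (simp add: t_def adj_ipr)
  have tn: "norm t \<le> 1" unfolding t_def norm_ipr_self using x by (simp add: power_le_one)
  have "norm (1 - t * t) \<le> 1" by (rule norm_one_minus_square[OF ta tn])
  moreover have "adj (t * t) = t * t" by (simp add: adj_mult ta)
  \<comment> \<open>\<open>t * t\<close> is the square of the absolute value of \<open>t\<close>,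
    hence its root of order 32 is the 16th root of the absolute value.\<close>
  ultimately have "\<exists>l. l ^ (2 ^ 5) = t * t \<and> norm (1 - l) \<le> 1 \<and> adj l = l \<and>
      (\<forall>b. b * (t * t) = t * t * b \<longrightarrow> b * l = l * b)"
    by (rule root_one_minus)
  then obtain l where l32: "l ^ 32 = t * t" and ln: "norm (1 - l) \<le> 1" and la: "adj l = l"
    and lc: "\<And>b. b * (t * t) = t * t * b \<Longrightarrow> b * l = l * b"
    by auto
  have tl: "t * l = l * t" by (rule lc) (simp add: mult.assoc)
  have res: "\<exists>R. l * R = 1 - e *\<^sub>R R \<and> norm (e *\<^sub>R R) \<le> 1 \<and>
    (\<forall>b. b * l = l * b \<longrightarrow> b * R = R * b) \<and> adj R = R" if "e > 0" for e
    using resolvent[OF ln that] la by metis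
  then have "\<forall>n::nat. \<exists>R. l * R = 1 - (1 / real (Suc n)) *\<^sub>R R \<and> norm ((1 / real (Suc n)) *\<^sub>R R) \<le> 1 \<and>
    (\<forall>b. b * l = l * b \<longrightarrow> b * R = R * b) \<and> adj R = R" by (intro allI res) simp
  then obtain R where lR: "\<And>n::nat. l * R n = 1 - (1 / real (Suc n)) *\<^sub>R R n"
    and Rn: "\<And>n. norm ((1 / real (Suc n)) *\<^sub>R R n) \<le> 1"
    and Rc: "\<And>n b. b * l = l * b \<Longrightarrow> b * R n = R n * b" and Ra: "\<And>n. adj (R n) = R n"
    by metis
  \<comment> \<open>\<open>R n\<close> inverts \<open>l + 1 / (n + 1)\<close>, so \<open>s n\<close>
    approximates the support of \<open>l\<close>. It need not converge in norm, but
    \<open>l * s n ^ k\<close> does, with an error of order \<open>1 / n\<close>.\<close>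
  define s where "s n = l * R n" for n
  have Rl: "l * R n = R n * l" for n by (rule Rc) simp
  have tR: "t * R n = R n * t" for n by (rule Rc) (rule tl)
  have sn: "norm (s n) \<le> 2" for n
    using norm_triangle_ineq4[of 1 "(1 / real (Suc n)) *\<^sub>R R n"] Rn[of n] norm_one_le[where 'a="'a mult_alg"]
    unfolding s_def lR by linarith
  have conv: "\<exists>C. \<forall>n. norm (l * s n ^ k - l) \<le> C / real (Suc n)" for k
  proof (induction k)
    case 0 show ?case by (intro exI[of _ 0]) simp
  next
    case (Suc k)
    then obtain C where C: "\<And>n. norm (l * s n ^ k - l) \<le> C / real (Suc n)" by blast
    have "norm (l * s n ^ Suc k - l) \<le> (2 * C + 2) / real (Suc n)" for n
    proof -
      have "l * s n = l * (1 - (1 / real (Suc n)) *\<^sub>R R n)" by (simp only: s_def lR)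
      also have "\<dots> = l - (1 / real (Suc n)) *\<^sub>R s n"
        by (simp only: right_diff_distrib mult_1_right mult_scaleR_right s_def)
      finally have "l * s n - l = - ((1 / real (Suc n)) *\<^sub>R s n)" by simp
      then have "norm (l * s n - l) = (1 / real (Suc n)) * norm (s n)"
        by (simp only: norm_minus_cancel norm_scaleR) simp
      also have "\<dots> \<le> (1 / real (Suc n)) * 2" by (intro mult_left_mono sn) simp
      finally have a: "norm (l * s n - l) \<le> (1 / real (Suc n)) * 2" .
      have b: "norm ((l * s n ^ k - l) * s n) \<le> C / real (Suc n) * 2"
        by (rule order_trans[OF norm_mult_ineq mult_mono[OF C sn]])
           (rule order_trans[OF norm_ge_zero C], rule norm_ge_zero)
      have eq: "l * s n ^ Suc k - l = (l * s n ^ k - l) * s n + (l * s n - l)"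
        by (simp add: algebra_simps power_commutes)
      have "norm (l * s n ^ Suc k - l) \<le> C / real (Suc n) * 2 + (1 / real (Suc n)) * 2"
        unfolding eq by (rule order_trans[OF norm_triangle_ineq add_mono[OF b a]])
      also have "\<dots> = (2 * C + 2) / real (Suc n)" by (simp add: add_divide_distrib mult.commute del: of_nat_Suc)
      finally show ?thesis .
    qed
    then show ?case by blast
  qed
  have lim: "(\<lambda>n. l * s n ^ k) \<longlonglongrightarrow> l" for k
  proof -
    obtain C where C: "\<And>n. norm (l * s n ^ k - l) \<le> C / real (Suc n)" using conv by blast
    have "(\<lambda>n. C / real (Suc n)) \<longlonglongrightarrow> 0" by real_asymp
    then have "(\<lambda>n. l * s n ^ k - l) \<longlonglongrightarrow> 0"
      by (rule Lim_null_comparison[rotated]) (use C in auto)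
    then show ?thesis by (simp add: LIM_zero_iff)
  qed
  \<comment> \<open>The substitute for division by \<open>l ^ 7\<close>. The absolute value of
    \<open>x\<close> is \<open>l ^ 8\<close>, so \<open>x\<close> times \<open>X n\<close> has the
    size of \<open>l ^ 8 * X n = l * s n ^ 7\<close>; the one factor \<open>l\<close> left over is
    what makes this converge in norm.\<close>
  define X where "X n = R n ^ 7" for n
  have lX: "l ^ 8 * X n = l * s n ^ 7" for n
  proof -
    have "l * s n ^ 7 = l * (l ^ 7 * X n)" unfolding s_def X_def power_mult_commuting[OF Rl] ..
    then show ?thesis by (simp add: mult.assoc[symmetric] flip: power_Suc)
  qed
  \<comment> \<open>Transfers norms from the tring to the algebra. Only the square of
    \<open>t\<close> is a power of \<open>l\<close>, so the two norms are compared after squaring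
    twice.\<close>
  have iso: "norm (x \<lhd>\<^sub>m Y) = norm (l ^ 8 * Y)"
    if Y: "adj Y = Y" "t * Y = Y * t" "l * Y = Y * l" for Y
  proof -
    have l8: "l ^ 8 * Y = Y * l ^ 8" using power_commuting_commutes[of l Y 8] Y(3) by simp
    have l8a: "adj (l ^ 8 * Y) = l ^ 8 * Y" by (simp add: adj_mult adj_power la Y(1) l8)
    have "ipr (x \<lhd>\<^sub>m Y) (x \<lhd>\<^sub>m Y) = t * (Y * Y)"
      by (simp add: ipr_ract1 ipr_ract2 Y(1) t_def[symmetric] Y(2)[symmetric] flip: mult.assoc)
    then have n1: "norm (x \<lhd>\<^sub>m Y) ^ 2 = norm (t * (Y * Y))" by (metis norm_ipr_self)
    have c: "Y * (t * Z) = t * (Y * Z)" for Z by (rule commute_left) (rule Y(2)[symmetric])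
    have "adj (t * (Y * Y)) = t * (Y * Y)" by (simp add: adj_mult ta Y(1) mult.assoc c Y(2)[symmetric])
    then have "norm (t * (Y * Y)) ^ 2 = norm (t * (Y * Y) * (t * (Y * Y)))"
      by (simp add: norm_square_sa)
    also have "t * (Y * Y) * (t * (Y * Y)) = t * t * (Y * Y * (Y * Y))"
      by (simp add: mult.assoc c)
    also have "t * t = l ^ 8 * l ^ 8 * (l ^ 8 * l ^ 8)" unfolding l32[symmetric] by (simp flip: power_add)
    also have "l ^ 8 * l ^ 8 * (l ^ 8 * l ^ 8) * (Y * Y * (Y * Y)) =
        (l ^ 8 * Y) * (l ^ 8 * Y) * ((l ^ 8 * Y) * (l ^ 8 * Y))"
    proof -
      define m where "m = l ^ 8"
      have "Y * (m * Z) = m * (Y * Z)" for Z unfolding m_def by (rule commute_left) (rule l8[symmetric])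
      then show ?thesis unfolding m_def[symmetric] by (simp add: mult.assoc)
    qed
    also have "norm \<dots> = ((norm (l ^ 8 * Y))\<^sup>2)\<^sup>2"
      using norm_square_sa[OF l8a] norm_square_sa[of "l ^ 8 * Y * (l ^ 8 * Y)"] l8a
      by (simp add: adj_mult)
    finally have "norm (t * (Y * Y)) = (norm (l ^ 8 * Y))\<^sup>2"
      by (rule power2_eq_imp_eq) simp_all
    with n1 have "norm (x \<lhd>\<^sub>m Y) ^ 2 = (norm (l ^ 8 * Y))\<^sup>2" by simp
    then show ?thesis by (rule power2_eq_imp_eq) simp_all
  qed
  have Xa: "adj (X n) = X n" for n by (simp add: X_def adj_power Ra)
  have tX: "t * X n = X n * t" for n
    using power_commuting_commutes[of "R n" t 7] tR[of n] by (simp add: X_def)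
  have lXc: "l * X n = X n * l" for n
    using power_commuting_commutes[of "R n" l 7] Rl[of n] by (simp add: X_def)
  have "Cauchy (\<lambda>n. l ^ 8 * X n)" unfolding lX using lim[of 7] by (rule LIMSEQ_imp_Cauchy)
  moreover have "norm (x \<lhd>\<^sub>m X m - x \<lhd>\<^sub>m X n) = norm (l ^ 8 * X m - l ^ 8 * X n)" for m n
    unfolding ract_minus[symmetric] right_diff_distrib[symmetric]
    by (rule iso) (simp_all add: adj_diff Xa algebra_simps tX lXc)
  ultimately have "Cauchy (\<lambda>n. x \<lhd>\<^sub>m X n)" unfolding Cauchy_iff by simp
  then obtain y where y: "(\<lambda>n. x \<lhd>\<^sub>m X n) \<longlonglongrightarrow> y" using convergent_eq_Cauchy by blast
  show ?thesis
  proof (rule that[of y l])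
    show "adj l = l" by (rule la)
    have l7: "l * l ^ 7 = l ^ 7 * l" by (simp add: power_commutes)
    have X7: "X n * l ^ 7 = l ^ 7 * X n" for n
      using power_commuting_commutes[of l "X n" 7] lXc[of n] by simp
    have "norm (x \<lhd>\<^sub>m X n \<lhd>\<^sub>m l ^ 7 - x) = norm ((l * s n ^ 7 - l) * l ^ 7)" for n
    proof -
      have "x \<lhd>\<^sub>m X n \<lhd>\<^sub>m l ^ 7 - x = x \<lhd>\<^sub>m (X n * l ^ 7 - 1)" by (simp add: ract_minus ract_times)
      also have "norm \<dots> = norm (l ^ 8 * (X n * l ^ 7 - 1))"
      proof (rule iso)
        show "adj (X n * l ^ 7 - 1) = X n * l ^ 7 - 1"
          by (simp add: adj_diff adj_mult adj_power la Xa X7)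
        have "t * l ^ 7 = l ^ 7 * t" using power_commuting_commutes[of l t 7] tl by simp
        then show "t * (X n * l ^ 7 - 1) = (X n * l ^ 7 - 1) * t"
          using commute_left[OF tX[of n]] by (simp add: algebra_simps)
        show "l * (X n * l ^ 7 - 1) = (X n * l ^ 7 - 1) * l"
          using commute_left[OF lXc[of n]] l7 by (simp add: algebra_simps)
      qed
      also have "l ^ 8 * (X n * l ^ 7 - 1) = (l ^ 8 * X n) * l ^ 7 - l * l ^ 7"
        by (simp add: right_diff_distrib mult.assoc flip: power_Suc)
      finally show ?thesis by (simp only: lX left_diff_distrib)
    qed
    moreover have "(\<lambda>n. (l * s n ^ 7 - l) * l ^ 7) \<longlonglongrightarrow> (l - l) * l ^ 7"
      by (intro tendsto_intros lim)
    then have "(\<lambda>n. norm ((l * s n ^ 7 - l) * l ^ 7)) \<longlonglongrightarrow> 0"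
      by (intro tendsto_norm_zero) simp
    ultimately have "(\<lambda>n. norm (x \<lhd>\<^sub>m X n \<lhd>\<^sub>m l ^ 7 - x)) \<longlonglongrightarrow> 0" by simp
    then have "(\<lambda>n. x \<lhd>\<^sub>m X n \<lhd>\<^sub>m l ^ 7) \<longlonglongrightarrow> x"
      by (simp add: tendsto_norm_zero_iff LIM_zero_iff)
    moreover have "(\<lambda>n. x \<lhd>\<^sub>m X n \<lhd>\<^sub>m l ^ 7) \<longlonglongrightarrow> y \<lhd>\<^sub>m l ^ 7"
      by (intro tendsto_ract y tendsto_const)
    ultimately show "x = y \<lhd>\<^sub>m l ^ 7" by (rule LIMSEQ_unique)
    have I: "ipr (x \<lhd>\<^sub>m X n) (x \<lhd>\<^sub>m X n) = X n * t * X n" for n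
      by (simp add: ipr_ract1 ipr_ract2 Xa t_def)
    then have T: "(\<lambda>n. X n * t * X n) \<longlonglongrightarrow> ipr y y" using tendsto_ipr[OF y y] by simp
    have cX: "X n * (t * Z) = t * (X n * Z)" for n Z by (rule commute_left) (rule tX[symmetric])
    have cl: "X n * (l * Z) = l * (X n * Z)" for n Z by (rule commute_left) (rule lXc[symmetric])
    have ctl: "t * (l * Z) = l * (t * Z)" for Z by (rule commute_left) (rule tl)
    have "X n * t * X n * l = l * (X n * t * X n)" for n
      by (simp add: mult.assoc cl ctl tl lXc[symmetric])
    then have "(\<lambda>n. X n * t * X n * l) \<longlonglongrightarrow> l * ipr y y"
      using tendsto_mult[OF tendsto_const[of l] T] by simp
    then show "ipr y y * l = l * ipr y y"
      using LIMSEQ_unique tendsto_mult[OF T tendsto_const[of l]] by blast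
    have "X n * t * X n * (X n * t * X n) = (l * s n ^ 7) ^ 4" for n
    proof -
      have "X n * t * X n * (X n * t * X n) = t * t * X n ^ 4"
        by (simp add: mult.assoc cX power4_eq_xxxx)
      also have "t * t = (l ^ 8) ^ 4" unfolding l32[symmetric] by (simp flip: power_mult)
      also have "(l ^ 8) ^ 4 * X n ^ 4 = (l ^ 8 * X n) ^ 4"
        by (rule power_mult_commuting[symmetric]) 
          (use power_commuting_commutes[of l "X n" 8] lXc[of n] in simp)
      finally show ?thesis by (simp add: lX)
    qed
    moreover have "(\<lambda>n. (l * s n ^ 7) ^ 4) \<longlonglongrightarrow> l ^ 4"
      unfolding power4_eq_xxxx by (intro tendsto_intros lim)
    ultimately have "(\<lambda>n. X n * t * X n * (X n * t * X n)) \<longlonglongrightarrow> l ^ 4" by simp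
    then show "ipr y y * ipr y y = l ^ 4"
      using LIMSEQ_unique tendsto_mult[OF T T] by blast
  qed
qed

section \<open>Elements with a sign\<close>

text \<open>For \<open>e = 1\<close> and \<open>e = - 1\<close>, \<open>p\<close> certifies that both inner products of \<open>u\<close> with itself are positive,
  respectively negative.\<close>

definition zsgn :: "real \<Rightarrow> 'a::cstar_triple \<Rightarrow> 'a \<Rightarrow> bool"
  where "zsgn e u p \<longleftrightarrow> (\<forall>z. tp u u z = e *\<^sub>R tp p p (tp p p z) \<and> tp z u u = e *\<^sub>R tp (tp z p p) p p)"

text \<open>The identities are quadratic in \<open>u\<close> and quartic in \<open>p\<close>, whence
  the square root.\<close>

lemma zsgn_scale:
  assumes "zsgn e u p" "0 \<le> c"
  shows "zsgn e (c *\<^sub>R u) (sqrt c *\<^sub>R p)"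
proof -
  have "sqrt c * (sqrt c * X) = c * X" for X using assms(2) by (simp flip: mult.assoc)
  with assms show ?thesis
    unfolding zsgn_def by (simp add: tp_scaleR1 tp_scaleR2 tp_scaleR3 mult_ac)
qed

lemma zsgn_ipr: "zsgn e u p \<Longrightarrow> ipr u u = e *\<^sub>R (ipr p p * ipr p p)"
  unfolding zsgn_def by (rule mult_alg_eqI) (simp add: ract_ipr ract_scaleR ract_times)

text \<open>How a sign found by calculating with the right inner product reaches the left one. The
  hypothesis evaluates the cube \<open>(p, p, p)\<close>; the left square is
  \<open>(p, p, (p, p, z)) = ((p, p, p), p, z)\<close>, the right one is the inner product of
  \<open>p\<close> with its cube, and in either of them one factor \<open>m\<close> moves over to
  the other \<open>p\<close>.\<close>

lemma zsgnI:
  assumes "adj m = m" "p \<lhd>\<^sub>m ipr p p = (e * c) *\<^sub>R (p \<lhd>\<^sub>m (m * m))" "ipr p p * m = m * ipr p p" "c \<ge> 0"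
    and e: "e * e = 1"
  shows "zsgn e (sqrt c *\<^sub>R (p \<lhd>\<^sub>m m)) p"
  unfolding zsgn_def
proof (intro allI conjI)
  fix z
  let ?u = "p \<lhd>\<^sub>m m"
  have cube: "tp p p p = (e * c) *\<^sub>R (?u \<lhd>\<^sub>m m)"
    using assms(2) by (simp add: ract_ipr ract_times)
  have "tp p p (tp p p z) = tp (tp p p p) p z" by (simp add: tp_assoc13)
  also have "\<dots> = (e * c) *\<^sub>R tp ?u ?u z"
    using assms(1) by (simp add: cube tp_scaleR1 mult_alg_rules(1)[of ?u m]) (metis ract_adj_eq)
  finally show "tp (sqrt c *\<^sub>R ?u) (sqrt c *\<^sub>R ?u) z = e *\<^sub>R tp p p (tp p p z)"
    using assms(4) e by (simp add: tp_scaleR1 tp_scaleR2 flip: mult.assoc)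
  have "tp (tp z p p) p p = z \<lhd>\<^sub>m (ipr p (p \<lhd>\<^sub>m ipr p p))"
    by (simp add: tp_assoc13 ract_ipr)
  also have "ipr p (p \<lhd>\<^sub>m ipr p p) = (e * c) *\<^sub>R (m * ipr p p * m)"
    by (simp add: assms(2) ipr_scaleR ipr_ract2 assms(3)[symmetric] mult.assoc)
  also have "m * ipr p p * m = ipr ?u ?u" by (simp add: ipr_ract1 ipr_ract2 assms(1))
  finally show "tp z (sqrt c *\<^sub>R ?u) (sqrt c *\<^sub>R ?u) = e *\<^sub>R tp (tp z p p) p p"
    using assms(4) e by (simp add: ract_scaleR ract_ipr tp_scaleR2 tp_scaleR3 flip: mult.assoc)
qed

lemma scaleR_4: "4 *\<^sub>R a = a + a + (a + a :: 'a::real_vector)"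
  by (simp flip: scaleR_2)

text \<open>With \<open>k = ipr y y\<close>, the sign \<open>sgn (ipr x x)\<close> is \<open>k / l\<^sup>2\<close>, so the two cases \<open>e = 1\<close>, \<open>e = - 1\<close> of
  \<open>l\<^sup>3 + e k l\<close> are twice the positive and the negative part of \<open>l\<^sup>3\<close>.\<close>

lemma zsgn_part:
  assumes l: "adj l = l" and kl: "ipr y y * l = l * ipr y y" and kk: "ipr y y * ipr y y = l ^ 4"
    and e: "e = 1 \<or> e = (-1 :: real)"
  shows "zsgn e (2 *\<^sub>R (y \<lhd>\<^sub>m (l ^ 3 + e *\<^sub>R (ipr y y * l)) \<lhd>\<^sub>m l ^ 4)) (y \<lhd>\<^sub>m (l ^ 3 + e *\<^sub>R (ipr y y * l)))"
proof -
  define k where "k = ipr y y"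
  define P where "P = l ^ 3 + e *\<^sub>R (k * l)"
  have ka: "adj k = k" by (simp add: k_def adj_ipr)
  have kl: "k * l = l * k" using kl unfolding k_def .
  have kk: "k * k = l * (l * (l * l))" using kk unfolding k_def power4_eq_xxxx by (simp add: mult.assoc)
  have klz: "k * (l * z) = l * (k * z)" for z
    using arg_cong[OF kl, of "\<lambda>a. a * z"] by (simp add: mult.assoc)
  have kkz: "k * (k * z) = l * (l * (l * (l * z)))" for z
    using arg_cong[OF kk, of "\<lambda>a. a * z"] by (simp add: mult.assoc)
  have Pa: "adj P = P" unfolding P_def by (simp add: adj_add adj_scaleR adj_mult adj_power l ka kl)
  note [simp] = kl klz kk kkz
  have I: "ipr (y \<lhd>\<^sub>m P) (y \<lhd>\<^sub>m P) = P * k * P" by (simp add: ipr_ract1 ipr_ract2 Pa k_def)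
  have "zsgn e (sqrt 4 *\<^sub>R (y \<lhd>\<^sub>m P \<lhd>\<^sub>m l ^ 4)) (y \<lhd>\<^sub>m P)"
  proof (rule zsgnI)
    show "adj (l ^ 4) = l ^ 4" by (simp add: adj_power l)
    \<comment> \<open>From \<open>k * k = l ^ 4\<close> follow \<open>P * P = 2 l ^ 3 P\<close> and
      \<open>k * P = e l ^ 2 P\<close>, so the product collapses to \<open>4 e l ^ 8 P\<close>. This
      dictates \<open>m = l ^ 4\<close> and \<open>c = 4\<close>.\<close>
    have "P * (P * k * P) = (e * 4) *\<^sub>R (P * (l ^ 4 * l ^ 4))"
      using e unfolding P_def
      by (auto simp: algebra_simps power3_eq_cube power4_eq_xxxx scaleR_2 scaleR_4)
    then have "y \<lhd>\<^sub>m (P * (P * k * P)) = y \<lhd>\<^sub>m ((e * 4) *\<^sub>R (P * (l ^ 4 * l ^ 4)))" by simp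
    then show "y \<lhd>\<^sub>m P \<lhd>\<^sub>m ipr (y \<lhd>\<^sub>m P) (y \<lhd>\<^sub>m P) = (e * 4) *\<^sub>R (y \<lhd>\<^sub>m P \<lhd>\<^sub>m (l ^ 4 * l ^ 4))"
      unfolding I by (simp only: ract_times ract_scaleR)
    show "ipr (y \<lhd>\<^sub>m P) (y \<lhd>\<^sub>m P) * l ^ 4 = l ^ 4 * ipr (y \<lhd>\<^sub>m P) (y \<lhd>\<^sub>m P)"
      unfolding I unfolding P_def by (simp add: algebra_simps power3_eq_cube power4_eq_xxxx)
  qed (use e in auto)
  then show ?thesis by (simp add: P_def k_def)
qed

text \<open>The power \<open>l ^ 7\<close> consists of the \<open>l ^ 3\<close> in
  \<open>P + Q = 2 l ^ 3\<close> and the \<open>l ^ 4\<close> demanded by \<open>zsgn_part\<close>.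
  The last conjunct expresses that \<open>u\<close> and \<open>v\<close> are orthogonal: multiplied
  by \<open>ipr v v\<close>, the inner product of \<open>x\<close> is that of \<open>v\<close>
  alone.\<close>

lemma zettl_split_unit:
  fixes x :: "'a::cstar_triple"
  assumes "norm x \<le> 1"
  shows "\<exists>u v p q. x = u + v \<and> zsgn 1 u p \<and> zsgn (-1) v q \<and>
    ipr v v * ipr x x = ipr v v * ipr v v"
proof -
  obtain y l where x: "x = y \<lhd>\<^sub>m l ^ 7" and l: "adj l = l" and kl: "ipr y y * l = l * ipr y y"
    and kk: "ipr y y * ipr y y = l ^ 4"
    using root_division[OF assms] by metis
  define k where "k = ipr y y"
  define P where "P = l ^ 3 + 1 *\<^sub>R (k * l)"
  define Q where "Q = l ^ 3 + (-1) *\<^sub>R (k * l)"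
  have zP: "zsgn 1 (2 *\<^sub>R (y \<lhd>\<^sub>m P \<lhd>\<^sub>m l ^ 4)) (y \<lhd>\<^sub>m P)"
    unfolding P_def k_def by (rule zsgn_part[OF l kl kk]) simp
  have zQ: "zsgn (-1) (2 *\<^sub>R (y \<lhd>\<^sub>m Q \<lhd>\<^sub>m l ^ 4)) (y \<lhd>\<^sub>m Q)"
    unfolding Q_def k_def by (rule zsgn_part[OF l kl kk]) simp
  have ka: "adj k = k" by (simp add: k_def adj_ipr)
  have kl: "k * l = l * k" using kl unfolding k_def .
  have kk: "k * k = l * (l * (l * l))" using kk unfolding k_def power4_eq_xxxx by (simp add: mult.assoc)
  have klz: "k * (l * z) = l * (k * z)" for z
    using arg_cong[OF kl, of "\<lambda>a. a * z"] by (simp add: mult.assoc)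
  have kkz: "k * (k * z) = l * (l * (l * (l * z)))" for z
    using arg_cong[OF kk, of "\<lambda>a. a * z"] by (simp add: mult.assoc)
  have Qa: "adj Q = Q" unfolding Q_def by (simp add: adj_diff adj_mult adj_power l ka kl)
  let ?u = "(1/2) *\<^sub>R (y \<lhd>\<^sub>m P \<lhd>\<^sub>m l ^ 4)" and ?v = "(1/2) *\<^sub>R (y \<lhd>\<^sub>m Q \<lhd>\<^sub>m l ^ 4)"
  have "zsgn 1 ((1/4) *\<^sub>R (2 *\<^sub>R (y \<lhd>\<^sub>m P \<lhd>\<^sub>m l ^ 4))) (sqrt (1/4) *\<^sub>R (y \<lhd>\<^sub>m P))"
    by (rule zsgn_scale[OF zP]) simp
  then have 1: "zsgn 1 ?u (sqrt (1/4) *\<^sub>R (y \<lhd>\<^sub>m P))" by simp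
  have "zsgn (-1) ((1/4) *\<^sub>R (2 *\<^sub>R (y \<lhd>\<^sub>m Q \<lhd>\<^sub>m l ^ 4))) (sqrt (1/4) *\<^sub>R (y \<lhd>\<^sub>m Q))"
    by (rule zsgn_scale[OF zQ]) simp
  then have 2: "zsgn (-1) ?v (sqrt (1/4) *\<^sub>R (y \<lhd>\<^sub>m Q))" by simp
  have "?u + ?v = (1/2) *\<^sub>R (y \<lhd>\<^sub>m ((P + Q) * l ^ 4))"
    by (simp only: ract_add_left ract_plus ract_times scaleR_right_distrib)
  also have "P + Q = 2 *\<^sub>R l ^ 3" by (simp add: P_def Q_def scaleR_2)
  finally have 3: "x = ?u + ?v" by (simp add: x ract_scaleR power_add[symmetric])
  have vv: "ipr ?v ?v = (1/4) *\<^sub>R (l ^ 4 * (Q * k * Q) * l ^ 4)"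
    by (simp add: ipr_scaleR ipr_ract1 ipr_ract2 Qa l adj_power k_def mult.assoc)
  have xx: "ipr x x = l ^ 7 * k * l ^ 7"
    by (simp add: x ipr_ract1 ipr_ract2 l adj_power k_def)
  have l7: "l ^ 7 = l * (l * (l * (l * (l * (l * l)))))" by (simp add: eval_nat_numeral mult.assoc)
  let ?A = "l ^ 4 * (Q * k * Q) * l ^ 4"
  \<comment> \<open>By \<open>Q * Q = 2 l ^ 3 Q\<close> and \<open>k * Q = - l ^ 2 Q\<close> both
    sides equal \<open>8 l ^ 29 Q\<close>.\<close>
  have "?A * ?A = 4 *\<^sub>R (?A * (l ^ 7 * k * l ^ 7))"
    unfolding Q_def
    by (simp add: algebra_simps power3_eq_cube power4_eq_xxxx l7 kl klz kk kkz scaleR_2 scaleR_4)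
  then have "ipr ?v ?v * ipr x x = ipr ?v ?v * ipr ?v ?v"
    unfolding vv xx by simp
  with 1 2 3 show ?thesis by blast
qed

lemma zettl_split:
  fixes x :: "'a::cstar_triple"
  shows "\<exists>u v p q. x = u + v \<and> zsgn 1 u p \<and> zsgn (-1) v q \<and>
    ipr v v * ipr x x = ipr v v * ipr v v"
proof -
  define N where "N = norm x + 1"
  have N: "N > 0" by (simp add: N_def add_nonneg_pos)
  have "norm ((1 / N) *\<^sub>R x) \<le> 1" using N by (simp add: N_def)
  then obtain u v p q where s: "(1 / N) *\<^sub>R x = u + v" "zsgn 1 u p" "zsgn (-1) v q"
    and o: "ipr v v * ipr ((1 / N) *\<^sub>R x) ((1 / N) *\<^sub>R x) = ipr v v * ipr v v"
    using zettl_split_unit by blast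
  have x: "x = N *\<^sub>R u + N *\<^sub>R v" using arg_cong[OF s(1), of "(*\<^sub>R) N"] N by (simp add: scaleR_right_distrib)
  moreover have "ipr (N *\<^sub>R v) (N *\<^sub>R v) * ipr x x = ipr (N *\<^sub>R v) (N *\<^sub>R v) * ipr (N *\<^sub>R v) (N *\<^sub>R v)"
    using arg_cong[OF o, of "(*\<^sub>R) (N * N * (N * N))"] N by (simp add: ipr_scaleR)
  ultimately show ?thesis using zsgn_scale[OF s(2) less_imp_le[OF N]] zsgn_scale[OF s(3) less_imp_le[OF N]]
    by (intro exI conjI)
qed

text \<open>Cut down to the negative part, \<open>c\<close> becomes \<open>c * V\<close> with
  \<open>V = ipr v v = - k * k\<close>. Then \<open>adj (c * V) * (c * V) = V ^ 3\<close> is the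
  negative of the square of \<open>k ^ 3\<close>, so \<open>kaplansky\<close> kills it, and
  \<open>V ^ 3 = 0\<close> forces \<open>v = 0\<close>.\<close>

lemma zsgn_of_adj_mult:
  fixes w :: "'a::cstar_triple"
  assumes "ipr w w = adj c * c"
  shows "\<exists>p. zsgn 1 w p"
proof -
  obtain u v p q where s: "w = u + v" "zsgn 1 u p" "zsgn (-1) v q"
    and o: "ipr v v * ipr w w = ipr v v * ipr v v"
    using zettl_split by blast
  let ?k = "ipr q q" and ?V = "ipr v v"
  have V: "?V = - (?k * ?k)" using zsgn_ipr[OF s(3)] by simp
  have cV: "adj (c * ?V) * (c * ?V) = ?V * ipr w w * ?V"
    by (simp add: adj_mult adj_ipr assms mult.assoc)
  also have "\<dots> = - (?k * ?k * ?k * (?k * ?k * ?k))" unfolding o by (simp add: V mult.assoc)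
  finally have "c * ?V = 0"
    by (rule kaplansky) (simp add: adj_mult adj_ipr mult.assoc)
  then have "?V * ipr w w * ?V = 0" using cV by simp
  then have "adj (?V * ?V) * (?V * ?V) = 0" unfolding o by (simp add: adj_mult adj_ipr mult.assoc)
  then have "?V * ?V = 0" by (rule adj_mult_eq_0)
  then have "?V = 0" using adj_mult_eq_0[of ?V] by (simp add: adj_ipr)
  then have "v = 0" by (rule ipr_self_eq_0)
  then show ?thesis using s by auto
qed

text \<open>The square of \<open>ipr p p\<close> would be the negative of the square of
  \<open>ipr q q\<close>, which \<open>kaplansky\<close> excludes.\<close>

lemma zsgn_both:
  assumes "zsgn 1 w p" "zsgn (-1) w q" shows "w = (0::'a::cstar_triple)"
proof -
  have "adj (ipr p p) * ipr p p = - (ipr q q * ipr q q)"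
    using zsgn_ipr[OF assms(1)] zsgn_ipr[OF assms(2)] by (simp add: adj_ipr)
  then have "ipr p p = 0" by (rule kaplansky) (simp add: adj_ipr)
  then have "ipr w w = 0" using zsgn_ipr[OF assms(1)] by simp
  then show ?thesis by (rule ipr_self_eq_0)
qed

section \<open>Complex modules and completions\<close>

lemma complex_field_simps [simp]:
  "carrier complex_field = UNIV" "monoid.mult complex_field = (*)" "monoid.one complex_field = 1"
  "ring.zero complex_field = 0" "ring.add complex_field = (+)"
  by (simp_all add: complex_field_def)

lemma null_sandwich:
  fixes f g :: "nat \<Rightarrow> real"
  assumes "g \<longlonglongrightarrow> 0" "\<And>n. f n \<le> g n" "\<And>n. 0 \<le> f n"
  shows "f \<longlonglongrightarrow> 0"
  by (rule real_tendsto_sandwich[OF _ _ tendsto_const assms(1)]) (simp_all add: assms(2,3))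

text \<open>Restates the module laws with scalars ranging over the type \<open>complex\<close>, free
  of membership conditions and of the operations of \<open>complex_field\<close>.\<close>

locale complex_module = module complex_field V for V :: "(complex, 'a, 'm) module_scheme" (structure)
begin

lemma smult_cl [simp]: "x \<in> carrier V \<Longrightarrow> c \<odot> x \<in> carrier V"
  using smult_closed[of c x] by simp

lemma smult_plus: "x \<in> carrier V \<Longrightarrow> (a + b) \<odot> x = a \<odot> x \<oplus> b \<odot> x"
  using smult_l_distr[of a b x] by simp

lemma smult_add: "x \<in> carrier V \<Longrightarrow> y \<in> carrier V \<Longrightarrow> c \<odot> (x \<oplus> y) = c \<odot> x \<oplus> c \<odot> y"
  using smult_r_distr[of c x y] by simp

lemma smult_smult: "x \<in> carrier V \<Longrightarrow> a \<odot> (b \<odot> x) = (a * b) \<odot> x"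
  using smult_assoc1[of a b x] by simp

lemma smult_1 [simp]: "x \<in> carrier V \<Longrightarrow> 1 \<odot> x = x"
  using smult_one[of x] by simp

lemma smult_0 [simp]: "x \<in> carrier V \<Longrightarrow> 0 \<odot> x = \<zero>"
  using smult_plus[of x 0 0] by simp

lemma smult_zero [simp]: "c \<odot> \<zero> = \<zero>"
  using smult_smult[of \<zero> c 0] by simp

lemma smult_minus1: "x \<in> carrier V \<Longrightarrow> (- 1) \<odot> x = \<ominus> x"
  using smult_plus[of x "-1" 1] by (intro minus_equality[symmetric]) simp_all

lemma minus_smult: "x \<in> carrier V \<Longrightarrow> y \<in> carrier V \<Longrightarrow> x \<ominus> y = x \<oplus> (- 1) \<odot> y"
  by (simp add: smult_minus1 a_minus_def)

lemma smult_diff: "x \<in> carrier V \<Longrightarrow> y \<in> carrier V \<Longrightarrow> c \<odot> (x \<ominus> y) = c \<odot> x \<ominus> c \<odot> y"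
  by (simp add: minus_smult smult_add smult_smult mult.commute)

lemma diff_self [simp]: "x \<in> carrier V \<Longrightarrow> x \<ominus> x = \<zero>"
  by (simp add: a_minus_def r_neg)

lemma diff_zero [simp]: "x \<in> carrier V \<Longrightarrow> x \<ominus> \<zero> = x"
  by (simp add: a_minus_def)

lemma minus_diff: "x \<in> carrier V \<Longrightarrow> y \<in> carrier V \<Longrightarrow> \<ominus> (x \<ominus> y) = y \<ominus> x"
  by (simp add: a_minus_def minus_add a_comm)

lemma diff_eq_zero: "x \<in> carrier V \<Longrightarrow> y \<in> carrier V \<Longrightarrow> x \<ominus> y = \<zero> \<Longrightarrow> x = y"
  by (metis a_minus_def minus_equality minus_minus a_inv_closed)

lemma diff_add_diff:
  "x \<in> carrier V \<Longrightarrow> y \<in> carrier V \<Longrightarrow> z \<in> carrier V \<Longrightarrow> (x \<ominus> y) \<oplus> (y \<ominus> z) = x \<ominus> z"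
  by (simp add: a_minus_def a_assoc) (simp add: a_assoc[symmetric] l_neg)

lemma add_diff_add:
  "x \<in> carrier V \<Longrightarrow> y \<in> carrier V \<Longrightarrow> x' \<in> carrier V \<Longrightarrow> y' \<in> carrier V \<Longrightarrow>
    (x \<oplus> y) \<ominus> (x' \<oplus> y') = (x \<ominus> x') \<oplus> (y \<ominus> y')"
  by (simp add: a_minus_def minus_add a_ac)

end

section \<open>Limits and Cauchy sequences for a seminorm\<close>

locale seminormed = complex_module V for V :: "(complex, 'a, 'm) module_scheme" (structure) +
  fixes p :: "'a \<Rightarrow> real"
  assumes seminorm: "seminorm_on V p"
begin

lemma p_nonneg [simp]: "x \<in> carrier V \<Longrightarrow> 0 \<le> p x"
  and p_add: "x \<in> carrier V \<Longrightarrow> y \<in> carrier V \<Longrightarrow> p (x \<oplus> y) \<le> p x + p y"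
  and p_smult: "x \<in> carrier V \<Longrightarrow> p (c \<odot> x) = cmod c * p x"
  using seminorm unfolding seminorm_on_def by blast+

lemma p_zero [simp]: "p \<zero> = 0"
  using p_smult[of \<zero> 0] by simp

lemma p_minus: "x \<in> carrier V \<Longrightarrow> p (\<ominus> x) = p x"
  using p_smult[of x "-1"] by (simp add: smult_minus1)

lemma p_diff_le: "x \<in> carrier V \<Longrightarrow> y \<in> carrier V \<Longrightarrow> p (x \<ominus> y) \<le> p x + p y"
  using p_add[of x "\<ominus> y"] by (simp add: a_minus_def p_minus)

lemma p_diff_comm: "x \<in> carrier V \<Longrightarrow> y \<in> carrier V \<Longrightarrow> p (x \<ominus> y) = p (y \<ominus> x)"
  using p_minus[of "x \<ominus> y"] by (simp add: minus_diff)

lemma p_triangle: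
  "x \<in> carrier V \<Longrightarrow> y \<in> carrier V \<Longrightarrow> z \<in> carrier V \<Longrightarrow> p (x \<ominus> z) \<le> p (x \<ominus> y) + p (y \<ominus> z)"
  using p_add[of "x \<ominus> y" "y \<ominus> z"] by (simp add: diff_add_diff)

lemma p_abs_diff: "x \<in> carrier V \<Longrightarrow> y \<in> carrier V \<Longrightarrow> \<bar>p x - p y\<bar> \<le> p (x \<ominus> y)"
  using p_triangle[of x y \<zero>] p_triangle[of y x \<zero>] p_diff_comm[of x y] by simp

text \<open>Membership of all terms is built in to spare side conditions. For a mere seminorm the
  limit is unique only up to distance 0, see \<open>lim_to_dist\<close>.\<close>

definition lim_to :: "(nat \<Rightarrow> 'a) \<Rightarrow> 'a \<Rightarrow> bool"
  where "lim_to s x \<longleftrightarrow> (\<forall>n. s n \<in> carrier V) \<and> x \<in> carrier V \<and> (\<lambda>n. p (s n \<ominus> x)) \<longlonglongrightarrow> 0"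

lemma lim_toI:
  assumes "\<And>n. s n \<in> carrier V" "x \<in> carrier V" "\<And>n. p (s n \<ominus> x) \<le> f n" "f \<longlonglongrightarrow> 0"
  shows "lim_to s x"
  unfolding lim_to_def
  using assms by (auto intro: tendsto_sandwich[where f = "\<lambda>_. 0" and h = f])

lemma lim_to_closed: "lim_to s x \<Longrightarrow> s n \<in> carrier V" "lim_to s x \<Longrightarrow> x \<in> carrier V"
  by (simp_all add: lim_to_def)

lemma lim_to_const: "x \<in> carrier V \<Longrightarrow> lim_to (\<lambda>_. x) x"
  by (simp add: lim_to_def)

lemma lim_to_add: "lim_to s x \<Longrightarrow> lim_to t y \<Longrightarrow> lim_to (\<lambda>n. s n \<oplus> t n) (x \<oplus> y)"
  by (rule lim_toI[where f = "\<lambda>n. p (s n \<ominus> x) + p (t n \<ominus> y)"])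
     (auto simp: lim_to_def add_diff_add intro!: p_add tendsto_add_zero)

lemma lim_to_smult: "lim_to s x \<Longrightarrow> lim_to (\<lambda>n. c \<odot> s n) (c \<odot> x)"
  by (rule lim_toI[where f = "\<lambda>n. cmod c * p (s n \<ominus> x)"])
     (auto simp: lim_to_def p_smult smult_diff[symmetric] intro!: tendsto_mult_right_zero)

lemma lim_to_norm: "lim_to s x \<Longrightarrow> (\<lambda>n. p (s n)) \<longlonglongrightarrow> p x"
  unfolding lim_to_def
  by (rule LIM_zero_cancel, rule Lim_null_comparison[where g = "\<lambda>n. p (s n \<ominus> x)"])
     (auto simp: p_abs_diff)

lemma lim_to_dist: "lim_to s x \<Longrightarrow> lim_to s y \<Longrightarrow> p (x \<ominus> y) = 0"
proof -
  assume s: "lim_to s x" "lim_to s y"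
  have "(\<lambda>n. p (s n \<ominus> x) + p (s n \<ominus> y)) \<longlonglongrightarrow> 0"
    using s by (auto simp: lim_to_def intro: tendsto_add_zero)
  moreover have "p (x \<ominus> y) \<le> p (s n \<ominus> x) + p (s n \<ominus> y)" for n
    using p_triangle[of x "s n" y] p_diff_comm[of x "s n"] s by (simp add: lim_to_def)
  ultimately have "p (x \<ominus> y) \<le> 0" by (intro LIMSEQ_le_const) auto
  then show ?thesis using s p_nonneg[of "x \<ominus> y"] by (simp add: lim_to_def del: p_nonneg)
qed

lemma cauchyD: "cauchy_in V p s \<Longrightarrow> s n \<in> carrier V"
  by (simp add: cauchy_in_def)

lemma cauchy_comp:
  assumes s: "cauchy_in V p s" and q: "\<And>n. f n \<in> carrier V"
    and le: "\<And>m n. p (f m \<ominus> f n) \<le> K * p (s m \<ominus> s n)"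
  shows "cauchy_in V p f"
  unfolding cauchy_in_def
proof (intro conjI allI impI)
  fix e :: real assume "e > 0"
  \<comment> \<open>The absolute value and the added 1 make the divisor positive whatever
    \<open>K\<close> is.\<close>
  then have "e / (\<bar>K\<bar> + 1) > 0" by (simp add: add_nonneg_pos)
  then obtain N where N: "\<And>m n. m \<ge> N \<Longrightarrow> n \<ge> N \<Longrightarrow> p (s m \<ominus> s n) < e / (\<bar>K\<bar> + 1)"
    using s unfolding cauchy_in_def by blast
  have "p (f m \<ominus> f n) < e" if "m \<ge> N" "n \<ge> N" for m n
  proof -
    have "K * p (s m \<ominus> s n) \<le> (\<bar>K\<bar> + 1) * p (s m \<ominus> s n)"
      using s by (intro mult_right_mono) (auto simp: cauchyD)
    also have "\<dots> < e" using N[OF that] by (simp add: pos_less_divide_eq add_nonneg_pos mult.commute)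
    finally show ?thesis using le[of m n] by simp
  qed
  then show "\<exists>N. \<forall>m\<ge>N. \<forall>n\<ge>N. p (f m \<ominus> f n) < e" by blast
qed (rule q)

lemma cauchy_const: "x \<in> carrier V \<Longrightarrow> cauchy_in V p (\<lambda>_. x)"
  by (simp add: cauchy_in_def)

lemma cauchy_add:
  assumes s: "cauchy_in V p s" and t: "cauchy_in V p t"
  shows "cauchy_in V p (\<lambda>n. s n \<oplus> t n)"
  unfolding cauchy_in_def
proof (intro conjI allI impI)
  fix e :: real assume "e > 0"
  then have "e / 2 > 0" by simp
  with s t obtain M N where "\<And>m n. m \<ge> M \<Longrightarrow> n \<ge> M \<Longrightarrow> p (s m \<ominus> s n) < e / 2"
    "\<And>m n. m \<ge> N \<Longrightarrow> n \<ge> N \<Longrightarrow> p (t m \<ominus> t n) < e / 2"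
    unfolding cauchy_in_def by metis
  moreover have "p (s m \<oplus> t m \<ominus> (s n \<oplus> t n)) \<le> p (s m \<ominus> s n) + p (t m \<ominus> t n)" for m n
    using s t by (simp add: cauchyD add_diff_add p_add)
  ultimately have "p (s m \<oplus> t m \<ominus> (s n \<oplus> t n)) < e" if "m \<ge> max M N" "n \<ge> max M N" for m n
    using that by (smt (verit, best) field_sum_of_halves max.bounded_iff)
  then show "\<exists>N. \<forall>m\<ge>N. \<forall>n\<ge>N. p (s m \<oplus> t m \<ominus> (s n \<oplus> t n)) < e" by blast
qed (use s t in \<open>simp add: cauchyD\<close>)

lemma cauchy_smult: "cauchy_in V p s \<Longrightarrow> cauchy_in V p (\<lambda>n. c \<odot> s n)"
  by (rule cauchy_comp[where K = "cmod c"]) (auto simp: cauchyD smult_diff[symmetric] p_smult)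

lemma cauchy_norm: "cauchy_in V p s \<Longrightarrow> Cauchy (\<lambda>n. p (s n))"
proof (rule CauchyI)
  fix e :: real assume s: "cauchy_in V p s" and "e > 0"
  then obtain N where "\<And>m n. m \<ge> N \<Longrightarrow> n \<ge> N \<Longrightarrow> p (s m \<ominus> s n) < e"
    unfolding cauchy_in_def by blast
  then show "\<exists>M. \<forall>m\<ge>M. \<forall>n\<ge>M. norm (p (s m) - p (s n)) < e"
    using p_abs_diff[OF cauchyD[OF s] cauchyD[OF s]] by (metis order_le_less_trans real_norm_def)
qed

lemma cauchy_bounded:
  assumes "cauchy_in V p s" obtains M where "M \<ge> 0" "\<And>n. p (s n) \<le> M"
proof -
  have "Bseq (\<lambda>n. p (s n))" using cauchy_norm[OF assms] by (rule Cauchy_Bseq)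
  then obtain M where "\<And>n. \<bar>p (s n)\<bar> \<le> M" by (auto simp: Bseq_def)
  then show ?thesis using that[of M] by (meson abs_ge_self abs_ge_zero order_trans)
qed

lemma cauchy_diff_null:
  assumes s: "cauchy_in V p s" and e: "e > 0"
  shows "\<exists>N. \<forall>m\<ge>N. \<forall>n\<ge>N. p (s m \<ominus> s n) < e"
  using assms unfolding cauchy_in_def by blast

section \<open>The space of classes of Cauchy sequences\<close>

abbreviation cl :: "(nat \<Rightarrow> 'a) \<Rightarrow> (nat \<Rightarrow> 'a) set" where "cl \<equiv> completion_class V p"

lemma equiv_completion: "equiv {s. cauchy_in V p s} (completion_rel V p)"
proof (rule equivI)
  show "completion_rel V p \<subseteq> {s. cauchy_in V p s} \<times> {s. cauchy_in V p s}"
    by (auto simp: completion_rel_def)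
  show "refl_on {s. cauchy_in V p s} (completion_rel V p)"
    by (auto simp: refl_on_def completion_rel_def cauchyD)
  show "sym (completion_rel V p)"
    by (auto simp: sym_def completion_rel_def p_diff_comm cauchyD)
  show "trans (completion_rel V p)"
  proof (rule transI)
    fix s t u assume "(s, t) \<in> completion_rel V p" "(t, u) \<in> completion_rel V p"
    then have c: "cauchy_in V p s" "cauchy_in V p t" "cauchy_in V p u"
      and st: "(\<lambda>n. p (s n \<ominus> t n)) \<longlonglongrightarrow> 0" and tu: "(\<lambda>n. p (t n \<ominus> u n)) \<longlonglongrightarrow> 0"
      by (auto simp: completion_rel_def)
    have "(\<lambda>n. p (s n \<ominus> u n)) \<longlonglongrightarrow> 0"
      by (rule tendsto_sandwich[OF _ _ tendsto_const tendsto_add_zero[OF st tu]])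
         (use c in \<open>auto simp: cauchyD p_triangle\<close>)
    with c show "(s, u) \<in> completion_rel V p" by (simp add: completion_rel_def)
  qed
qed

lemma cl_eq_iff:
  "cauchy_in V p s \<Longrightarrow> cauchy_in V p t \<Longrightarrow> cl s = cl t \<longleftrightarrow> (\<lambda>n. p (s n \<ominus> t n)) \<longlonglongrightarrow> 0"
  using eq_equiv_class_iff[OF equiv_completion, of s t]
  by (simp add: completion_class_def completion_rel_def)

lemma cl_closed: "cauchy_in V p s \<Longrightarrow> cl s \<in> completion_carrier V p"
  unfolding completion_carrier_def completion_class_def by (rule quotientI) simp

text \<open>\<open>rep\<close> returns an uncontrolled member of the class. All that may be used of
  it is that it is Cauchy and differs from \<open>s\<close> by a null sequence.\<close>

lemma rep_cl:
  assumes "cauchy_in V p s"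
  shows "cauchy_in V p (rep (cl s))" "(\<lambda>n. p (s n \<ominus> rep (cl s) n)) \<longlonglongrightarrow> 0"
    "cl (rep (cl s)) = cl s"
proof -
  have "s \<in> cl s"
    using equiv_class_self[OF equiv_completion, of s] assms by (simp add: completion_class_def)
  then have "rep (cl s) \<in> cl s" unfolding rep_def by (rule someI[where P = "\<lambda>t. t \<in> cl s"])
  then have r: "(s, rep (cl s)) \<in> completion_rel V p" by (simp add: completion_class_def)
  then show "cauchy_in V p (rep (cl s))" "(\<lambda>n. p (s n \<ominus> rep (cl s) n)) \<longlonglongrightarrow> 0"
    by (simp_all add: completion_rel_def)
  then show "cl (rep (cl s)) = cl s" using assms cl_eq_iff by blast
qed

lemma completionE:
  assumes "X \<in> completion_carrier V p"
  obtains s where "cauchy_in V p s" "X = cl s"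
  using assms unfolding completion_carrier_def completion_class_def by (auto elim!: quotientE)

text \<open>A Lipschitz map changes by a null sequence when the representative does, so it may be
  computed on any representative.\<close>

lemma cl_op1:
  assumes f: "\<And>s. cauchy_in V p s \<Longrightarrow> cauchy_in V p (\<lambda>n. f (s n))"
    and le: "\<And>x y. x \<in> carrier V \<Longrightarrow> y \<in> carrier V \<Longrightarrow> p (f x \<ominus> f y) \<le> K * p (x \<ominus> y)"
    and s: "cauchy_in V p s"
  shows "cl (\<lambda>n. f (rep (cl s) n)) = cl (\<lambda>n. f (s n))"
proof (rule sym, subst cl_eq_iff[OF f[OF s] f[OF rep_cl(1)[OF s]]])
  have "(\<lambda>n. K * p (s n \<ominus> rep (cl s) n)) \<longlonglongrightarrow> 0"
    by (rule tendsto_mult_right_zero[OF rep_cl(2)[OF s]])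
  moreover have "p (f (s n) \<ominus> f (rep (cl s) n)) \<le> K * p (s n \<ominus> rep (cl s) n)" for n
    by (rule le[OF cauchyD[OF s] cauchyD[OF rep_cl(1)[OF s]]])
  moreover have "0 \<le> p (f (s n) \<ominus> f (rep (cl s) n))" for n
    using cauchyD[OF f[OF s]] cauchyD[OF f[OF rep_cl(1)[OF s]]] by simp
  ultimately show "(\<lambda>n. p (f (s n) \<ominus> f (rep (cl s) n))) \<longlonglongrightarrow> 0"
    by (rule null_sandwich)
qed

lemma cl_add:
  assumes s: "cauchy_in V p s" and t: "cauchy_in V p t"
  shows "cl (\<lambda>n. rep (cl s) n \<oplus> rep (cl t) n) = cl (\<lambda>n. s n \<oplus> t n)"
proof (rule sym, subst cl_eq_iff[OF cauchy_add[OF s t] cauchy_add[OF rep_cl(1)[OF s] rep_cl(1)[OF t]]])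
  note c = cauchyD[OF s] cauchyD[OF t] cauchyD[OF rep_cl(1)[OF s]] cauchyD[OF rep_cl(1)[OF t]]
  show "(\<lambda>n. p (s n \<oplus> t n \<ominus> (rep (cl s) n \<oplus> rep (cl t) n))) \<longlonglongrightarrow> 0"
    by (rule tendsto_sandwich[OF _ _ tendsto_const tendsto_add_zero[OF rep_cl(2)[OF s] rep_cl(2)[OF t]]])
       (auto simp: c add_diff_add intro!: p_add always_eventually)
qed

lemma cl_smult: "cauchy_in V p s \<Longrightarrow> cl (\<lambda>n. c \<odot> rep (cl s) n) = cl (\<lambda>n. c \<odot> s n)"
  by (rule cl_op1[where f = "\<lambda>x. c \<odot> x" and K = "cmod c"])
     (auto simp: cauchy_smult smult_diff[symmetric] p_smult)

lemma completion_norm_cl: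
  assumes s: "cauchy_in V p s"
  shows "(\<lambda>n. p (s n)) \<longlonglongrightarrow> completion_norm p (cl s)"
proof -
  have "convergent (\<lambda>n. p (rep (cl s) n))"
    using cauchy_norm[OF rep_cl(1)[OF s]] by (simp add: Cauchy_convergent_iff)
  then have "(\<lambda>n. p (rep (cl s) n)) \<longlonglongrightarrow> completion_norm p (cl s)"
    unfolding completion_norm_def by (rule convergent_LIMSEQ_iff[THEN iffD1])
  moreover have "(\<lambda>n. p (s n) - p (rep (cl s) n)) \<longlonglongrightarrow> 0"
    by (rule Lim_null_comparison[OF _ rep_cl(2)[OF s]])
       (auto simp: p_abs_diff cauchyD[OF s] cauchyD[OF rep_cl(1)[OF s]])
  ultimately show ?thesis using tendsto_add by fastforce
qed

lemma completion_norm_cl_le: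
  "cauchy_in V p s \<Longrightarrow> (\<And>n. n \<ge> N \<Longrightarrow> p (s n) \<le> K) \<Longrightarrow> completion_norm p (cl s) \<le> K"
  by (rule LIMSEQ_le_const2[OF completion_norm_cl]) auto

end

text \<open>\<open>C\<close> is any record whose linear part is the completion; this serves the
  completions of algebras and of trings alike.\<close>

locale completed = seminormed V p for V :: "(complex, 'a, 'm) module_scheme" (structure) and p +
  fixes C :: "(complex, (nat \<Rightarrow> 'a) set, 'k) module_scheme"
  assumes C_carrier: "carrier C = completion_carrier V p"
    and C_zero: "ring.zero C = completion_class V p (\<lambda>n. \<zero>\<^bsub>V\<^esub>)"
    and C_add: "ring.add C = (\<lambda>X Y. completion_class V p (\<lambda>n. rep X n \<oplus>\<^bsub>V\<^esub> rep Y n))"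
    and C_smult: "module.smult C = (\<lambda>c X. completion_class V p (\<lambda>n. c \<odot>\<^bsub>V\<^esub> rep X n))"
begin

lemma C_add_cl: "cauchy_in V p s \<Longrightarrow> cauchy_in V p t \<Longrightarrow> cl s \<oplus>\<^bsub>C\<^esub> cl t = cl (\<lambda>n. s n \<oplus> t n)"
  by (simp add: C_add cl_add)

lemma C_smult_cl: "cauchy_in V p s \<Longrightarrow> c \<odot>\<^bsub>C\<^esub> cl s = cl (\<lambda>n. c \<odot> s n)"
  by (simp add: C_smult cl_smult)

lemma C_closed: "cauchy_in V p s \<Longrightarrow> cl s \<in> carrier C"
  by (simp add: C_carrier cl_closed)

lemma CE:
  assumes "X \<in> carrier C" obtains s where "cauchy_in V p s" "X = cl s"
  using assms completionE unfolding C_carrier by blast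

lemma C_module: "module complex_field C"
proof (rule moduleI[OF cring_complex_field])
  note sim = C_add_cl C_smult_cl C_closed C_zero cauchy_add cauchy_smult cauchy_const cauchyD
  show "abelian_group C"
  proof (rule abelian_groupI)
    fix X Y assume "X \<in> carrier C" "Y \<in> carrier C"
    then obtain s t where "cauchy_in V p s" "X = cl s" "cauchy_in V p t" "Y = cl t" by (meson CE)
    then show "X \<oplus>\<^bsub>C\<^esub> Y \<in> carrier C" "X \<oplus>\<^bsub>C\<^esub> Y = Y \<oplus>\<^bsub>C\<^esub> X"
      by (auto simp: sim a_comm)
    fix Z assume "Z \<in> carrier C"
    then obtain u where "cauchy_in V p u" "Z = cl u" by (meson CE)
    with \<open>cauchy_in V p s\<close> \<open>X = cl s\<close> \<open>cauchy_in V p t\<close> \<open>Y = cl t\<close>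
    show "X \<oplus>\<^bsub>C\<^esub> Y \<oplus>\<^bsub>C\<^esub> Z = X \<oplus>\<^bsub>C\<^esub> (Y \<oplus>\<^bsub>C\<^esub> Z)"
      by (simp add: sim a_assoc)
  next
    fix X assume "X \<in> carrier C"
    then obtain s where s: "cauchy_in V p s" "X = cl s" by (meson CE)
    then show "\<zero>\<^bsub>C\<^esub> \<oplus>\<^bsub>C\<^esub> X = X" by (simp add: sim)
    have "(\<lambda>n. (- 1) \<odot> s n \<oplus> s n) = (\<lambda>n. \<zero>)" using s by (simp add: smult_minus1 l_neg cauchyD)
    then have "(- 1) \<odot>\<^bsub>C\<^esub> X \<oplus>\<^bsub>C\<^esub> X = \<zero>\<^bsub>C\<^esub>" using s by (simp add: sim)
    then show "\<exists>Y\<in>carrier C. Y \<oplus>\<^bsub>C\<^esub> X = \<zero>\<^bsub>C\<^esub>"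
      using s by (intro bexI[of _ "(- 1) \<odot>\<^bsub>C\<^esub> X"]) (auto simp: sim)
  qed (simp add: sim)
  fix a b X assume "X \<in> carrier C"
  then obtain s where s: "cauchy_in V p s" "X = cl s" by (meson CE)
  show "a \<odot>\<^bsub>C\<^esub> X \<in> carrier C" using s by (simp add: sim)
  show "(a \<oplus>\<^bsub>complex_field\<^esub> b) \<odot>\<^bsub>C\<^esub> X = a \<odot>\<^bsub>C\<^esub> X \<oplus>\<^bsub>C\<^esub> b \<odot>\<^bsub>C\<^esub> X"
    using s by (simp add: sim smult_plus)
  show "a \<otimes>\<^bsub>complex_field\<^esub> b \<odot>\<^bsub>C\<^esub> X = a \<odot>\<^bsub>C\<^esub> (b \<odot>\<^bsub>C\<^esub> X)"
    using s by (simp add: sim smult_smult)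
  show "\<one>\<^bsub>complex_field\<^esub> \<odot>\<^bsub>C\<^esub> X = X" using s by (simp add: sim)
  fix Y assume "Y \<in> carrier C"
  then obtain t where "cauchy_in V p t" "Y = cl t" by (meson CE)
  then show "a \<odot>\<^bsub>C\<^esub> (X \<oplus>\<^bsub>C\<^esub> Y) = a \<odot>\<^bsub>C\<^esub> X \<oplus>\<^bsub>C\<^esub> a \<odot>\<^bsub>C\<^esub> Y"
    using s by (simp add: sim smult_add)
qed

sublocale C: complex_module C by (intro complex_module.intro C_module)

lemma C_diff_cl: "cauchy_in V p s \<Longrightarrow> cauchy_in V p t \<Longrightarrow> cl s \<ominus>\<^bsub>C\<^esub> cl t = cl (\<lambda>n. s n \<ominus> t n)"
  by (simp add: C.minus_smult C_closed C_smult_cl C_add_cl cauchy_smult minus_smult cauchyD)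

lemma cauchy_diff: "cauchy_in V p s \<Longrightarrow> cauchy_in V p t \<Longrightarrow> cauchy_in V p (\<lambda>n. s n \<ominus> t n)"
  using cauchy_add[OF _ cauchy_smult[of t "-1"], of s] by (simp add: minus_smult cauchyD)

lemma C_norm: "norm_on C (completion_norm p)"
  unfolding norm_on_def seminorm_on_def
proof (intro conjI ballI allI impI)
  fix X assume "X \<in> carrier C"
  then obtain s where s: "cauchy_in V p s" and X: "X = cl s" by (meson CE)
  note L = completion_norm_cl[OF s]
  show "0 \<le> completion_norm p X" unfolding X
    by (rule LIMSEQ_le_const[OF L]) (auto simp: cauchyD[OF s])
  show "completion_norm p (c \<odot>\<^bsub>C\<^esub> X) = cmod c * completion_norm p X" for c
    using completion_norm_cl[OF cauchy_smult[OF s]] tendsto_mult_left[OF L, of "cmod c"]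
    unfolding X C_smult_cl[OF s] by (auto simp: p_smult cauchyD[OF s] intro: LIMSEQ_unique)
  show "X = \<zero>\<^bsub>C\<^esub>" if "completion_norm p X = 0"
    using L that by (simp add: X C_zero cl_eq_iff s cauchy_const cauchyD[OF s])
  fix Y assume "Y \<in> carrier C"
  then obtain t where t: "cauchy_in V p t" and Y: "Y = cl t" by (meson CE)
  show "completion_norm p (X \<oplus>\<^bsub>C\<^esub> Y) \<le> completion_norm p X + completion_norm p Y"
    unfolding X Y C_add_cl[OF s t]
    by (rule LIMSEQ_le[OF completion_norm_cl[OF cauchy_add[OF s t]] tendsto_add[OF L completion_norm_cl[OF t]]])
       (auto simp: p_add cauchyD[OF s] cauchyD[OF t])
qed

sublocale C: seminormed C "completion_norm p"
  by standard (use C_norm in \<open>simp add: norm_on_def\<close>)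

lemma C_dist_const:
  assumes s: "cauchy_in V p s" and x: "x \<in> carrier V" and le: "\<And>n. n \<ge> N \<Longrightarrow> p (s n \<ominus> x) \<le> e"
  shows "completion_norm p (cl s \<ominus>\<^bsub>C\<^esub> cl (\<lambda>_. x)) \<le> e"
  using completion_norm_cl_le[OF cauchy_diff[OF s cauchy_const[OF x]] le] s x
  by (simp add: C_diff_cl cauchy_const)

lemma C_approx:
  assumes "X \<in> carrier C" "e > 0"
  shows "\<exists>x. x \<in> carrier V \<and> completion_norm p (X \<ominus>\<^bsub>C\<^esub> cl (\<lambda>_. x)) \<le> e"
proof -
  obtain s where s: "cauchy_in V p s" and X: "X = cl s" using assms(1) by (meson CE)
  obtain N where "\<forall>m\<ge>N. \<forall>n\<ge>N. p (s m \<ominus> s n) < e" using cauchy_diff_null[OF s assms(2)] by blast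
  then have "completion_norm p (X \<ominus>\<^bsub>C\<^esub> cl (\<lambda>_. s N)) \<le> e"
    unfolding X by (intro C_dist_const[OF s cauchyD[OF s], where N = N]) (auto intro: less_imp_le)
  then show ?thesis using cauchyD[OF s] by blast
qed

lemma C_norm_const: "x \<in> carrier V \<Longrightarrow> completion_norm p (cl (\<lambda>_. x)) = p x"
  using completion_norm_cl[OF cauchy_const] by (simp add: LIMSEQ_const_iff)

text \<open>For each \<open>X k\<close> a point of \<open>V\<close> at distance at most
  \<open>1 / (k + 1)\<close> is chosen. These points form a Cauchy sequence in \<open>V\<close>, and
  its class is the limit.\<close>

lemma C_complete: "complete_in C (completion_norm p)"
  unfolding complete_in_def
proof (intro allI impI)
  fix X assume X: "cauchy_in C (completion_norm p) X"
  let ?N = "completion_norm p"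
  have "\<exists>x. x \<in> carrier V \<and> ?N (X k \<ominus>\<^bsub>C\<^esub> cl (\<lambda>_. x)) \<le> 1 / real (Suc k)" for k
    by (rule C_approx[OF C.cauchyD[OF X]]) simp
  then obtain d where d: "\<And>k. d k \<in> carrier V" "\<And>k. ?N (X k \<ominus>\<^bsub>C\<^esub> cl (\<lambda>_. d k)) \<le> 1 / real (Suc k)"
    by metis
  have cd: "cl (\<lambda>_. d k) \<in> carrier C" for k by (simp add: C_closed cauchy_const d)
  have Xc: "X k \<in> carrier C" for k by (rule C.cauchyD[OF X])
  have dd: "p (d k \<ominus> d j) \<le> 1 / real (Suc k) + ?N (X k \<ominus>\<^bsub>C\<^esub> X j) + 1 / real (Suc j)" for j k
  proof -
    have "p (d k \<ominus> d j) = ?N (cl (\<lambda>_. d k) \<ominus>\<^bsub>C\<^esub> cl (\<lambda>_. d j))"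
      using C_norm_const[of "d k \<ominus> d j"] by (simp add: C_diff_cl cauchy_const d)
    also have "\<dots> \<le> ?N (X k \<ominus>\<^bsub>C\<^esub> cl (\<lambda>_. d k)) + ?N (X k \<ominus>\<^bsub>C\<^esub> X j) + ?N (X j \<ominus>\<^bsub>C\<^esub> cl (\<lambda>_. d j))"
      using C.p_triangle[OF cd[of k] Xc[of k] cd[of j]] C.p_triangle[OF Xc[of k] Xc[of j] cd[of j]]
        C.p_diff_comm[OF cd[of k] Xc[of k]] by linarith
    finally show ?thesis using d(2)[of k] d(2)[of j] by linarith
  qed
  have cauchy_d: "cauchy_in V p d"
    unfolding cauchy_in_def
  proof (intro conjI allI impI)
    fix e :: real assume e: "e > 0"
    obtain M where M: "\<And>m n. m \<ge> M \<Longrightarrow> n \<ge> M \<Longrightarrow> ?N (X m \<ominus>\<^bsub>C\<^esub> X n) < e / 3"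
      using C.cauchy_diff_null[OF X, of "e / 3"] e by auto
    obtain K where K: "1 / real (Suc K) < e / 3" using e nat_approx_posE by (metis zero_less_divide_iff zero_less_numeral)
    have K': "1 / real (Suc k) < e / 3" if "k \<ge> K" for k
      using K that by (smt (verit) Suc_le_mono frac_le of_nat_0_less_iff of_nat_mono zero_less_Suc)
    have "p (d m \<ominus> d n) < e" if "m \<ge> max K M" "n \<ge> max K M" for m n
      using dd[of m n] M[of m n] K'[of m] K'[of n] that by simp
    then show "\<exists>N. \<forall>m\<ge>N. \<forall>n\<ge>N. p (d m \<ominus> d n) < e" by blast
  qed (rule d)
  have "(\<lambda>k. ?N (X k \<ominus>\<^bsub>C\<^esub> cl d)) \<longlonglongrightarrow> 0"
  proof (rule LIMSEQ_I)
    fix e :: real assume e: "e > 0"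
    obtain M where M: "\<And>m n. m \<ge> M \<Longrightarrow> n \<ge> M \<Longrightarrow> p (d m \<ominus> d n) < e / 3"
      using cauchy_diff_null[OF cauchy_d, of "e / 3"] e by auto
    obtain K where K: "1 / real (Suc K) < e / 3" using e nat_approx_posE by (metis zero_less_divide_iff zero_less_numeral)
    have K': "1 / real (Suc k) < e / 3" if "k \<ge> K" for k
      using K that by (smt (verit) Suc_le_mono frac_le of_nat_0_less_iff of_nat_mono zero_less_Suc)
    have "norm (?N (X k \<ominus>\<^bsub>C\<^esub> cl d) - 0) < e" if k: "k \<ge> max K M" for k
    proof -
      have "?N (cl d \<ominus>\<^bsub>C\<^esub> cl (\<lambda>_. d k)) \<le> e / 3"
        by (rule C_dist_const[OF cauchy_d d(1), where N = M]) (use M k in \<open>auto intro: less_imp_le\<close>)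
      moreover have "?N (X k \<ominus>\<^bsub>C\<^esub> cl d) \<le> ?N (X k \<ominus>\<^bsub>C\<^esub> cl (\<lambda>_. d k)) + ?N (cl d \<ominus>\<^bsub>C\<^esub> cl (\<lambda>_. d k))"
        using C.p_triangle[OF Xc[of k] cd[of k] C_closed[OF cauchy_d]]
          C.p_diff_comm[OF cd[of k] C_closed[OF cauchy_d]] by simp
      moreover have "0 \<le> ?N (X k \<ominus>\<^bsub>C\<^esub> cl d)"
        using Xc C_closed[OF cauchy_d] by simp
      ultimately show ?thesis using d(2)[of k] K'[of k] k e by simp
    qed
    then show "\<exists>no. \<forall>k\<ge>no. norm (?N (X k \<ominus>\<^bsub>C\<^esub> cl d) - 0) < e" by blast
  qed
  then show "\<exists>x\<in>carrier C. (\<lambda>n. ?N (X n \<ominus>\<^bsub>C\<^esub> x)) \<longlonglongrightarrow> 0"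
    using C_closed[OF cauchy_d] by blast
qed

end

section \<open>The product of all C*-trings on a type\<close>

sublocale star_tring \<subseteq> complex_module E
  by (intro complex_module.intro module_axioms)

context star_tring
begin

lemma tprod_zero [simp]:
  "y \<in> carrier E \<Longrightarrow> z \<in> carrier E \<Longrightarrow> tprod E \<zero> y z = \<zero>"
  "x \<in> carrier E \<Longrightarrow> z \<in> carrier E \<Longrightarrow> tprod E x \<zero> z = \<zero>"
  "x \<in> carrier E \<Longrightarrow> y \<in> carrier E \<Longrightarrow> tprod E x y \<zero> = \<zero>"
  using tprod_smult1[of \<zero> y z 0] tprod_smult2[of x \<zero> z 0] tprod_smult3[of x y \<zero> 0]
  by (simp_all add: tprod_closed)

lemma tprod_diff:
  "\<lbrakk>x \<in> carrier E; x' \<in> carrier E; y \<in> carrier E; z \<in> carrier E\<rbrakk> \<Longrightarrow>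
    tprod E (x \<ominus> x') y z = tprod E x y z \<ominus> tprod E x' y z"
  "\<lbrakk>x \<in> carrier E; y \<in> carrier E; y' \<in> carrier E; z \<in> carrier E\<rbrakk> \<Longrightarrow>
    tprod E x (y \<ominus> y') z = tprod E x y z \<ominus> tprod E x y' z"
  "\<lbrakk>x \<in> carrier E; y \<in> carrier E; z \<in> carrier E; z' \<in> carrier E\<rbrakk> \<Longrightarrow>
    tprod E x y (z \<ominus> z') = tprod E x y z \<ominus> tprod E x y z'"
  by (simp_all add: minus_smult tprod_add1 tprod_add2 tprod_add3 tprod_smult1 tprod_smult2
      tprod_smult3 tprod_closed)

text \<open>\<open>zsgn\<close> relative to a carrier; the sign is a complex number because the
  scalars are.\<close>

definition zs :: "complex \<Rightarrow> 'a \<Rightarrow> 'a \<Rightarrow> bool"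
  where "zs e u p \<longleftrightarrow> u \<in> carrier E \<and> p \<in> carrier E \<and> (\<forall>z\<in>carrier E.
    tprod E u u z = e \<odot> tprod E p p (tprod E p p z) \<and>
    tprod E z u u = e \<odot> tprod E (tprod E z p p) p p)"

end

text \<open>The record is not extensible here, so that the rings with points in a given type form
  one type, over which the product below can be taken.\<close>

locale cstar_tring = star_tring F for F :: "'a tring" (structure) +
  fixes \<gamma> :: "'a \<Rightarrow> real"
  assumes norm_F: "norm_on F \<gamma>" and SN_F: "\<gamma> \<in> SN F" and complete_F: "complete_in F \<gamma>"

sublocale cstar_tring \<subseteq> seminormed F \<gamma>
  by (intro seminormed.intro complex_module_axioms seminormed_axioms.intro)
     (use norm_F in \<open>simp add: norm_on_def\<close>)

context cstar_tring
begin

lemma g_eq_0: "x \<in> carrier F \<Longrightarrow> \<gamma> x = 0 \<Longrightarrow> x = \<zero>"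
  using norm_F by (simp add: norm_on_def)

lemma g_tprod: "x \<in> carrier F \<Longrightarrow> y \<in> carrier F \<Longrightarrow> z \<in> carrier F \<Longrightarrow>
    \<gamma> (tprod F x y z) \<le> \<gamma> x * \<gamma> y * \<gamma> z"
  and g_cube: "x \<in> carrier F \<Longrightarrow> \<gamma> (tprod F x x x) = \<gamma> x ^ 3"
  using SN_F by (simp_all add: SN_def)

lemma cube_eq_0: "x \<in> carrier F \<Longrightarrow> tprod F x x x = \<zero> \<Longrightarrow> x = \<zero>"
  using g_cube[of x] g_eq_0[of x] by simp

lemma g_diff_0: "x \<in> carrier F \<Longrightarrow> y \<in> carrier F \<Longrightarrow> \<gamma> (x \<ominus> y) = 0 \<Longrightarrow> x = y"
  using g_eq_0[of "x \<ominus> y"] diff_eq_zero[of x y] by simp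

lemma lim_unique: "lim_to s x \<Longrightarrow> lim_to s y \<Longrightarrow> x = y"
  using lim_to_dist[of s x y] g_diff_0 lim_to_closed(2) by blast

lemma ex_lim: "cauchy_in F \<gamma> s \<Longrightarrow> \<exists>x. lim_to s x"
  using complete_F unfolding complete_in_def lim_to_def by (auto simp: cauchyD)

end

section \<open>Bounded sections over all C*-trings\<close>

text \<open>HOL has no types depending on the parameters \<open>F\<close>, \<open>\<gamma>\<close> of the locale. To use type classes
  nevertheless, all C*-trings with points of a given type are collected into their
  \<open>\<ell>\<^sup>\<infinity>\<close>-product, of which each of them is a direct summand.\<close>

definition is_sec :: "('a tring \<Rightarrow> ('a \<Rightarrow> real) \<Rightarrow> 'a) \<Rightarrow> bool"
  where "is_sec f \<longleftrightarrow>
    (\<forall>F \<gamma>. (cstar_tring F \<gamma> \<longrightarrow> f F \<gamma> \<in> carrier F) \<and> (\<not> cstar_tring F \<gamma> \<longrightarrow> f F \<gamma> = undefined)) \<and>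
    (\<exists>K. \<forall>F \<gamma>. cstar_tring F \<gamma> \<longrightarrow> \<gamma> (f F \<gamma>) \<le> K)"

definition extend_sec :: "('a tring \<Rightarrow> ('a \<Rightarrow> real) \<Rightarrow> 'a) \<Rightarrow> 'a tring \<Rightarrow> ('a \<Rightarrow> real) \<Rightarrow> 'a"
  where "extend_sec h F \<gamma> = (if cstar_tring F \<gamma> then h F \<gamma> else undefined)"

lemma is_sec_extend:
  assumes "\<And>F \<gamma>. cstar_tring F \<gamma> \<Longrightarrow> h F \<gamma> \<in> carrier F" "\<And>F \<gamma>. cstar_tring F \<gamma> \<Longrightarrow> \<gamma> (h F \<gamma>) \<le> K"
  shows "is_sec (extend_sec h)"
  using assms unfolding is_sec_def extend_sec_def by auto

lemma (in cstar_tring) zero_sec: "\<zero> \<in> carrier F \<and> \<gamma> \<zero> \<le> 0"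
  by simp

typedef 'a csec = "{f :: 'a tring \<Rightarrow> ('a \<Rightarrow> real) \<Rightarrow> 'a. is_sec f}"
  using is_sec_extend[of "\<lambda>F \<gamma>. \<zero>\<^bsub>F\<^esub>" 0] cstar_tring.zero_sec by blast

abbreviation app :: "'a csec \<Rightarrow> 'a tring \<Rightarrow> ('a \<Rightarrow> real) \<Rightarrow> 'a" where "app \<equiv> Rep_csec"

definition mk_sec :: "('a tring \<Rightarrow> ('a \<Rightarrow> real) \<Rightarrow> 'a) \<Rightarrow> 'a csec"
  where "mk_sec h = Abs_csec (extend_sec h)"

lemma app_closed: "cstar_tring F \<gamma> \<Longrightarrow> app f F \<gamma> \<in> carrier F"
  using Rep_csec[of f] by (simp add: is_sec_def)

lemma csec_eqI: "(\<And>F \<gamma>. cstar_tring F \<gamma> \<Longrightarrow> app f F \<gamma> = app g F \<gamma>) \<Longrightarrow> f = g"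
proof -
  assume h: "\<And>F \<gamma>. cstar_tring F \<gamma> \<Longrightarrow> app f F \<gamma> = app g F \<gamma>"
  have "app f F \<gamma> = app g F \<gamma>" for F \<gamma>
    using h Rep_csec[of f] Rep_csec[of g] by (cases "cstar_tring F \<gamma>") (auto simp: is_sec_def)
  then show ?thesis by (metis Rep_csec_inject ext)
qed

lemma app_mk:
  assumes "\<And>F \<gamma>. cstar_tring F \<gamma> \<Longrightarrow> h F \<gamma> \<in> carrier F \<and> \<gamma> (h F \<gamma>) \<le> K" "cstar_tring F \<gamma>"
  shows "app (mk_sec h) F \<gamma> = h F \<gamma>"
proof -
  have "is_sec (extend_sec h)" using assms(1) by (intro is_sec_extend) auto
  then show ?thesis using assms(2) by (simp add: mk_sec_def Abs_csec_inverse extend_sec_def)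
qed

text \<open>The inserted 0 makes the set nonempty and the norm nonnegative without exhibiting a
  C*-tring.\<close>

definition sec_norm :: "'a csec \<Rightarrow> real"
  where "sec_norm f = Sup (insert 0 {\<gamma> (app f F \<gamma>) | F \<gamma>. cstar_tring F \<gamma>})"

lemma sec_norm_ge: "cstar_tring F \<gamma> \<Longrightarrow> \<gamma> (app f F \<gamma>) \<le> sec_norm f"
  and sec_norm_nonneg: "0 \<le> sec_norm f"
proof -
  obtain K where "\<And>F \<gamma>. cstar_tring F \<gamma> \<Longrightarrow> \<gamma> (app f F \<gamma>) \<le> K"
    using Rep_csec[of f] by (auto simp: is_sec_def)
  then have b: "bdd_above (insert 0 {\<gamma> (app f F \<gamma>) | F \<gamma>. cstar_tring F \<gamma>})"
    by (auto intro!: bdd_aboveI)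
  show "0 \<le> sec_norm f" unfolding sec_norm_def by (rule cSup_upper[OF _ b]) simp
  show "cstar_tring F \<gamma> \<Longrightarrow> \<gamma> (app f F \<gamma>) \<le> sec_norm f"
    unfolding sec_norm_def by (rule cSup_upper[OF _ b]) auto
qed

lemma sec_norm_le: "0 \<le> K \<Longrightarrow> (\<And>F \<gamma>. cstar_tring F \<gamma> \<Longrightarrow> \<gamma> (app f F \<gamma>) \<le> K) \<Longrightarrow> sec_norm f \<le> K"
  unfolding sec_norm_def by (rule cSup_least) auto

instantiation csec :: (type) real_vector
begin

definition "0 = mk_sec (\<lambda>F \<gamma>. \<zero>\<^bsub>F\<^esub>)"
definition "f + g = mk_sec (\<lambda>F \<gamma>. app f F \<gamma> \<oplus>\<^bsub>F\<^esub> app g F \<gamma>)"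
definition "f - g = mk_sec (\<lambda>F \<gamma>. app f F \<gamma> \<ominus>\<^bsub>F\<^esub> app g F \<gamma>)"
definition "- f = mk_sec (\<lambda>F \<gamma>. \<ominus>\<^bsub>F\<^esub> app f F \<gamma>)"
definition "r *\<^sub>R f = mk_sec (\<lambda>F \<gamma>. complex_of_real r \<odot>\<^bsub>F\<^esub> app f F \<gamma>)"

lemma app_zero: "cstar_tring F \<gamma> \<Longrightarrow> app 0 F \<gamma> = \<zero>\<^bsub>F\<^esub>"
  unfolding zero_csec_def by (rule app_mk[where K = 0]) (rule cstar_tring.zero_sec)

lemma app_plus: "cstar_tring F \<gamma> \<Longrightarrow> app (f + g) F \<gamma> = app f F \<gamma> \<oplus>\<^bsub>F\<^esub> app g F \<gamma>"
  unfolding plus_csec_def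
proof (rule app_mk[where K = "sec_norm f + sec_norm g"])
  fix F :: "'a tring" and \<gamma> assume h: "cstar_tring F \<gamma>"
  interpret cstar_tring F \<gamma> by (rule h)
  show "app f F \<gamma> \<oplus>\<^bsub>F\<^esub> app g F \<gamma> \<in> carrier F \<and> \<gamma> (app f F \<gamma> \<oplus>\<^bsub>F\<^esub> app g F \<gamma>) \<le> sec_norm f + sec_norm g"
    using p_add[OF app_closed[OF h] app_closed[OF h], of f g] sec_norm_ge[OF h, of f] sec_norm_ge[OF h, of g]
    by (auto simp: app_closed[OF h])
qed

lemma app_scaleR: "cstar_tring F \<gamma> \<Longrightarrow> app (r *\<^sub>R f) F \<gamma> = complex_of_real r \<odot>\<^bsub>F\<^esub> app f F \<gamma>"
  unfolding scaleR_csec_def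
proof (rule app_mk[where K = "\<bar>r\<bar> * sec_norm f"])
  fix F :: "'a tring" and \<gamma> assume h: "cstar_tring F \<gamma>"
  interpret cstar_tring F \<gamma> by (rule h)
  show "complex_of_real r \<odot>\<^bsub>F\<^esub> app f F \<gamma> \<in> carrier F \<and> \<gamma> (complex_of_real r \<odot>\<^bsub>F\<^esub> app f F \<gamma>) \<le> \<bar>r\<bar> * sec_norm f"
    by (simp add: p_smult app_closed[OF h] sec_norm_ge[OF h] mult_left_mono)
qed

lemma app_uminus: "cstar_tring F \<gamma> \<Longrightarrow> app (- f) F \<gamma> = \<ominus>\<^bsub>F\<^esub> app f F \<gamma>"
  unfolding uminus_csec_def
proof (rule app_mk[where K = "sec_norm f"])
  fix F :: "'a tring" and \<gamma> assume h: "cstar_tring F \<gamma>"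
  interpret cstar_tring F \<gamma> by (rule h)
  show "\<ominus>\<^bsub>F\<^esub> app f F \<gamma> \<in> carrier F \<and> \<gamma> (\<ominus>\<^bsub>F\<^esub> app f F \<gamma>) \<le> sec_norm f"
    by (simp add: p_minus app_closed[OF h] sec_norm_ge[OF h])
qed

lemma app_minus: "cstar_tring F \<gamma> \<Longrightarrow> app (f - g) F \<gamma> = app f F \<gamma> \<ominus>\<^bsub>F\<^esub> app g F \<gamma>"
  unfolding minus_csec_def
proof (rule app_mk[where K = "sec_norm f + sec_norm g"])
  fix F :: "'a tring" and \<gamma> assume h: "cstar_tring F \<gamma>"
  interpret cstar_tring F \<gamma> by (rule h)
  show "app f F \<gamma> \<ominus>\<^bsub>F\<^esub> app g F \<gamma> \<in> carrier F \<and> \<gamma> (app f F \<gamma> \<ominus>\<^bsub>F\<^esub> app g F \<gamma>) \<le> sec_norm f + sec_norm g"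
    using p_diff_le[OF app_closed[OF h] app_closed[OF h], of f g] sec_norm_ge[OF h, of f] sec_norm_ge[OF h, of g]
    by (auto simp: app_closed[OF h])
qed

lemmas app_simps = app_zero app_plus app_scaleR app_uminus app_minus app_closed

instance
proof
  fix f g h :: "'a csec" and r s :: real
  show "f + g + h = f + (g + h)" "f + g = g + f" "0 + f = f" "- f + f = 0" "f - g = f + - g"
    "r *\<^sub>R (f + g) = r *\<^sub>R f + r *\<^sub>R g" "(r + s) *\<^sub>R f = r *\<^sub>R f + s *\<^sub>R f"
    "r *\<^sub>R s *\<^sub>R f = (r * s) *\<^sub>R f" "1 *\<^sub>R f = f"
  proof (safe intro!: csec_eqI)
    fix F :: "'a tring" and \<gamma> assume c: "cstar_tring F \<gamma>"
    interpret cstar_tring F \<gamma> by (rule c)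
    show "app (f + g + h) F \<gamma> = app (f + (g + h)) F \<gamma>" "app (f + g) F \<gamma> = app (g + f) F \<gamma>"
      "app (0 + f) F \<gamma> = app f F \<gamma>" "app (- f + f) F \<gamma> = app 0 F \<gamma>"
      "app (f - g) F \<gamma> = app (f + - g) F \<gamma>"
      "app (r *\<^sub>R (f + g)) F \<gamma> = app (r *\<^sub>R f + r *\<^sub>R g) F \<gamma>"
      "app ((r + s) *\<^sub>R f) F \<gamma> = app (r *\<^sub>R f + s *\<^sub>R f) F \<gamma>"
      "app (r *\<^sub>R s *\<^sub>R f) F \<gamma> = app ((r * s) *\<^sub>R f) F \<gamma>" "app (1 *\<^sub>R f) F \<gamma> = app f F \<gamma>"
      by (simp_all add: app_simps[OF c] a_ac l_neg r_neg a_minus_def smult_add smult_plus smult_smult)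
  qed
qed

end

instantiation csec :: (type) real_normed_vector
begin

definition "norm f = sec_norm f" for f :: "'a csec"
definition "dist f g = norm (f - g)" for f :: "'a csec"
definition "sgn f = f /\<^sub>R norm f" for f :: "'a csec"
definition "uniformity = (INF e\<in>{0 <..}. principal {(x, y :: 'a csec). dist x y < e})"
definition "open U = (\<forall>x\<in>U. \<forall>\<^sub>F (x', y) in uniformity. x' = x \<longrightarrow> y \<in> U)"
  for U :: "'a csec set"

instance
proof
  fix f g :: "'a csec" and r :: real
  show "norm f = 0 \<longleftrightarrow> f = 0"
  proof
    assume n: "norm f = 0"
    show "f = 0"
    proof (rule csec_eqI)
      fix F :: "'a tring" and \<gamma> assume c: "cstar_tring F \<gamma>"
      interpret cstar_tring F \<gamma> by (rule c)
      have "\<gamma> (app f F \<gamma>) \<le> 0" using sec_norm_ge[OF c, of f] n by (simp add: norm_csec_def)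
      then have "\<gamma> (app f F \<gamma>) = 0" using p_nonneg[OF app_closed[OF c], of f] by linarith
      then show "app f F \<gamma> = app 0 F \<gamma>" by (simp add: app_simps[OF c] g_eq_0)
    qed
  next
    assume "f = 0"
    then have "norm f \<le> 0" unfolding norm_csec_def
      by (auto intro!: sec_norm_le simp: app_zero cstar_tring.zero_sec)
    then show "norm f = 0" using sec_norm_nonneg[of f] by (simp add: norm_csec_def)
  qed
  show "norm (f + g) \<le> norm f + norm g" unfolding norm_csec_def
  proof (rule sec_norm_le)
    fix F :: "'a tring" and \<gamma> assume c: "cstar_tring F \<gamma>"
    interpret cstar_tring F \<gamma> by (rule c)
    show "\<gamma> (app (f + g) F \<gamma>) \<le> sec_norm f + sec_norm g"
      using p_add[OF app_closed[OF c] app_closed[OF c], of f g] sec_norm_ge[OF c, of f] sec_norm_ge[OF c, of g]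
      by (simp add: app_simps[OF c])
  qed (simp add: sec_norm_nonneg)
  have le: "norm (s *\<^sub>R f) \<le> \<bar>s\<bar> * norm f" for s and f :: "'a csec" unfolding norm_csec_def
  proof (rule sec_norm_le)
    fix F :: "'a tring" and \<gamma> assume c: "cstar_tring F \<gamma>"
    interpret cstar_tring F \<gamma> by (rule c)
    show "\<gamma> (app (s *\<^sub>R f) F \<gamma>) \<le> \<bar>s\<bar> * sec_norm f"
      by (simp add: app_simps[OF c] p_smult sec_norm_ge[OF c] mult_left_mono)
  qed (simp add: sec_norm_nonneg)
  show "norm (r *\<^sub>R f) = \<bar>r\<bar> * norm f"
  proof (rule antisym[OF le])
    show "\<bar>r\<bar> * norm f \<le> norm (r *\<^sub>R f)"
    proof (cases "r = 0")
      case False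
      then show ?thesis using le[of "inverse r" "r *\<^sub>R f"] by (simp add: field_simps)
    qed (simp add: norm_csec_def sec_norm_nonneg)
  qed
qed (simp_all add: dist_csec_def sgn_csec_def uniformity_csec_def open_csec_def)

end

lemma norm_app_le: "cstar_tring F \<gamma> \<Longrightarrow> \<gamma> (app f F \<gamma>) \<le> norm f"
  by (simp add: norm_csec_def sec_norm_ge)

text \<open>The limit is formed in each component; convergence is uniform over the components
  because the Cauchy estimate is.\<close>

lemma csec_complete:
  fixes X :: "nat \<Rightarrow> 'a csec"
  assumes X: "Cauchy X" shows "convergent X"
proof -
  have cX: "cauchy_in F \<gamma> (\<lambda>n. app (X n) F \<gamma>)" if c: "cstar_tring F \<gamma>" for F \<gamma>
    unfolding cauchy_in_def
  proof (intro conjI allI impI)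
    fix e :: real assume "e > 0"
    then obtain N where N: "\<And>m n. m \<ge> N \<Longrightarrow> n \<ge> N \<Longrightarrow> norm (X m - X n) < e"
      using X CauchyD by metis
    show "\<exists>N. \<forall>m\<ge>N. \<forall>n\<ge>N. \<gamma> (app (X m) F \<gamma> \<ominus>\<^bsub>F\<^esub> app (X n) F \<gamma>) < e"
      using N norm_app_le[OF c] unfolding app_minus[OF c, symmetric]
      by (meson order_le_less_trans)
  qed (rule app_closed[OF c])
  define L where "L F \<gamma> = (SOME x. seminormed.lim_to F \<gamma> (\<lambda>n. app (X n) F \<gamma>) x)" for F \<gamma>
  have L: "seminormed.lim_to F \<gamma> (\<lambda>n. app (X n) F \<gamma>) (L F \<gamma>)" if c: "cstar_tring F \<gamma>" for F \<gamma>
    unfolding L_def by (rule someI_ex) (rule cstar_tring.ex_lim[OF c cX[OF c]])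
  obtain K where K: "\<And>n. norm (X n) \<le> K"
    using Cauchy_Bseq[OF X] by (auto simp: Bseq_def)
  have Lc: "L F \<gamma> \<in> carrier F \<and> \<gamma> (L F \<gamma>) \<le> K" if c: "cstar_tring F \<gamma>" for F \<gamma>
  proof -
    interpret cstar_tring F \<gamma> by (rule c)
    show ?thesis
      using lim_to_closed(2)[OF L[OF c]]
      by (auto intro: LIMSEQ_le_const2[OF lim_to_norm[OF L[OF c]]] order_trans[OF norm_app_le[OF c] K])
  qed
  have "X \<longlonglongrightarrow> mk_sec L"
  proof (rule LIMSEQ_I)
    fix e :: real assume "e > 0"
    then have "e / 2 > 0" by simp
    then obtain N where N: "\<And>m n. m \<ge> N \<Longrightarrow> n \<ge> N \<Longrightarrow> norm (X m - X n) < e / 2"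
      using X CauchyD by metis
    have "norm (X n - mk_sec L) < e" if n: "n \<ge> N" for n
    proof -
      have "norm (X n - mk_sec L) \<le> e / 2" unfolding norm_csec_def
      proof (rule sec_norm_le)
        fix F :: "'a tring" and \<gamma> assume c: "cstar_tring F \<gamma>"
        interpret cstar_tring F \<gamma> by (rule c)
        note cl = app_closed[OF c] conjunct1[OF Lc[OF c]]
        \<comment> \<open>Letting \<open>m\<close> tend to infinity within one component turns the
          Cauchy bound into a bound that no longer depends on the component.\<close>
        have "(\<lambda>m. e / 2 + \<gamma> (app (X m) F \<gamma> \<ominus>\<^bsub>F\<^esub> L F \<gamma>)) \<longlonglongrightarrow> e / 2 + 0"
          using L[OF c] by (intro tendsto_intros) (simp add: lim_to_def)
        moreover have "\<gamma> (app (X n) F \<gamma> \<ominus>\<^bsub>F\<^esub> L F \<gamma>) \<le> e / 2 + \<gamma> (app (X m) F \<gamma> \<ominus>\<^bsub>F\<^esub> L F \<gamma>)" if "m \<ge> N" for m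
        proof -
          have "\<gamma> (app (X n) F \<gamma> \<ominus>\<^bsub>F\<^esub> app (X m) F \<gamma>) \<le> e / 2"
            using order_trans[OF norm_app_le[OF c] less_imp_le[OF N[OF n that]]]
            by (simp add: app_minus[OF c])
          then show ?thesis using p_triangle[of "app (X n) F \<gamma>" "app (X m) F \<gamma>" "L F \<gamma>"] cl by simp
        qed
        ultimately have "\<gamma> (app (X n) F \<gamma> \<ominus>\<^bsub>F\<^esub> L F \<gamma>) \<le> e / 2 + 0"
          by (intro LIMSEQ_le_const) auto
        then show "\<gamma> (app (X n - mk_sec L) F \<gamma>) \<le> e / 2"
          by (simp add: app_minus[OF c] app_mk[OF Lc c])
      qed (use \<open>e > 0\<close> in simp)
      then show ?thesis using \<open>e > 0\<close> by simp
    qed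
    then show "\<exists>no. \<forall>n\<ge>no. norm (X n - mk_sec L) < e" by blast
  qed
  then show ?thesis by (rule convergentI)
qed

instantiation csec :: (type) cstar_triple
begin

definition "tp f g h = mk_sec (\<lambda>F \<gamma>. tprod F (app f F \<gamma>) (app g F \<gamma>) (app h F \<gamma>))"
definition "im f = mk_sec (\<lambda>F \<gamma>. \<i> \<odot>\<^bsub>F\<^esub> app f F \<gamma>)"

lemma app_tp_le:
  assumes c: "cstar_tring F \<gamma>"
  shows "tprod F (app f F \<gamma>) (app g F \<gamma>) (app h F \<gamma>) \<in> carrier F \<and>
    \<gamma> (tprod F (app f F \<gamma>) (app g F \<gamma>) (app h F \<gamma>)) \<le> norm f * norm g * norm h"
proof -
  interpret cstar_tring F \<gamma> by (rule c)
  have "\<gamma> (app f F \<gamma>) * \<gamma> (app g F \<gamma>) * \<gamma> (app h F \<gamma>) \<le> norm f * norm g * norm h"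
    by (intro mult_mono norm_app_le[OF c] mult_nonneg_nonneg p_nonneg app_closed[OF c] norm_ge_zero)
  with g_tprod[OF app_closed[OF c] app_closed[OF c] app_closed[OF c], of f g h]
  show ?thesis by (simp add: tprod_closed app_closed[OF c])
qed

lemma app_tp:
  "cstar_tring F \<gamma> \<Longrightarrow> app (tp f g h) F \<gamma> = tprod F (app f F \<gamma>) (app g F \<gamma>) (app h F \<gamma>)"
  unfolding tp_csec_def by (rule app_mk[OF app_tp_le])

lemma app_im: "cstar_tring F \<gamma> \<Longrightarrow> app (im f) F \<gamma> = \<i> \<odot>\<^bsub>F\<^esub> app f F \<gamma>"
  unfolding im_csec_def
proof (rule app_mk[where K = "sec_norm f"])
  fix F :: "'a tring" and \<gamma> assume h: "cstar_tring F \<gamma>"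
  interpret cstar_tring F \<gamma> by (rule h)
  show "\<i> \<odot>\<^bsub>F\<^esub> app f F \<gamma> \<in> carrier F \<and> \<gamma> (\<i> \<odot>\<^bsub>F\<^esub> app f F \<gamma>) \<le> sec_norm f"
    by (simp add: p_smult app_closed[OF h] sec_norm_ge[OF h])
qed

instance
proof
  fix X :: "nat \<Rightarrow> 'a csec" assume "Cauchy X" then show "convergent X" by (rule csec_complete)
next
  fix x x' y y' z z' u v :: "'a csec" and r :: real
  show "tp (x + x') y z = tp x y z + tp x' y z" "tp x (y + y') z = tp x y z + tp x y' z"
    "tp x y (z + z') = tp x y z + tp x y z'" "tp (r *\<^sub>R x) y z = r *\<^sub>R tp x y z"
    "tp x (r *\<^sub>R y) z = r *\<^sub>R tp x y z" "tp x y (r *\<^sub>R z) = r *\<^sub>R tp x y z"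
    "im (x + y) = im x + im y" "im (r *\<^sub>R x) = r *\<^sub>R im x" "im (im x) = - x"
    "tp (im x) y z = im (tp x y z)" "tp x (im y) z = - im (tp x y z)" "tp x y (im z) = im (tp x y z)"
    "tp (tp x y z) u v = tp x (tp u z y) v" "tp (tp x y z) u v = tp x y (tp z u v)"
  proof (safe intro!: csec_eqI)
    fix F :: "'a tring" and \<gamma> assume c: "cstar_tring F \<gamma>"
    interpret cstar_tring F \<gamma> by (rule c)
    note [simp] = app_simps[OF c] app_tp[OF c] app_im[OF c] tprod_closed
    show "app (tp (x + x') y z) F \<gamma> = app (tp x y z + tp x' y z) F \<gamma>" by (simp add: tprod_add1)
    show "app (tp x (y + y') z) F \<gamma> = app (tp x y z + tp x y' z) F \<gamma>" by (simp add: tprod_add2)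
    show "app (tp x y (z + z')) F \<gamma> = app (tp x y z + tp x y z') F \<gamma>" by (simp add: tprod_add3)
    show "app (tp (r *\<^sub>R x) y z) F \<gamma> = app (r *\<^sub>R tp x y z) F \<gamma>" by (simp add: tprod_smult1)
    show "app (tp x (r *\<^sub>R y) z) F \<gamma> = app (r *\<^sub>R tp x y z) F \<gamma>" by (simp add: tprod_smult2)
    show "app (tp x y (r *\<^sub>R z)) F \<gamma> = app (r *\<^sub>R tp x y z) F \<gamma>" by (simp add: tprod_smult3)
    show "app (im (x + y)) F \<gamma> = app (im x + im y) F \<gamma>" by (simp add: smult_add)
    show "app (im (r *\<^sub>R x)) F \<gamma> = app (r *\<^sub>R im x) F \<gamma>" by (simp add: smult_smult mult.commute)
    show "app (im (im x)) F \<gamma> = app (- x) F \<gamma>" by (simp add: smult_smult smult_minus1)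
    show "app (tp (im x) y z) F \<gamma> = app (im (tp x y z)) F \<gamma>" by (simp add: tprod_smult1)
    show "app (tp x (im y) z) F \<gamma> = app (- im (tp x y z)) F \<gamma>"
      by (simp add: tprod_smult2 smult_smult flip: smult_minus1)
    show "app (tp x y (im z)) F \<gamma> = app (im (tp x y z)) F \<gamma>" by (simp add: tprod_smult3)
    show "app (tp (tp x y z) u v) F \<gamma> = app (tp x (tp u z y) v) F \<gamma>" by (simp add: tprod_assoc12)
    show "app (tp (tp x y z) u v) F \<gamma> = app (tp x y (tp z u v)) F \<gamma>" by (simp add: tprod_assoc13)
  qed
  have norm_le: "norm f \<le> norm g"
    if "\<And>F \<gamma>. cstar_tring F \<gamma> \<Longrightarrow> \<gamma> (app f F \<gamma>) \<le> \<gamma> (app g F \<gamma>)" for f g :: "'a csec"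
    unfolding norm_csec_def
    by (rule sec_norm_le[OF sec_norm_nonneg]) (rule order_trans[OF that sec_norm_ge])
  show "norm (im x) = norm x"
  proof (rule antisym; rule norm_le)
    fix F :: "'a tring" and \<gamma> assume c: "cstar_tring F \<gamma>"
    interpret cstar_tring F \<gamma> by (rule c)
    show "\<gamma> (app (im x) F \<gamma>) \<le> \<gamma> (app x F \<gamma>)" "\<gamma> (app x F \<gamma>) \<le> \<gamma> (app (im x) F \<gamma>)"
      by (simp_all add: app_im[OF c] p_smult app_closed[OF c])
  qed
  show le: "norm (tp x y z) \<le> norm x * norm y * norm z" for x y z :: "'a csec"
    unfolding norm_csec_def[of "tp x y z"]
    by (rule sec_norm_le) (simp_all add: app_tp app_tp_le)
  show "norm (tp x x x) = norm x ^ 3"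
  proof (rule antisym)
    show "norm (tp x x x) \<le> norm x ^ 3" using le[of x x x] by (simp add: power3_eq_cube)
    \<comment> \<open>The cube identity holds in each component; after a cube root it bounds every
      component, hence the supremum.\<close>
    have "norm x \<le> root 3 (norm (tp x x x))" unfolding norm_csec_def[of x]
    proof (rule sec_norm_le)
      fix F :: "'a tring" and \<gamma> assume c: "cstar_tring F \<gamma>"
      interpret cstar_tring F \<gamma> by (rule c)
      have "\<gamma> (app x F \<gamma>) ^ 3 \<le> norm (tp x x x)"
        using norm_app_le[OF c, of "tp x x x"] by (simp add: app_tp[OF c] g_cube app_closed[OF c])
      then have "root 3 (\<gamma> (app x F \<gamma>) ^ 3) \<le> root 3 (norm (tp x x x))" by simp
      then show "\<gamma> (app x F \<gamma>) \<le> root 3 (norm (tp x x x))" by (simp add: odd_real_root_power_cancel)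
    qed simp
    then have "norm x ^ 3 \<le> root 3 (norm (tp x x x)) ^ 3" by (intro power_mono) auto
    then show "norm x ^ 3 \<le> norm (tp x x x)" by (simp add: odd_real_root_pow)
  qed
qed

end

section \<open>Transfer between a C*-tring and the product\<close>

context cstar_tring
begin

text \<open>The inclusion of the summand \<open>F\<close>; all other components are zero.\<close>

definition emb :: "'a \<Rightarrow> 'a csec"
  where "emb x = mk_sec (\<lambda>G \<delta>. if G = F \<and> \<delta> = \<gamma> then x else \<zero>\<^bsub>G\<^esub>)"

lemma app_emb:
  assumes x: "x \<in> carrier F" and c: "cstar_tring G \<delta>"
  shows "app (emb x) G \<delta> = (if G = F \<and> \<delta> = \<gamma> then x else \<zero>\<^bsub>G\<^esub>)"
  unfolding emb_def
proof (rule app_mk[where K = "\<gamma> x", OF _ c])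
  fix G :: "'a tring" and \<delta> assume "cstar_tring G \<delta>"
  then have "\<zero>\<^bsub>G\<^esub> \<in> carrier G \<and> \<delta> \<zero>\<^bsub>G\<^esub> \<le> 0" by (rule cstar_tring.zero_sec)
  then show "(if G = F \<and> \<delta> = \<gamma> then x else \<zero>\<^bsub>G\<^esub>) \<in> carrier G \<and>
      \<delta> (if G = F \<and> \<delta> = \<gamma> then x else \<zero>\<^bsub>G\<^esub>) \<le> \<gamma> x"
    using x p_nonneg[OF x] by (auto intro: order_trans)
qed

lemma app_emb_self [simp]: "x \<in> carrier F \<Longrightarrow> app (emb x) F \<gamma> = x"
  using app_emb[OF _ cstar_tring_axioms] by simp

lemmas app_here = app_simps[OF cstar_tring_axioms] app_tp[OF cstar_tring_axioms]

text \<open>The identities of \<open>zsgn\<close> are tested on embedded elements and read off in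
  the component of \<open>F\<close>.\<close>

lemma zs_app: "zsgn e U P \<Longrightarrow> zs (complex_of_real e) (app U F \<gamma>) (app P F \<gamma>)"
  unfolding zs_def
proof (intro conjI ballI)
  fix z assume z: "z \<in> carrier F" and h: "zsgn e U P"
  have "app (tp U U (emb z)) F \<gamma> = app (e *\<^sub>R tp P P (tp P P (emb z))) F \<gamma>"
    "app (tp (emb z) U U) F \<gamma> = app (e *\<^sub>R tp (tp (emb z) P P) P P) F \<gamma>"
    using h by (simp_all add: zsgn_def)
  then show "tprod F (app U F \<gamma>) (app U F \<gamma>) z =
      complex_of_real e \<odot> tprod F (app P F \<gamma>) (app P F \<gamma>) (tprod F (app P F \<gamma>) (app P F \<gamma>) z)"
    "tprod F z (app U F \<gamma>) (app U F \<gamma>) =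
      complex_of_real e \<odot> tprod F (tprod F z (app P F \<gamma>) (app P F \<gamma>)) (app P F \<gamma>) (app P F \<gamma>)"
    using z by (simp_all add: app_here)
qed (simp_all add: app_here)

text \<open>In every component other than that of \<open>F\<close> both sides vanish.\<close>

lemma zsgn_emb:
  assumes "zs (complex_of_real e) u p"
  shows "zsgn e (emb u) (emb p)"
  unfolding zsgn_def
proof (intro allI conjI)
  have up: "u \<in> carrier F" "p \<in> carrier F" using assms by (simp_all add: zs_def)
  fix z
  show "tp (emb u) (emb u) z = e *\<^sub>R tp (emb p) (emb p) (tp (emb p) (emb p) z)"
    "tp z (emb u) (emb u) = e *\<^sub>R tp (tp z (emb p) (emb p)) (emb p) (emb p)"
  proof (safe intro!: csec_eqI)
    fix G :: "'a tring" and \<delta> assume c: "cstar_tring G \<delta>"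
    interpret G: cstar_tring G \<delta> by (rule c)
    show "app (tp (emb u) (emb u) z) G \<delta> = app (e *\<^sub>R tp (emb p) (emb p) (tp (emb p) (emb p) z)) G \<delta>"
      "app (tp z (emb u) (emb u)) G \<delta> = app (e *\<^sub>R tp (tp z (emb p) (emb p)) (emb p) (emb p)) G \<delta>"
      using assms by (auto simp: app_tp[OF c] app_simps[OF c] app_emb[OF up(1) c] app_emb[OF up(2) c] zs_def app_closed[OF cstar_tring_axioms])
  qed
qed

lemma zs_split:
  assumes "x \<in> carrier F"
  shows "\<exists>u v p q. x = u \<oplus> v \<and> zs 1 u p \<and> zs (- 1) v q"
proof -
  obtain u v p q where s: "emb x = u + v" "zsgn 1 u p" "zsgn (- 1) v q"
    using zettl_split by blast
  have "x = app u F \<gamma> \<oplus> app v F \<gamma>"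
    using arg_cong[OF s(1), of "\<lambda>f. app f F \<gamma>"] assms by (simp add: app_here)
  with zs_app[OF s(2)] zs_app[OF s(3)] show ?thesis by auto
qed

text \<open>For operators on the right, \<open>adj (ipr x y) = ipr y x\<close> acts first in
  \<open>adj c * c\<close> with \<open>c = ipr x y\<close>; the hypothesis is therefore that of
  \<open>zsgn_of_adj_mult\<close>.\<close>

lemma zs_of_square:
  assumes c: "w \<in> carrier F" "x \<in> carrier F" "y \<in> carrier F"
    and eq: "\<And>z. z \<in> carrier F \<Longrightarrow> tprod F z w w = tprod F (tprod F z y x) x y"
  shows "\<exists>p. zs 1 w p"
proof -
  have "ipr (emb w) (emb w) = adj (ipr (emb x) (emb y)) * ipr (emb x) (emb y)"
  proof (rule mult_alg_eqI)
    fix z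
    have "tp z (emb w) (emb w) = tp (tp z (emb y) (emb x)) (emb x) (emb y)"
    proof (rule csec_eqI)
      fix G :: "'a tring" and \<delta> assume g: "cstar_tring G \<delta>"
      interpret G: cstar_tring G \<delta> by (rule g)
      show "app (tp z (emb w) (emb w)) G \<delta> = app (tp (tp z (emb y) (emb x)) (emb x) (emb y)) G \<delta>"
        using eq by (auto simp: app_tp[OF g] app_simps[OF g] app_emb[OF _ g] c app_closed[OF cstar_tring_axioms])
    qed
    then show "z \<lhd>\<^sub>m ipr (emb w) (emb w) = z \<lhd>\<^sub>m (adj (ipr (emb x) (emb y)) * ipr (emb x) (emb y))"
      by (simp add: ract_times adj_ipr ract_ipr)
  qed
  then obtain P where "zsgn 1 (emb w) P" using zsgn_of_adj_mult by blast
  from zs_app[OF this] show ?thesis using c by auto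
qed

lemma zs_both: "zs 1 w p \<Longrightarrow> zs (- 1) w q \<Longrightarrow> w = \<zero>"
proof -
  assume h: "zs 1 w p" "zs (- 1) w q"
  then have "zsgn 1 (emb w) (emb p)" "zsgn (- 1) (emb w) (emb q)" by (simp_all add: zsgn_emb)
  then have "emb w = 0" by (rule zsgn_both)
  moreover have "w \<in> carrier F" using h by (simp add: zs_def)
  ultimately show "w = \<zero>" using app_emb_self app_here(1) by metis
qed

end

section \<open>Orthogonality of the positive and the negative elements\<close>

text \<open>Subtraction is no field of the record but derived from these three. The fact is needed
  whenever a structure is replaced by another one with the same linear part.\<close>

lemma a_minus_cong:
  assumes "carrier W = carrier V" "ring.zero W = ring.zero V" "ring.add W = ring.add V"
  shows "a_minus W = a_minus V"
  using assms by (intro ext) (simp add: a_minus_def a_inv_def m_inv_def)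

section \<open>Change of record and linear spans\<close>

context complex_module
begin

lemma module_cong:
  assumes [simp]: "carrier W = carrier V" "ring.zero W = \<zero>" "ring.add W = ring.add V"
    "module.smult W = module.smult V"
  shows "module complex_field W"
proof (rule moduleI[OF cring_complex_field])
  show "abelian_group W"
    by (rule abelian_groupI) (auto simp: a_ac intro!: bexI[of _ "\<ominus> x" for x] l_neg)
qed (auto simp: smult_plus smult_add smult_smult)

lemma lin_span_submodule: "S \<subseteq> carrier V \<Longrightarrow> submodule (lin_span V S) complex_field V"
proof (rule submoduleI)
  let ?W = "{W. submodule W complex_field V \<and> S \<subseteq> W}"
  assume S: "S \<subseteq> carrier V"
  have c: "submodule (carrier V) complex_field V" by (rule submoduleI) auto
  then show "lin_span V S \<subseteq> carrier V" using S unfolding lin_span_def by auto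
  have W: "\<zero> \<in> W \<and> (\<forall>a\<in>W. \<ominus> a \<in> W) \<and> (\<forall>a\<in>W. \<forall>b\<in>W. a \<oplus> b \<in> W) \<and> (\<forall>c. \<forall>a\<in>W. c \<odot> a \<in> W)"
    if "submodule W complex_field V" for W
    using subgroup.one_closed[OF submodule.axioms(1)[OF that]] subgroup.m_inv_closed[OF submodule.axioms(1)[OF that]]
      subgroup.m_closed[OF submodule.axioms(1)[OF that]] submodule.smult_closed[OF that]
    by (simp add: a_inv_def)
  show "\<zero> \<in> lin_span V S" using W unfolding lin_span_def by simp
  show "\<ominus> a \<in> lin_span V S" if "a \<in> lin_span V S" for a
    using W that unfolding lin_span_def by simp
  show "a \<oplus> b \<in> lin_span V S" if "a \<in> lin_span V S" "b \<in> lin_span V S" for a b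
    using W that unfolding lin_span_def by simp
  show "c \<odot> a \<in> lin_span V S" if "a \<in> lin_span V S" for c a
    using W that unfolding lin_span_def by simp
qed

lemma lin_span_base: "S \<subseteq> lin_span V S"
  unfolding lin_span_def by auto

lemma submodule_CollectI:
  assumes "P \<zero>" "\<And>a b. a \<in> carrier V \<Longrightarrow> b \<in> carrier V \<Longrightarrow> P a \<Longrightarrow> P b \<Longrightarrow> P (a \<oplus> b)"
    "\<And>c a. a \<in> carrier V \<Longrightarrow> P a \<Longrightarrow> P (c \<odot> a)"
  shows "submodule {a \<in> carrier V. P a} complex_field V"
  by (rule submoduleI) (use assms in \<open>auto simp flip: smult_minus1\<close>)

lemma lin_span_induct:
  assumes "a \<in> lin_span V S" "S \<subseteq> carrier V" "\<And>s. s \<in> S \<Longrightarrow> P s"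
    "P \<zero>" "\<And>a b. a \<in> carrier V \<Longrightarrow> b \<in> carrier V \<Longrightarrow> P a \<Longrightarrow> P b \<Longrightarrow> P (a \<oplus> b)"
    "\<And>c a. a \<in> carrier V \<Longrightarrow> P a \<Longrightarrow> P (c \<odot> a)"
  shows "P a"
proof -
  have "lin_span V S \<subseteq> {a \<in> carrier V. P a}"
    unfolding lin_span_def using submodule_CollectI[of P] assms by auto
  then show ?thesis using assms(1) by blast
qed

end

section \<open>Opposite and negated opposite rings\<close>

definition opp_tring :: "'a tring \<Rightarrow> 'a tring"
  where "opp_tring F = F\<lparr>tprod := \<lambda>x y z. tprod F z y x\<rparr>"

text \<open>Exchanges the two inner products and at the same time the two signs, so a statement on
  positivity on the right becomes one on negativity on the left.\<close>

definition neg_opp_tring :: "'a tring \<Rightarrow> 'a tring"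
  where "neg_opp_tring F = F\<lparr>tprod := \<lambda>x y z. a_inv F (tprod F z y x)\<rparr>"

lemma opp_simps [simp]:
  "carrier (opp_tring F) = carrier F" "ring.zero (opp_tring F) = ring.zero F"
  "ring.add (opp_tring F) = ring.add F" "module.smult (opp_tring F) = module.smult F"
  "tprod (opp_tring F) = (\<lambda>x y z. tprod F z y x)" "a_minus (opp_tring F) = a_minus F"
  by (simp_all add: opp_tring_def) (intro a_minus_cong; simp)

lemma neg_opp_simps [simp]:
  "carrier (neg_opp_tring F) = carrier F" "ring.zero (neg_opp_tring F) = ring.zero F"
  "ring.add (neg_opp_tring F) = ring.add F" "module.smult (neg_opp_tring F) = module.smult F"
  "tprod (neg_opp_tring F) = (\<lambda>x y z. a_inv F (tprod F z y x))" "a_minus (neg_opp_tring F) = a_minus F"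
  by (simp_all add: neg_opp_tring_def) (intro a_minus_cong; simp)

lemma (in star_tring) tprod_neg:
  "\<lbrakk>x \<in> carrier E; y \<in> carrier E; z \<in> carrier E\<rbrakk> \<Longrightarrow> tprod E (\<ominus> x) y z = \<ominus> tprod E x y z"
  "\<lbrakk>x \<in> carrier E; y \<in> carrier E; z \<in> carrier E\<rbrakk> \<Longrightarrow> tprod E x (\<ominus> y) z = \<ominus> tprod E x y z"
  "\<lbrakk>x \<in> carrier E; y \<in> carrier E; z \<in> carrier E\<rbrakk> \<Longrightarrow> tprod E x y (\<ominus> z) = \<ominus> tprod E x y z"
  by (simp_all add: smult_minus1[symmetric] tprod_smult1 tprod_smult2 tprod_smult3 tprod_closed)

context cstar_tring
begin

lemma tprod_assoc: "\<lbrakk>x \<in> carrier F; y \<in> carrier F; z \<in> carrier F; u \<in> carrier F; v \<in> carrier F\<rbrakk> \<Longrightarrow>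
    tprod F x (tprod F u z y) v = tprod F x y (tprod F z u v)"
  using tprod_assoc12 tprod_assoc13 by simp

lemma opp_cstar_tring: "cstar_tring (opp_tring F) \<gamma>"
proof (intro cstar_tring.intro star_tring.intro)
  show "module complex_field (opp_tring F)" by (rule module_cong) simp_all
  show "star_tring_axioms (opp_tring F)"
    by (rule star_tring_axioms.intro) (simp_all add: tprod_closed tprod_add1 tprod_add2 tprod_add3 tprod_smult1
        tprod_smult2 tprod_smult3 tprod_assoc tprod_assoc13)
  have "\<gamma> \<in> SN (opp_tring F)" unfolding SN_def mem_Collect_eq
  proof (intro conjI ballI)
    show "seminorm_on (opp_tring F) \<gamma>" using seminorm by (simp add: seminorm_on_def)
    fix x y z assume "x \<in> carrier (opp_tring F)" "y \<in> carrier (opp_tring F)" "z \<in> carrier (opp_tring F)"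
    then show "\<gamma> (tprod (opp_tring F) x y z) \<le> \<gamma> x * \<gamma> y * \<gamma> z"
      using g_tprod[of z y x] by (simp add: mult_ac)
  qed (simp add: g_cube)
  then show "cstar_tring_axioms (opp_tring F) \<gamma>"
    using norm_F complete_F
    by unfold_locales (simp_all add: norm_on_def seminorm_on_def complete_in_def cauchy_in_def)
qed

lemma neg_opp_cstar_tring: "cstar_tring (neg_opp_tring F) \<gamma>"
proof (intro cstar_tring.intro star_tring.intro)
  show "module complex_field (neg_opp_tring F)" by (rule module_cong) simp_all
  show "star_tring_axioms (neg_opp_tring F)"
    by (rule star_tring_axioms.intro) (simp_all add: tprod_closed tprod_add1 tprod_add2 tprod_add3 tprod_smult1
        tprod_smult2 tprod_smult3 minus_add tprod_neg smult_r_minus tprod_assoc tprod_assoc13)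
  have "\<gamma> \<in> SN (neg_opp_tring F)" unfolding SN_def mem_Collect_eq
  proof (intro conjI ballI)
    show "seminorm_on (neg_opp_tring F) \<gamma>" using seminorm by (simp add: seminorm_on_def)
    fix x y z assume "x \<in> carrier (neg_opp_tring F)" "y \<in> carrier (neg_opp_tring F)" "z \<in> carrier (neg_opp_tring F)"
    then show "\<gamma> (tprod (neg_opp_tring F) x y z) \<le> \<gamma> x * \<gamma> y * \<gamma> z"
      using g_tprod[of z y x] by (simp add: mult_ac p_minus tprod_closed)
  qed (simp add: g_cube p_minus tprod_closed)
  then show "cstar_tring_axioms (neg_opp_tring F) \<gamma>"
    using norm_F complete_F
    by unfold_locales (simp_all add: norm_on_def seminorm_on_def complete_in_def cauchy_in_def)
qed

lemma zs_opp: "star_tring.zs (opp_tring F) e u p \<longleftrightarrow> zs e u p"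
proof -
  interpret O: cstar_tring "opp_tring F" \<gamma> by (rule opp_cstar_tring)
  show ?thesis unfolding O.zs_def zs_def by auto
qed

text \<open>The certificate side applies the product twice, so there the minus signs cancel; the
  side of \<open>u\<close> applies it once.\<close>

lemma zs_neg_opp: "star_tring.zs (neg_opp_tring F) e u p \<longleftrightarrow> zs (- e) u p"
proof -
  interpret O: cstar_tring "neg_opp_tring F" \<gamma> by (rule neg_opp_cstar_tring)
  have neg: "\<ominus> a = e \<odot> b \<longleftrightarrow> a = (- e) \<odot> b" if "a \<in> carrier F" "b \<in> carrier F" for a b
  proof -
    have "(- e) \<odot> b = \<ominus> (e \<odot> b)" using that smult_smult[of b "-1" e] smult_minus1[of "e \<odot> b"] by simp
    then show ?thesis using that by (metis minus_minus smult_cl)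
  qed
  show ?thesis unfolding O.zs_def zs_def
    by (auto simp: tprod_closed tprod_neg neg)
qed

section \<open>Positive and negative elements\<close>

definition "Fpos = {x. \<exists>p. zs 1 x p}"
definition "Fneg = {x. \<exists>p. zs (- 1) x p}"

lemma Fpos_closed: "x \<in> Fpos \<Longrightarrow> x \<in> carrier F" and Fneg_closed: "x \<in> Fneg \<Longrightarrow> x \<in> carrier F"
  by (auto simp: Fpos_def Fneg_def zs_def)

lemma Fpos_opp: "cstar_tring.Fpos (opp_tring F) = Fpos" and Fneg_opp: "cstar_tring.Fneg (opp_tring F) = Fneg"
proof -
  interpret O: cstar_tring "opp_tring F" \<gamma> by (rule opp_cstar_tring)
  show "O.Fpos = Fpos" "O.Fneg = Fneg"
    by (simp_all add: O.Fpos_def O.Fneg_def Fpos_def Fneg_def zs_opp)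
qed

text \<open>For \<open>x\<close> positive and \<open>y\<close> negative, \<open>w = (p, p, y)\<close> has \<open>\<langle>w, w\<rangle>\<^sub>r = c\<^sup>* c\<close> with
  \<open>c = \<langle>x, y\<rangle>\<^sub>r\<close>, whereas \<open>\<langle>w, w\<rangle>\<^sub>l = - d d\<^sup>*\<close> with \<open>d = \<langle>(p, p, q), q\<rangle>\<^sub>l\<close>; so \<open>w = 0\<close>.\<close>

lemma orth_aux:
  assumes x: "x \<in> Fpos" and y: "y \<in> Fneg" and z: "z \<in> carrier F"
  shows "tprod F z y x = \<zero>" "tprod F z x y = \<zero>"
proof -
  obtain p q where p: "zs 1 x p" and q: "zs (- 1) y q" using x y by (auto simp: Fpos_def Fneg_def)
  have c [simp]: "x \<in> carrier F" "p \<in> carrier F" "y \<in> carrier F" "q \<in> carrier F"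
    using p q by (auto simp: zs_def)
  note [simp] = tprod_closed
  define w where "w = tprod F p p y"
  have w [simp]: "w \<in> carrier F" by (simp add: w_def)
  have pz: "tprod F p p (tprod F p p a) = tprod F x x a" if "a \<in> carrier F" for a
    using p that by (simp add: zs_def)
  have qz: "tprod F y y a = \<ominus> tprod F q q (tprod F q q a)" if "a \<in> carrier F" for a
    using q that by (simp add: zs_def smult_minus1)
  have ww: "tprod F a w w = tprod F (tprod F a y x) x y" if a: "a \<in> carrier F" for a
  proof -
    have "tprod F a w w = tprod F a y (tprod F p p w)"
      unfolding w_def using a by (simp add: tprod_assoc)
    also have "tprod F p p w = tprod F x x y" by (simp add: w_def pz)
    finally show ?thesis using a by (simp add: tprod_assoc13)
  qed
  then have "w \<in> Fpos" unfolding Fpos_def using zs_of_square[of w x y] by simp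
  moreover have "w \<in> Fneg"
  proof -
    interpret O: cstar_tring "neg_opp_tring F" \<gamma> by (rule neg_opp_cstar_tring)
    let ?b = "tprod F p p q"
    have "\<exists>r. O.zs 1 w r"
    proof (rule O.zs_of_square[of w q ?b])
      fix a assume "a \<in> carrier (neg_opp_tring F)"
      then have a [simp]: "a \<in> carrier F" by simp
      \<comment> \<open>Here \<open>- (w, w, a)\<close> is rewritten as \<open>d d* a\<close> with
        \<open>d\<close> the left inner product of \<open>?b\<close> and \<open>q\<close>; in the
        negated opposite ring this is the hypothesis of \<open>zs_of_square\<close>, which makes
        \<open>w\<close> negative.\<close>
      have "tprod F w w a = tprod F p p (tprod F y w a)"
        by (subst (1) w_def) (simp add: tprod_assoc13)
      also have "tprod F y w a = tprod F y y (tprod F p p a)"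
        by (simp add: w_def tprod_assoc)
      also have "\<dots> = \<ominus> tprod F q q (tprod F q q (tprod F p p a))" by (simp add: qz)
      finally have "\<ominus> tprod F w w a = tprod F p p (tprod F q q (tprod F q q (tprod F p p a)))"
        by (simp add: tprod_neg)
      moreover have "tprod F ?b q (tprod F q ?b a) = tprod F p p (tprod F q q (tprod F q q (tprod F p p a)))"
        by (simp add: tprod_assoc13 tprod_assoc)
      ultimately show "tprod (neg_opp_tring F) a w w =
          tprod (neg_opp_tring F) (tprod (neg_opp_tring F) a ?b q) q ?b"
        by (simp add: tprod_neg)
    qed simp_all
    then show ?thesis by (simp add: Fneg_def zs_neg_opp)
  qed
  ultimately have w0: "w = \<zero>" unfolding Fpos_def Fneg_def using zs_both by blast
  have yx: "tprod F a y x = \<zero>" if a [simp]: "a \<in> carrier F" for a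
  proof (rule cube_eq_0)
    let ?v = "tprod F a y x"
    \<comment> \<open>The cube of \<open>(a, y, x)\<close> contains
      \<open>((a, y, x), x, y)\<close>, which equals \<open>(a, w, w)\<close> by \<open>ww\<close>
      and vanishes with \<open>w\<close>.\<close>
    have "tprod F ?v ?v ?v = tprod F ?v x (tprod F y a ?v)" by (simp add: tprod_assoc)
    also have "\<dots> = tprod F (tprod F ?v x y) a ?v" by (simp add: tprod_assoc13)
    also have "tprod F ?v x y = \<zero>" using ww[of a] w0 by simp
    finally show "tprod F ?v ?v ?v = \<zero>" by simp
  qed simp
  show "tprod F z y x = \<zero>" by (rule yx[OF z])
  show "tprod F z x y = \<zero>"
  proof (rule cube_eq_0)
    let ?v = "tprod F z x y"
    \<comment> \<open>The same regrouping with \<open>x\<close> and \<open>y\<close> exchanged; the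
      inner product that appears is now covered by \<open>yx\<close>.\<close>
    have "tprod F ?v ?v ?v = tprod F ?v y (tprod F x z ?v)" using z by (simp add: tprod_assoc)
    also have "\<dots> = tprod F (tprod F ?v y x) z ?v" using z by (simp add: tprod_assoc13)
    also have "tprod F ?v y x = \<zero>" using z by (simp add: yx)
    finally show "tprod F ?v ?v ?v = \<zero>" using z by simp
  qed (use z in simp)
qed

lemma orth:
  assumes "x \<in> Fpos" "y \<in> Fneg" "z \<in> carrier F"
  shows "tprod F z y x = \<zero>" "tprod F z x y = \<zero>" "tprod F y x z = \<zero>" "tprod F x y z = \<zero>"
proof -
  interpret O: cstar_tring "opp_tring F" \<gamma> by (rule opp_cstar_tring)
  show "tprod F z y x = \<zero>" "tprod F z x y = \<zero>" using orth_aux[OF assms] by simp_all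
  show "tprod F y x z = \<zero>" "tprod F x y z = \<zero>"
    using O.orth_aux[of x y z] assms by (simp_all add: Fpos_opp Fneg_opp)
qed

lemma decomp: "x \<in> carrier F \<Longrightarrow> \<exists>u\<in>Fpos. \<exists>v\<in>Fneg. x = u \<oplus> v"
  using zs_split by (fastforce simp: Fpos_def Fneg_def)

text \<open>If \<open>x\<close> is annihilated, its negative component \<open>v\<close> satisfies
  \<open>(v, v, v) = (v, v, x) = 0\<close>. As the annihilator of the other part,
  \<open>Fpos\<close> is a subspace, which its definition by certificates does not show.\<close>

lemma Fpos_iff: "x \<in> carrier F \<Longrightarrow> x \<in> Fpos \<longleftrightarrow> (\<forall>y\<in>Fneg. \<forall>z\<in>carrier F. tprod F z y x = \<zero>)"
proof (intro iffI ballI)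
  assume x: "x \<in> carrier F" and h: "\<forall>y\<in>Fneg. \<forall>z\<in>carrier F. tprod F z y x = \<zero>"
  obtain u v where u: "u \<in> Fpos" and v: "v \<in> Fneg" and e: "x = u \<oplus> v" using decomp[OF x] by blast
  note c = Fpos_closed[OF u] Fneg_closed[OF v]
  have "tprod F v v v = tprod F v v x" using orth(1)[OF u v c(2)] c by (simp add: e tprod_add3 tprod_closed)
  then have "v = \<zero>" using h v c by (auto intro: cube_eq_0)
  then show "x \<in> Fpos" using u e c by simp
qed (rule orth)

lemma Fneg_iff: "x \<in> carrier F \<Longrightarrow> x \<in> Fneg \<longleftrightarrow> (\<forall>y\<in>Fpos. \<forall>z\<in>carrier F. tprod F z y x = \<zero>)"
proof (intro iffI ballI)
  assume x: "x \<in> carrier F" and h: "\<forall>y\<in>Fpos. \<forall>z\<in>carrier F. tprod F z y x = \<zero>"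
  obtain u v where u: "u \<in> Fpos" and v: "v \<in> Fneg" and e: "x = u \<oplus> v" using decomp[OF x] by blast
  note c = Fpos_closed[OF u] Fneg_closed[OF v]
  have "tprod F u u u = tprod F u u x" using orth(2)[OF u v c(1)] c by (simp add: e tprod_add3 tprod_closed)
  then have "u = \<zero>" using h u c by (auto intro: cube_eq_0)
  then show "x \<in> Fneg" using v e c by simp
qed (rule orth)

lemma Fpos_add: "x \<in> Fpos \<Longrightarrow> y \<in> Fpos \<Longrightarrow> x \<oplus> y \<in> Fpos"
  and Fpos_smult: "x \<in> Fpos \<Longrightarrow> c \<odot> x \<in> Fpos"
  by (subst Fpos_iff; simp add: Fpos_closed tprod_add3 tprod_smult3 Fneg_closed orth)+

lemma Fneg_add: "x \<in> Fneg \<Longrightarrow> y \<in> Fneg \<Longrightarrow> x \<oplus> y \<in> Fneg"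
  and Fneg_smult: "x \<in> Fneg \<Longrightarrow> c \<odot> x \<in> Fneg"
  by (subst Fneg_iff; simp add: Fneg_closed tprod_add3 tprod_smult3 Fpos_closed orth)+

lemma Fpos_Fneg: "x \<in> Fpos \<Longrightarrow> x \<in> Fneg \<Longrightarrow> x = \<zero>"
  using zs_both by (auto simp: Fpos_def Fneg_def)

section \<open>The sign involution\<close>

definition sg :: "'a \<Rightarrow> 'a"
  where "sg x = (THE s. \<exists>u\<in>Fpos. \<exists>v\<in>Fneg. x = u \<oplus> v \<and> s = u \<ominus> v)"

text \<open>The decomposition is unique: two of them differ by \<open>u - u' = v' - v\<close>, which
  lies in both parts and hence is zero.\<close>

lemma sg_eq:
  assumes u: "u \<in> Fpos" and v: "v \<in> Fneg" shows "sg (u \<oplus> v) = u \<ominus> v"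
  unfolding sg_def
proof (rule the_equality)
  show "\<exists>u'\<in>Fpos. \<exists>v'\<in>Fneg. u \<oplus> v = u' \<oplus> v' \<and> u \<ominus> v = u' \<ominus> v'"
    by (rule bexI[of _ u], rule bexI[of _ v]) (simp_all add: u v)
  fix s assume "\<exists>u'\<in>Fpos. \<exists>v'\<in>Fneg. u \<oplus> v = u' \<oplus> v' \<and> s = u' \<ominus> v'"
  then obtain u' v' where u': "u' \<in> Fpos" and v': "v' \<in> Fneg" and e: "u \<oplus> v = u' \<oplus> v'"
    and s: "s = u' \<ominus> v'" by blast
  note c [simp] = Fpos_closed[OF u] Fneg_closed[OF v] Fpos_closed[OF u'] Fneg_closed[OF v']
  have "(u \<oplus> v) \<ominus> (u' \<oplus> v') = \<zero>" by (simp add: e)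
  then have sum: "(u \<ominus> u') \<oplus> (v \<ominus> v') = \<zero>" by (simp add: add_diff_add)
  have "v \<ominus> v' \<in> Fneg" using v v' by (simp add: minus_smult Fneg_add Fneg_smult)
  then have "(- 1) \<odot> (v \<ominus> v') \<in> Fneg" by (rule Fneg_smult)
  moreover have "u \<ominus> u' = (- 1) \<odot> (v \<ominus> v')"
    using minus_equality[OF sum] by (simp add: smult_minus1)
  moreover have "u \<ominus> u' \<in> Fpos" using u u' by (simp add: minus_smult Fpos_add Fpos_smult)
  ultimately have "u \<ominus> u' = \<zero>" using Fpos_Fneg by simp
  then have "u = u'" by (simp add: diff_eq_zero)
  moreover from this have "v = v'" using e by simp
  ultimately show "s = u \<ominus> v" using s by simp
qed

lemma sgE:
  assumes "x \<in> carrier F"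
  obtains u v where "u \<in> Fpos" "v \<in> Fneg" "u \<in> carrier F" "v \<in> carrier F" "x = u \<oplus> v" "sg x = u \<ominus> v"
  using decomp[OF assms] sg_eq Fpos_closed Fneg_closed by metis

lemma sg_closed [simp]: "x \<in> carrier F \<Longrightarrow> sg x \<in> carrier F"
  by (metis sgE minus_closed)

lemma sg_add: "x \<in> carrier F \<Longrightarrow> y \<in> carrier F \<Longrightarrow> sg (x \<oplus> y) = sg x \<oplus> sg y"
proof -
  assume "x \<in> carrier F" "y \<in> carrier F"
  then obtain u v u' v' where h: "u \<in> Fpos" "v \<in> Fneg" "u' \<in> Fpos" "v' \<in> Fneg"
    and [simp]: "u \<in> carrier F" "v \<in> carrier F" "u' \<in> carrier F" "v' \<in> carrier F"
    and e: "x = u \<oplus> v" "sg x = u \<ominus> v" "y = u' \<oplus> v'" "sg y = u' \<ominus> v'"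
    by (metis sgE)
  have "x \<oplus> y = (u \<oplus> u') \<oplus> (v \<oplus> v')" by (simp add: e a_ac)
  then have "sg (x \<oplus> y) = (u \<oplus> u') \<ominus> (v \<oplus> v')" using h by (simp add: sg_eq Fpos_add Fneg_add)
  then show ?thesis unfolding e(2,4) by (simp add: add_diff_add)
qed

lemma sg_smult: "x \<in> carrier F \<Longrightarrow> sg (c \<odot> x) = c \<odot> sg x"
proof -
  assume "x \<in> carrier F"
  then obtain u v where h: "u \<in> Fpos" "v \<in> Fneg" and [simp]: "u \<in> carrier F" "v \<in> carrier F"
    and e: "x = u \<oplus> v" "sg x = u \<ominus> v" by (rule sgE)
  have "c \<odot> x = c \<odot> u \<oplus> c \<odot> v" by (simp add: e smult_add)
  then show ?thesis using h unfolding e(2) by (simp add: sg_eq Fpos_smult Fneg_smult smult_diff)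
qed

lemma sg_sg [simp]: "x \<in> carrier F \<Longrightarrow> sg (sg x) = x"
proof -
  assume "x \<in> carrier F"
  then obtain u v where h: "u \<in> Fpos" "v \<in> Fneg" and [simp]: "u \<in> carrier F" "v \<in> carrier F"
    and e: "x = u \<oplus> v" "sg x = u \<ominus> v" by (rule sgE)
  have "sg (sg x) = u \<ominus> (- 1) \<odot> v"
    using sg_eq[of u "(- 1) \<odot> v"] h unfolding e(2) by (simp add: minus_smult Fneg_smult)
  then show ?thesis by (simp add: e(1) minus_smult smult_smult)
qed

text \<open>A product of three elements with signs vanishes unless the signs agree. With a positive
  third factor only the positive components of the other two count, and the result is annihilated by
  every negative element; likewise with the signs exchanged.\<close>

lemma tprod_sg3:
  assumes p: "p \<in> carrier F" and q: "q \<in> carrier F" and x: "x \<in> carrier F"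
  shows "tprod F p q (sg x) = sg (tprod F p q x)"
proof -
  note [simp] = tprod_closed
  have pos: "tprod F p q u \<in> Fpos" if u: "u \<in> Fpos" for u
  proof -
    obtain a b where a: "a \<in> Fpos" "b \<in> Fneg" and [simp]: "a \<in> carrier F" "b \<in> carrier F" and ab: "p = a \<oplus> b"
      using p by (metis sgE)
    obtain c d where c: "c \<in> Fpos" "d \<in> Fneg" and [simp]: "c \<in> carrier F" "d \<in> carrier F" and cd: "q = c \<oplus> d"
      using q by (metis sgE)
    have [simp]: "u \<in> carrier F" using u by (rule Fpos_closed)
    have "tprod F p q u = tprod F a c u"
      using orth[OF u c(2)] orth[OF c(1) a(2)] by (simp add: ab cd tprod_add1 tprod_add2)
    moreover have "tprod F a c u \<in> Fpos"
    proof (subst Fpos_iff)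
      show "\<forall>y\<in>Fneg. \<forall>z\<in>carrier F. tprod F z y (tprod F a c u) = \<zero>"
      proof (intro ballI)
        fix y z assume y: "y \<in> Fneg" and z: "z \<in> carrier F"
        have "tprod F z y (tprod F a c u) = tprod F (tprod F z y a) c u"
          using y z by (simp add: tprod_assoc13 Fneg_closed)
        then show "tprod F z y (tprod F a c u) = \<zero>" using orth(1)[OF a(1) y z] by simp
      qed
    qed simp
    ultimately show ?thesis by simp
  qed
  have neg: "tprod F p q u \<in> Fneg" if u: "u \<in> Fneg" for u
  proof -
    obtain a b where a: "a \<in> Fpos" "b \<in> Fneg" and [simp]: "a \<in> carrier F" "b \<in> carrier F" and ab: "p = a \<oplus> b"
      using p by (metis sgE)
    obtain c d where c: "c \<in> Fpos" "d \<in> Fneg" and [simp]: "c \<in> carrier F" "d \<in> carrier F" and cd: "q = c \<oplus> d"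
      using q by (metis sgE)
    have [simp]: "u \<in> carrier F" using u by (rule Fneg_closed)
    have "tprod F p q u = tprod F b d u"
      using orth[OF c(1) u] orth[OF a(1) c(2)] by (simp add: ab cd tprod_add1 tprod_add2)
    moreover have "tprod F b d u \<in> Fneg"
    proof (subst Fneg_iff)
      show "\<forall>y\<in>Fpos. \<forall>z\<in>carrier F. tprod F z y (tprod F b d u) = \<zero>"
      proof (intro ballI)
        fix y z assume y: "y \<in> Fpos" and z: "z \<in> carrier F"
        have "tprod F z y (tprod F b d u) = tprod F (tprod F z y b) d u"
          using y z by (simp add: tprod_assoc13 Fpos_closed)
        then show "tprod F z y (tprod F b d u) = \<zero>" using orth(2)[OF y a(2) z] by simp
      qed
    qed simp
    ultimately show ?thesis by simp
  qed
  obtain u v where h: "u \<in> Fpos" "v \<in> Fneg" and [simp]: "u \<in> carrier F" "v \<in> carrier F"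
    and e: "x = u \<oplus> v" "sg x = u \<ominus> v" using x by (metis sgE)
  show ?thesis using p q sg_eq[OF pos[OF h(1)] neg[OF h(2)]]
    by (simp add: e(2) tprod_diff(3)) (simp add: e(1) tprod_add3)
qed

lemma sg_opp: "cstar_tring.sg (opp_tring F) = sg"
proof -
  interpret O: cstar_tring "opp_tring F" \<gamma> by (rule opp_cstar_tring)
  show ?thesis by (intro ext) (simp add: O.sg_def sg_def Fpos_opp Fneg_opp)
qed

lemma tprod_sg1:
  assumes "p \<in> carrier F" "q \<in> carrier F" "x \<in> carrier F"
  shows "tprod F (sg x) q p = sg (tprod F x q p)"
proof -
  interpret O: cstar_tring "opp_tring F" \<gamma> by (rule opp_cstar_tring)
  show ?thesis using O.tprod_sg3[of p q x] assms by (simp add: sg_opp)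
qed

text \<open>In \<open>(p, sg x, q)\<close> and in \<open>(sg p, x, q)\<close> only products of
  components of equal sign survive, so the two coincide, and the middle variable is reduced to the
  first.\<close>

lemma tprod_sg2:
  assumes "p \<in> carrier F" "q \<in> carrier F" "x \<in> carrier F"
  shows "tprod F p (sg x) q = sg (tprod F p x q)"
proof -
  note [simp] = tprod_closed
  obtain u v where h: "u \<in> Fpos" "v \<in> Fneg" and [simp]: "u \<in> carrier F" "v \<in> carrier F"
    and e: "x = u \<oplus> v" "sg x = u \<ominus> v" using assms(3) by (metis sgE)
  obtain a b where a: "a \<in> Fpos" "b \<in> Fneg" and [simp]: "a \<in> carrier F" "b \<in> carrier F"
    and ab: "p = a \<oplus> b" "sg p = a \<ominus> b"
    using assms(1) by (metis sgE)
  have "tprod F p (sg x) q = tprod F a u q \<ominus> tprod F b v q"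
    using assms orth[OF h(1) a(2)] orth[OF a(1) h(2)]
    by (simp add: ab(1) e(2) tprod_diff tprod_add1)
  moreover have "tprod F (sg p) x q = tprod F a u q \<ominus> tprod F b v q"
    using assms orth[OF h(1) a(2)] orth[OF a(1) h(2)]
    by (simp add: ab(2) e(1) tprod_diff tprod_add2) (simp add: a_minus_def)
  ultimately show ?thesis using tprod_sg1[of q x p] assms by simp
qed

lemmas tprod_sg = tprod_sg1 tprod_sg2 tprod_sg3

text \<open>In the cube two of the three signs cancel:
  \<open>(sg y, sg y, sg y) = (y, y, sg y)\<close>. Hence \<open>\<gamma> (sg y)\<close> squared is
  at most \<open>\<gamma> y\<close> squared, and \<open>sg\<close> is its own inverse.\<close>

lemma g_sg: assumes "x \<in> carrier F" shows "\<gamma> (sg x) = \<gamma> x"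
proof -
  have le: "\<gamma> (sg y) \<le> \<gamma> y" if y: "y \<in> carrier F" for y
  proof (cases "\<gamma> (sg y) = 0")
    case False
    then have pos: "\<gamma> (sg y) > 0" using p_nonneg[of "sg y"] y by (auto simp: order_less_le)
    have "tprod F (sg y) (sg y) (sg y) = tprod F y y (sg y)"
      using y by (simp add: tprod_sg tprod_closed)
    then have "\<gamma> (sg y) ^ 3 \<le> \<gamma> y * \<gamma> y * \<gamma> (sg y)"
      using g_cube[of "sg y"] g_tprod[of y y "sg y"] y by simp
    then have "\<gamma> (sg y) * \<gamma> (sg y) \<le> \<gamma> y * \<gamma> y"
      using pos by (simp add: power3_eq_cube)
    then show ?thesis using y power2_le_imp_le[of "\<gamma> (sg y)" "\<gamma> y"] by (simp add: power2_eq_square)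
  qed (use y in simp)
  show ?thesis using le[of x] le[of "sg x"] assms by simp
qed

text \<open>Orthogonality passes to square roots of the inner products. An operator that vanishes
  when applied twice to an element vanishes already when applied once, because the cube of the
  single application contains the double one; this is used first for \<open>p\<close>, then for
  \<open>q\<close>. It removes the mixed terms in \<open>lip_positive\<close>.\<close>

lemma zs_cross:
  assumes p: "zs e u p" and q: "zs e' v q" and e: "e \<noteq> 0" "e' \<noteq> 0"
    and vu: "tprod F v u u = \<zero>" and z: "z \<in> carrier F"
  shows "tprod F (tprod F z p p) q q = \<zero>"
proof -
  note [simp] = tprod_closed z
  have c [simp]: "u \<in> carrier F" "p \<in> carrier F" "v \<in> carrier F" "q \<in> carrier F"
    using p q by (auto simp: zs_def)
  have cancel: "a = \<zero>" if "c \<odot> a = \<zero>" "c \<noteq> 0" "a \<in> carrier F" for a and c :: complex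
    using smult_smult[of a "inverse c" c] that by simp
  have ep: "tprod F (tprod F a p p) p p = \<zero>" if "a \<in> carrier F" "tprod F a u u = \<zero>" for a
    by (rule cancel[OF _ e(1)]) (use p that in \<open>simp_all add: zs_def\<close>)
  have eq: "tprod F (tprod F a q q) q q = \<zero>" if "a \<in> carrier F" "tprod F a v v = \<zero>" for a
    by (rule cancel[OF _ e(2)]) (use q that in \<open>simp_all add: zs_def\<close>)
  have vpp: "tprod F v p p = \<zero>"
  proof (rule cube_eq_0)
    let ?d = "tprod F v p p"
    have "tprod F ?d ?d ?d = tprod F ?d p (tprod F p v ?d)" by (rule tprod_assoc) simp_all
    also have "\<dots> = tprod F (tprod F ?d p p) v ?d" by (rule tprod_assoc13[symmetric]) simp_all
    finally show "tprod F ?d ?d ?d = \<zero>" using ep[OF _ vu] by simp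
  qed simp
  let ?a = "tprod F z p p"
  have av: "tprod F ?a v v = \<zero>" by (simp add: tprod_assoc12 vpp)
  show ?thesis
  proof (rule cube_eq_0)
    let ?f = "tprod F ?a q q"
    have "tprod F ?f ?f ?f = tprod F ?f q (tprod F q ?a ?f)" by (rule tprod_assoc) simp_all
    also have "\<dots> = tprod F (tprod F ?f q q) ?a ?f" by (rule tprod_assoc13[symmetric]) simp_all
    finally show "tprod F ?f ?f ?f = \<zero>" using eq[OF _ av] by simp
  qed simp
qed

end

section \<open>Completions of normed *-algebras and of *-trings\<close>

context seminormed
begin

text \<open>Unlike in \<open>cauchy_comp\<close>, the bound may combine several sequences, as it
  must for products.\<close>

lemma cauchy_of_bound:
  assumes f: "\<And>n. f n \<in> carrier V"
    and le: "\<And>m n. p (f m \<ominus> f n) \<le> D m n"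
    and D: "\<And>e::real. e > 0 \<Longrightarrow> \<exists>N. \<forall>m\<ge>N. \<forall>n\<ge>N. D m n < e"
  shows "cauchy_in V p f"
  unfolding cauchy_in_def using f le D by (meson order_le_less_trans)

lemma cauchy_null_sum:
  fixes D D' :: "nat \<Rightarrow> nat \<Rightarrow> real"
  assumes "\<And>e::real. e > 0 \<Longrightarrow> \<exists>N. \<forall>m\<ge>N. \<forall>n\<ge>N. D m n < e"
    and "\<And>e::real. e > 0 \<Longrightarrow> \<exists>N. \<forall>m\<ge>N. \<forall>n\<ge>N. D' m n < e" and e: "e > 0"
  shows "\<exists>N. \<forall>m\<ge>N. \<forall>n\<ge>N. D m n + D' m n < e"
proof -
  have e2: "e / 2 > 0" using e by simp
  obtain M where M: "\<forall>m\<ge>M. \<forall>n\<ge>M. D m n < e / 2" using assms(1)[OF e2] by blast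
  obtain N where N: "\<forall>m\<ge>N. \<forall>n\<ge>N. D' m n < e / 2" using assms(2)[OF e2] by blast
  from M N have "D m n + D' m n < e" if "m \<ge> max M N" "n \<ge> max M N" for m n
    using that by (metis add_strict_mono field_sum_of_halves max.bounded_iff)
  then show ?thesis by blast
qed

lemma cauchy_null_mult:
  assumes s: "cauchy_in V p s" and K: "K \<ge> 0" and e: "e > 0"
  shows "\<exists>N. \<forall>m\<ge>N. \<forall>n\<ge>N. K * p (s m \<ominus> s n) < e"
proof -
  obtain N where N: "\<And>m n. m \<ge> N \<Longrightarrow> n \<ge> N \<Longrightarrow> p (s m \<ominus> s n) < e / (K + 1)"
    using cauchy_diff_null[OF s, of "e / (K + 1)"] K e by auto
  have "K * p (s m \<ominus> s n) < e" if "m \<ge> N" "n \<ge> N" for m n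
  proof -
    have "K * p (s m \<ominus> s n) \<le> (K + 1) * p (s m \<ominus> s n)"
      using cauchyD[OF s] by (intro mult_right_mono) auto
    also have "\<dots> < e" using N[OF that] K by (simp add: pos_less_divide_eq mult.commute)
    finally show ?thesis .
  qed
  then show ?thesis by blast
qed

end

text \<open>All of \<open>cstar_algebra\<close> except completeness.\<close>

locale pre_cstar = complex_module A
  for A :: "('a, 'm) normed_star_alg_scheme" (structure) +
  assumes A_mult [simp]: "\<lbrakk>a \<in> carrier A; b \<in> carrier A\<rbrakk> \<Longrightarrow> a \<otimes> b \<in> carrier A"
    and A_assoc: "\<lbrakk>a \<in> carrier A; b \<in> carrier A; c \<in> carrier A\<rbrakk> \<Longrightarrow> (a \<otimes> b) \<otimes> c = a \<otimes> (b \<otimes> c)"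
    and A_l_distr: "\<lbrakk>a \<in> carrier A; b \<in> carrier A; c \<in> carrier A\<rbrakk> \<Longrightarrow>
      (a \<oplus> b) \<otimes> c = (a \<otimes> c) \<oplus> (b \<otimes> c)"
    and A_r_distr: "\<lbrakk>a \<in> carrier A; b \<in> carrier A; c \<in> carrier A\<rbrakk> \<Longrightarrow>
      a \<otimes> (b \<oplus> c) = (a \<otimes> b) \<oplus> (a \<otimes> c)"
    and A_smult_l: "\<lbrakk>a \<in> carrier A; b \<in> carrier A\<rbrakk> \<Longrightarrow> (k \<odot> a) \<otimes> b = k \<odot> (a \<otimes> b)"
    and A_smult_r: "\<lbrakk>a \<in> carrier A; b \<in> carrier A\<rbrakk> \<Longrightarrow> a \<otimes> (k \<odot> b) = k \<odot> (a \<otimes> b)"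
    and A_star [simp]: "a \<in> carrier A \<Longrightarrow> star A a \<in> carrier A"
    and A_star_add: "\<lbrakk>a \<in> carrier A; b \<in> carrier A\<rbrakk> \<Longrightarrow> star A (a \<oplus> b) = star A a \<oplus> star A b"
    and A_star_smult: "a \<in> carrier A \<Longrightarrow> star A (k \<odot> a) = cnj k \<odot> star A a"
    and A_star_mult: "\<lbrakk>a \<in> carrier A; b \<in> carrier A\<rbrakk> \<Longrightarrow> star A (a \<otimes> b) = star A b \<otimes> star A a"
    and A_star_star: "a \<in> carrier A \<Longrightarrow> star A (star A a) = a"
    and A_norm: "norm_on A (nrm A)"
    and A_nrm_mult: "\<lbrakk>a \<in> carrier A; b \<in> carrier A\<rbrakk> \<Longrightarrow> nrm A (a \<otimes> b) \<le> nrm A a * nrm A b"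
    and A_cstar: "a \<in> carrier A \<Longrightarrow> nrm A (star A a \<otimes> a) = (nrm A a)\<^sup>2"

sublocale pre_cstar \<subseteq> seminormed A "nrm A"
  by (intro seminormed.intro complex_module_axioms seminormed_axioms.intro)
     (use A_norm in \<open>simp add: norm_on_def\<close>)

lemma alg_completion_simps [simp]:
  "carrier (alg_completion A) = completion_carrier A (nrm A)"
  "a \<otimes>\<^bsub>alg_completion A\<^esub> b = completion_class A (nrm A) (\<lambda>n. rep a n \<otimes>\<^bsub>A\<^esub> rep b n)"
  "ring.zero (alg_completion A) = completion_class A (nrm A) (\<lambda>n. \<zero>\<^bsub>A\<^esub>)"
  "ring.add (alg_completion A) = (\<lambda>X Y. completion_class A (nrm A) (\<lambda>n. rep X n \<oplus>\<^bsub>A\<^esub> rep Y n))"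
  "module.smult (alg_completion A) = (\<lambda>c X. completion_class A (nrm A) (\<lambda>n. c \<odot>\<^bsub>A\<^esub> rep X n))"
  "star (alg_completion A) = (\<lambda>X. completion_class A (nrm A) (\<lambda>n. star A (rep X n)))"
  "nrm (alg_completion A) = completion_norm (nrm A)"
  by (simp_all add: alg_completion_def)

sublocale pre_cstar \<subseteq> completed A "nrm A" "alg_completion A"
  by (intro completed.intro seminormed_axioms completed_axioms.intro) simp_all

context pre_cstar
begin

lemma nrm_star [simp]:
  assumes "a \<in> carrier A" shows "nrm A (star A a) = nrm A a"
proof -
  have le: "nrm A b \<le> nrm A (star A b)" if b: "b \<in> carrier A" for b
  proof (cases "nrm A b = 0")
    case False
    then have "nrm A b > 0" using b by (auto simp: order_less_le)
    moreover have "nrm A b * nrm A b \<le> nrm A (star A b) * nrm A b"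
      using A_cstar[OF b] A_nrm_mult[of "star A b" b] b by (simp add: power2_eq_square)
    ultimately show ?thesis by simp
  qed (use b in simp)
  show ?thesis using le[OF assms] le[of "star A a"] assms by (simp add: A_star_star)
qed

lemma mult_diff:
  assumes "a \<in> carrier A" "b \<in> carrier A" "c \<in> carrier A" "d \<in> carrier A"
  shows "nrm A (a \<otimes> b \<ominus> c \<otimes> d) \<le> nrm A a * nrm A (b \<ominus> d) + nrm A (a \<ominus> c) * nrm A d"
proof -
  have "a \<otimes> (b \<ominus> d) = a \<otimes> b \<ominus> a \<otimes> d" "(a \<ominus> c) \<otimes> d = a \<otimes> d \<ominus> c \<otimes> d"
    using assms by (simp_all add: minus_smult A_r_distr A_l_distr A_smult_r A_smult_l)
  then have "a \<otimes> b \<ominus> c \<otimes> d = a \<otimes> (b \<ominus> d) \<oplus> (a \<ominus> c) \<otimes> d"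
    using diff_add_diff[of "a \<otimes> b" "a \<otimes> d" "c \<otimes> d"] assms by simp
  then show ?thesis
    using p_add[of "a \<otimes> (b \<ominus> d)" "(a \<ominus> c) \<otimes> d"] A_nrm_mult[of a "b \<ominus> d"] A_nrm_mult[of "a \<ominus> c" d] assms
    by simp
qed

lemma cauchy_mult:
  assumes s: "cauchy_in A (nrm A) s" and t: "cauchy_in A (nrm A) t"
  shows "cauchy_in A (nrm A) (\<lambda>n. s n \<otimes> t n)"
proof -
  obtain M N where M: "M \<ge> 0" "\<And>n. nrm A (s n) \<le> M" and N: "N \<ge> 0" "\<And>n. nrm A (t n) \<le> N"
    using cauchy_bounded[OF s] cauchy_bounded[OF t] by metis
  note [simp] = cauchyD[OF s] cauchyD[OF t]
  show ?thesis
  proof (rule cauchy_of_bound[where D = "\<lambda>m n. M * nrm A (t m \<ominus> t n) + N * nrm A (s m \<ominus> s n)"])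
    fix m n
    have "nrm A (s m) * nrm A (t m \<ominus> t n) + nrm A (s m \<ominus> s n) * nrm A (t n) \<le>
        M * nrm A (t m \<ominus> t n) + nrm A (s m \<ominus> s n) * N"
      by (intro add_mono mult_right_mono mult_left_mono M N) simp_all
    then show "nrm A (s m \<otimes> t m \<ominus> s n \<otimes> t n) \<le> M * nrm A (t m \<ominus> t n) + N * nrm A (s m \<ominus> s n)"
      using mult_diff[of "s m" "t m" "s n" "t n"] by (simp add: mult.commute)
  qed (auto intro!: cauchy_null_sum cauchy_null_mult s t M N)
qed

lemma cl_mult:
  assumes s: "cauchy_in A (nrm A) s" and t: "cauchy_in A (nrm A) t"
  shows "cl s \<otimes>\<^bsub>alg_completion A\<^esub> cl t = cl (\<lambda>n. s n \<otimes> t n)"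
proof -
  note s' = rep_cl[OF s] and t' = rep_cl[OF t]
  obtain M N where M: "M \<ge> 0" "\<And>n. nrm A (s n) \<le> M" and N: "N \<ge> 0" "\<And>n. nrm A (rep (cl t) n) \<le> N"
    using cauchy_bounded[OF s] cauchy_bounded[OF t'(1)] by metis
  note [simp] = cauchyD[OF s] cauchyD[OF t] cauchyD[OF s'(1)] cauchyD[OF t'(1)]
  have "(\<lambda>n. nrm A (s n \<otimes> t n \<ominus> rep (cl s) n \<otimes> rep (cl t) n)) \<longlonglongrightarrow> 0"
  proof (rule null_sandwich)
    show "(\<lambda>n. M * nrm A (t n \<ominus> rep (cl t) n) + N * nrm A (s n \<ominus> rep (cl s) n)) \<longlonglongrightarrow> 0"
      by (intro tendsto_add_zero tendsto_mult_right_zero s'(2) t'(2))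
    fix n
    have "nrm A (s n) * nrm A (t n \<ominus> rep (cl t) n) + nrm A (s n \<ominus> rep (cl s) n) * nrm A (rep (cl t) n) \<le>
        M * nrm A (t n \<ominus> rep (cl t) n) + nrm A (s n \<ominus> rep (cl s) n) * N"
      by (intro add_mono mult_right_mono mult_left_mono M N) simp_all
    then show "nrm A (s n \<otimes> t n \<ominus> rep (cl s) n \<otimes> rep (cl t) n) \<le>
        M * nrm A (t n \<ominus> rep (cl t) n) + N * nrm A (s n \<ominus> rep (cl s) n)"
      using mult_diff[of "s n" "t n" "rep (cl s) n" "rep (cl t) n"] by (simp add: mult.commute)
  qed simp
  then show ?thesis
    using cl_eq_iff[OF cauchy_mult[OF s t] cauchy_mult[OF s'(1) t'(1)]] by simp
qed

lemma star_diff: "a \<in> carrier A \<Longrightarrow> b \<in> carrier A \<Longrightarrow> star A a \<ominus> star A b = star A (a \<ominus> b)"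
  by (simp add: minus_smult A_star_add A_star_smult)

lemma cauchy_star: "cauchy_in A (nrm A) s \<Longrightarrow> cauchy_in A (nrm A) (\<lambda>n. star A (s n))"
  by (rule cauchy_comp[where K = 1]) (auto simp: cauchyD star_diff)

lemma cl_star: "cauchy_in A (nrm A) s \<Longrightarrow> star (alg_completion A) (cl s) = cl (\<lambda>n. star A (s n))"
  unfolding alg_completion_simps
  by (rule cl_op1[where f = "star A" and K = 1]) (auto simp: cauchy_star star_diff)

lemma cstar_completion: "cstar_algebra (alg_completion A)"
proof (intro cstar_algebra.intro C_module cstar_algebra_axioms.intro)
  let ?C = "alg_completion A"
  note sim = C_add_cl C_smult_cl C_closed cl_mult cl_star cauchy_add cauchy_smult cauchy_mult cauchy_star cauchyD
  note [simp del] = alg_completion_simps(2,4,5,6)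
  fix X assume "X \<in> carrier ?C"
  then obtain s where s: "cauchy_in A (nrm A) s" "X = cl s" by (rule CE)
  show "star ?C X \<in> carrier ?C" using s by (simp add: sim del: alg_completion_simps(1))
  show "star ?C (k \<odot>\<^bsub>?C\<^esub> X) = cnj k \<odot>\<^bsub>?C\<^esub> star ?C X" for k
    using s by (simp add: sim A_star_smult)
  show "star ?C (star ?C X) = X" using s by (simp add: sim A_star_star)
  show "nrm ?C (star ?C X \<otimes>\<^bsub>?C\<^esub> X) = (nrm ?C X)\<^sup>2"
  proof -
    have "(\<lambda>n. nrm A (star A (s n) \<otimes> s n)) \<longlonglongrightarrow> completion_norm (nrm A) (cl (\<lambda>n. star A (s n) \<otimes> s n))"
      by (rule completion_norm_cl) (simp add: s sim)
    moreover have "(\<lambda>n. (nrm A (s n))\<^sup>2) \<longlonglongrightarrow> (completion_norm (nrm A) (cl s))\<^sup>2"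
      by (intro tendsto_power completion_norm_cl s)
    ultimately show ?thesis
      using s by (simp add: sim A_cstar LIMSEQ_unique)
  qed
  fix Y assume "Y \<in> carrier ?C"
  then obtain t where t: "cauchy_in A (nrm A) t" "Y = cl t" by (rule CE)
  show "X \<otimes>\<^bsub>?C\<^esub> Y \<in> carrier ?C" using s t by (simp add: sim del: alg_completion_simps(1))
  show "(k \<odot>\<^bsub>?C\<^esub> X) \<otimes>\<^bsub>?C\<^esub> Y = k \<odot>\<^bsub>?C\<^esub> (X \<otimes>\<^bsub>?C\<^esub> Y)"
    "X \<otimes>\<^bsub>?C\<^esub> (k \<odot>\<^bsub>?C\<^esub> Y) = k \<odot>\<^bsub>?C\<^esub> (X \<otimes>\<^bsub>?C\<^esub> Y)" for k
    using s t by (simp_all add: sim A_smult_l A_smult_r)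
  show "star ?C (X \<oplus>\<^bsub>?C\<^esub> Y) = star ?C X \<oplus>\<^bsub>?C\<^esub> star ?C Y"
    using s t by (simp add: sim A_star_add)
  show "star ?C (X \<otimes>\<^bsub>?C\<^esub> Y) = star ?C Y \<otimes>\<^bsub>?C\<^esub> star ?C X"
    using s t by (simp add: sim A_star_mult)
  show "nrm ?C (X \<otimes>\<^bsub>?C\<^esub> Y) \<le> nrm ?C X * nrm ?C Y"
  proof -
    have "completion_norm (nrm A) (cl (\<lambda>n. s n \<otimes> t n)) \<le> completion_norm (nrm A) (cl s) * completion_norm (nrm A) (cl t)"
      by (rule LIMSEQ_le[OF completion_norm_cl tendsto_mult[OF completion_norm_cl completion_norm_cl]])
        (use s t in \<open>auto simp: sim A_nrm_mult\<close>)
    then show ?thesis using s t by (simp add: sim)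
  qed
  fix Z assume "Z \<in> carrier ?C"
  then obtain u where u: "cauchy_in A (nrm A) u" "Z = cl u" by (rule CE)
  show "(X \<otimes>\<^bsub>?C\<^esub> Y) \<otimes>\<^bsub>?C\<^esub> Z = X \<otimes>\<^bsub>?C\<^esub> (Y \<otimes>\<^bsub>?C\<^esub> Z)"
    using s t u by (simp add: sim A_assoc)
  show "(X \<oplus>\<^bsub>?C\<^esub> Y) \<otimes>\<^bsub>?C\<^esub> Z = (X \<otimes>\<^bsub>?C\<^esub> Z) \<oplus>\<^bsub>?C\<^esub> (Y \<otimes>\<^bsub>?C\<^esub> Z)"
    using s t u by (simp add: sim A_l_distr)
  show "X \<otimes>\<^bsub>?C\<^esub> (Y \<oplus>\<^bsub>?C\<^esub> Z) = (X \<otimes>\<^bsub>?C\<^esub> Y) \<oplus>\<^bsub>?C\<^esub> (X \<otimes>\<^bsub>?C\<^esub> Z)"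
    using s t u by (simp add: sim A_r_distr)
qed (use C_norm C_complete in simp_all)

end

section \<open>Completion of a seminormed *-tring\<close>

lemma tring_completion_simps [simp]:
  "carrier (tring_completion E \<gamma>) = completion_carrier E \<gamma>"
  "ring.zero (tring_completion E \<gamma>) = completion_class E \<gamma> (\<lambda>n. \<zero>\<^bsub>E\<^esub>)"
  "ring.add (tring_completion E \<gamma>) = (\<lambda>X Y. completion_class E \<gamma> (\<lambda>n. rep X n \<oplus>\<^bsub>E\<^esub> rep Y n))"
  "module.smult (tring_completion E \<gamma>) = (\<lambda>c X. completion_class E \<gamma> (\<lambda>n. c \<odot>\<^bsub>E\<^esub> rep X n))"
  "tprod (tring_completion E \<gamma>) =
    (\<lambda>X Y Z. completion_class E \<gamma> (\<lambda>n. tprod E (rep X n) (rep Y n) (rep Z n)))"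
  by (simp_all add: tring_completion_def)

locale seminormed_tring = star_tring E for E :: "('a, 'm) tring_scheme" (structure) +
  fixes \<gamma> :: "'a \<Rightarrow> real"
  assumes SN_E: "\<gamma> \<in> SN E"

sublocale seminormed_tring \<subseteq> seminormed E \<gamma>
  by (intro seminormed.intro complex_module_axioms seminormed_axioms.intro)
     (use SN_E in \<open>simp add: SN_def\<close>)

sublocale seminormed_tring \<subseteq> completed E \<gamma> "tring_completion E \<gamma>"
  by (intro completed.intro seminormed_axioms completed_axioms.intro) simp_all

context seminormed_tring
begin

lemma E_tprod: "x \<in> carrier E \<Longrightarrow> y \<in> carrier E \<Longrightarrow> z \<in> carrier E \<Longrightarrow>
    \<gamma> (tprod E x y z) \<le> \<gamma> x * \<gamma> y * \<gamma> z"
  and E_cube: "x \<in> carrier E \<Longrightarrow> \<gamma> (tprod E x x x) = \<gamma> x ^ 3"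
  using SN_E by (simp_all add: SN_def)

text \<open>One argument is changed at a time; a common bound \<open>M\<close> gives the three terms
  the same coefficient.\<close>

lemma tprod_diff_le:
  assumes [simp]: "x \<in> carrier E" "y \<in> carrier E" "z \<in> carrier E" "x' \<in> carrier E" "y' \<in> carrier E" "z' \<in> carrier E"
    and M: "\<gamma> x \<le> M" "\<gamma> y \<le> M" "\<gamma> y' \<le> M" "\<gamma> z' \<le> M" "\<gamma> x' \<le> M" "0 \<le> M"
  shows "\<gamma> (tprod E x y z \<ominus> tprod E x' y' z') \<le>
    M * M * \<gamma> (z \<ominus> z') + (M * M * \<gamma> (y \<ominus> y') + M * M * \<gamma> (x \<ominus> x'))"
proof -
  note [simp] = tprod_closed
  have "\<gamma> (tprod E x y z \<ominus> tprod E x' y' z') \<le> \<gamma> (tprod E x y z \<ominus> tprod E x y z') +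
      (\<gamma> (tprod E x y z' \<ominus> tprod E x y' z') + \<gamma> (tprod E x y' z' \<ominus> tprod E x' y' z'))"
    using p_triangle[of "tprod E x y z" "tprod E x y z'" "tprod E x' y' z'"]
      p_triangle[of "tprod E x y z'" "tprod E x y' z'" "tprod E x' y' z'"] by simp
  also have "\<dots> \<le> \<gamma> x * \<gamma> y * \<gamma> (z \<ominus> z') + (\<gamma> x * \<gamma> (y \<ominus> y') * \<gamma> z' + \<gamma> (x \<ominus> x') * \<gamma> y' * \<gamma> z')"
    unfolding tprod_diff[symmetric, OF assms(1,2,3,6)] tprod_diff[symmetric, OF assms(1,2,5,6)]
      tprod_diff[symmetric, OF assms(1,4,5,6)]
    by (intro add_mono E_tprod) simp_all
  also have "\<dots> \<le> M * M * \<gamma> (z \<ominus> z') + (M * \<gamma> (y \<ominus> y') * M + \<gamma> (x \<ominus> x') * M * M)"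
    by (intro add_mono mult_mono M mult_nonneg_nonneg) simp_all
  finally show ?thesis by (simp add: mult_ac)
qed

lemma cauchy_bounded3:
  assumes "cauchy_in E \<gamma> s" "cauchy_in E \<gamma> t" "cauchy_in E \<gamma> u"
  obtains M where "M \<ge> 0" "\<And>n. \<gamma> (s n) \<le> M" "\<And>n. \<gamma> (t n) \<le> M" "\<And>n. \<gamma> (u n) \<le> M"
proof -
  obtain K L N where "\<And>n. \<gamma> (s n) \<le> K" "\<And>n. \<gamma> (t n) \<le> L" "\<And>n. \<gamma> (u n) \<le> N" "K \<ge> 0" "L \<ge> 0" "N \<ge> 0"
    using cauchy_bounded assms by metis
  then show ?thesis using that[of "K + L + N"]
    by (smt (verit))
qed

lemma cauchy_tprod:
  assumes s: "cauchy_in E \<gamma> s" and t: "cauchy_in E \<gamma> t" and u: "cauchy_in E \<gamma> u"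
  shows "cauchy_in E \<gamma> (\<lambda>n. tprod E (s n) (t n) (u n))"
proof -
  obtain M where M: "M \<ge> 0" "\<And>n. \<gamma> (s n) \<le> M" "\<And>n. \<gamma> (t n) \<le> M" "\<And>n. \<gamma> (u n) \<le> M"
    using cauchy_bounded3[OF s t u] by metis
  show ?thesis
    by (rule cauchy_of_bound[OF _ tprod_diff_le[where M = M]])
       (use s t u M in \<open>auto simp: cauchyD tprod_closed intro!: cauchy_null_sum cauchy_null_mult\<close>)
qed

lemma cl_tprod:
  assumes s: "cauchy_in E \<gamma> s" and t: "cauchy_in E \<gamma> t" and u: "cauchy_in E \<gamma> u"
  shows "tprod (tring_completion E \<gamma>) (cl s) (cl t) (cl u) = cl (\<lambda>n. tprod E (s n) (t n) (u n))"
proof -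
  note s' = rep_cl[OF s] and t' = rep_cl[OF t] and u' = rep_cl[OF u]
  note [simp] = cauchyD[OF s] cauchyD[OF t] cauchyD[OF u] cauchyD[OF s'(1)] cauchyD[OF t'(1)] cauchyD[OF u'(1)]
  obtain M1 where M1: "M1 \<ge> 0" "\<And>n. \<gamma> (s n) \<le> M1" "\<And>n. \<gamma> (t n) \<le> M1" "\<And>n. \<gamma> (u n) \<le> M1"
    using cauchy_bounded3[OF s t u] by metis
  obtain M2 where M2: "M2 \<ge> 0" "\<And>n. \<gamma> (rep (cl s) n) \<le> M2" "\<And>n. \<gamma> (rep (cl t) n) \<le> M2" "\<And>n. \<gamma> (rep (cl u) n) \<le> M2"
    using cauchy_bounded3[OF s'(1) t'(1) u'(1)] by metis
  define M where "M = M1 + M2"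
  have M: "\<gamma> (s n) \<le> M" "\<gamma> (t n) \<le> M" "\<gamma> (rep (cl s) n) \<le> M" "\<gamma> (rep (cl t) n) \<le> M" "\<gamma> (rep (cl u) n) \<le> M" "0 \<le> M" for n
    using M1 M2 by (auto simp: M_def intro: order_trans add_increasing add_increasing2)
  have "(\<lambda>n. \<gamma> (tprod E (s n) (t n) (u n) \<ominus> tprod E (rep (cl s) n) (rep (cl t) n) (rep (cl u) n))) \<longlonglongrightarrow> 0"
  proof (rule null_sandwich)
    show "(\<lambda>n. M * M * \<gamma> (u n \<ominus> rep (cl u) n) + (M * M * \<gamma> (t n \<ominus> rep (cl t) n) + M * M * \<gamma> (s n \<ominus> rep (cl s) n))) \<longlonglongrightarrow> 0"
      by (intro tendsto_add_zero tendsto_mult_right_zero s'(2) t'(2) u'(2))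
    fix n
    show "\<gamma> (tprod E (s n) (t n) (u n) \<ominus> tprod E (rep (cl s) n) (rep (cl t) n) (rep (cl u) n)) \<le>
      M * M * \<gamma> (u n \<ominus> rep (cl u) n) + (M * M * \<gamma> (t n \<ominus> rep (cl t) n) + M * M * \<gamma> (s n \<ominus> rep (cl s) n))"
      by (rule tprod_diff_le) (simp_all add: M)
  qed (simp add: tprod_closed)
  then show ?thesis
    using cl_eq_iff[OF cauchy_tprod[OF s t u] cauchy_tprod[OF s'(1) t'(1) u'(1)]] by simp
qed

text \<open>The algebraic laws hold termwise on representatives, and the norm conditions are limits
  of those in \<open>E\<close>.\<close>

lemma cstar_tring_completion: "cstar_tring (tring_completion E \<gamma>) (completion_norm \<gamma>)"
proof (intro cstar_tring.intro star_tring.intro C_module star_tring_axioms.intro cstar_tring_axioms.intro C_norm C_complete)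
  let ?C = "tring_completion E \<gamma>"
  note sim = C_add_cl C_smult_cl C_closed cl_tprod cauchy_add cauchy_smult cauchy_tprod cauchyD
  note [simp del] = tring_completion_simps
  show "completion_norm \<gamma> \<in> SN ?C"
    unfolding SN_def mem_Collect_eq
  proof (intro conjI ballI)
    show "seminorm_on ?C (completion_norm \<gamma>)" using C_norm by (simp add: norm_on_def)
    fix X assume "X \<in> carrier ?C"
    then obtain s where s: "cauchy_in E \<gamma> s" "X = cl s" by (rule CE)
    show "completion_norm \<gamma> (tprod ?C X X X) = completion_norm \<gamma> X ^ 3"
      using completion_norm_cl[OF cauchy_tprod[OF s(1) s(1) s(1)]] tendsto_power[OF completion_norm_cl[OF s(1)], of 3] s
      by (simp add: sim E_cube LIMSEQ_unique)
    fix Y Z assume "Y \<in> carrier ?C" "Z \<in> carrier ?C"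
    then obtain t u where t: "cauchy_in E \<gamma> t" "Y = cl t" "cauchy_in E \<gamma> u" "Z = cl u" by (metis CE)
    have "completion_norm \<gamma> (cl (\<lambda>n. tprod E (s n) (t n) (u n))) \<le>
        completion_norm \<gamma> (cl s) * completion_norm \<gamma> (cl t) * completion_norm \<gamma> (cl u)"
      by (rule LIMSEQ_le[OF completion_norm_cl tendsto_mult[OF tendsto_mult[OF completion_norm_cl completion_norm_cl] completion_norm_cl]])
        (use s t in \<open>auto simp: sim E_tprod\<close>)
    then show "completion_norm \<gamma> (tprod ?C X Y Z) \<le> completion_norm \<gamma> X * completion_norm \<gamma> Y * completion_norm \<gamma> Z"
      using s t by (simp add: sim)
  qed
  fix X Y Z assume "X \<in> carrier ?C" "Y \<in> carrier ?C" "Z \<in> carrier ?C"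
  then obtain s t u where s: "cauchy_in E \<gamma> s" "X = cl s" "cauchy_in E \<gamma> t" "Y = cl t" "cauchy_in E \<gamma> u" "Z = cl u"
    by (metis CE)
  show "tprod ?C X Y Z \<in> carrier ?C" using s by (simp add: sim)
  show "tprod ?C (c \<odot>\<^bsub>?C\<^esub> X) Y Z = c \<odot>\<^bsub>?C\<^esub> tprod ?C X Y Z"
    "tprod ?C X (c \<odot>\<^bsub>?C\<^esub> Y) Z = cnj c \<odot>\<^bsub>?C\<^esub> tprod ?C X Y Z"
    "tprod ?C X Y (c \<odot>\<^bsub>?C\<^esub> Z) = c \<odot>\<^bsub>?C\<^esub> tprod ?C X Y Z" for c
    using s by (simp_all add: sim tprod_smult1 tprod_smult2 tprod_smult3)
  fix U assume "U \<in> carrier ?C"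
  then obtain v where v: "cauchy_in E \<gamma> v" "U = cl v" by (rule CE)
  show "tprod ?C (X \<oplus>\<^bsub>?C\<^esub> Y) Z U = tprod ?C X Z U \<oplus>\<^bsub>?C\<^esub> tprod ?C Y Z U"
    "tprod ?C X (Y \<oplus>\<^bsub>?C\<^esub> Z) U = tprod ?C X Y U \<oplus>\<^bsub>?C\<^esub> tprod ?C X Z U"
    "tprod ?C X Y (Z \<oplus>\<^bsub>?C\<^esub> U) = tprod ?C X Y Z \<oplus>\<^bsub>?C\<^esub> tprod ?C X Y U"
    using s v by (simp_all add: sim tprod_add1 tprod_add2 tprod_add3)
  fix W assume "W \<in> carrier ?C"
  then obtain w where w: "cauchy_in E \<gamma> w" "W = cl w" by (rule CE)
  show "tprod ?C (tprod ?C X Y Z) U W = tprod ?C X (tprod ?C U Z Y) W"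
    using s v w by (simp add: sim tprod_assoc12)
  show "tprod ?C (tprod ?C X Y Z) U W = tprod ?C X Y (tprod ?C Z U W)"
    using s v w by (simp add: sim tprod_assoc13)
qed

end

section \<open>The left algebra of a C*-tring\<close>

lemma map_space_carrier [simp]: "carrier (map_space F) = carrier F \<rightarrow>\<^sub>E carrier F"
  by (simp add: map_space_def)

lemma map_space_apply [simp]:
  assumes "x \<in> carrier F"
  shows "(f \<oplus>\<^bsub>map_space F\<^esub> g) x = f x \<oplus>\<^bsub>F\<^esub> g x" "(c \<odot>\<^bsub>map_space F\<^esub> f) x = c \<odot>\<^bsub>F\<^esub> f x"
    "\<zero>\<^bsub>map_space F\<^esub> x = \<zero>\<^bsub>F\<^esub>"
  using assms by (simp_all add: map_space_def)

lemma map_space_eqI: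
  assumes "f \<in> carrier F \<rightarrow>\<^sub>E carrier F" "g \<in> carrier F \<rightarrow>\<^sub>E carrier F"
    "\<And>x. x \<in> carrier F \<Longrightarrow> f x = g x"
  shows "f = g"
  using assms by (rule PiE_ext)

lemma left_alg0_simps [simp]:
  "carrier (left_alg0 F \<gamma>) = span_l F"
  "a \<otimes>\<^bsub>left_alg0 F \<gamma>\<^esub> b = compose (carrier F) a b"
  "ring.zero (left_alg0 F \<gamma>) = \<zero>\<^bsub>map_space F\<^esub>"
  "ring.add (left_alg0 F \<gamma>) = ring.add (map_space F)"
  "module.smult (left_alg0 F \<gamma>) = module.smult (map_space F)"
  "star (left_alg0 F \<gamma>) = star_l F"
  "nrm (left_alg0 F \<gamma>) = op_norm F \<gamma>"
  by (simp_all add: left_alg0_def)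

lemma ip_l_apply [simp]: "z \<in> carrier F \<Longrightarrow> ip_l F x y z = tprod F x y z"
  by (simp add: ip_l_def)

context cstar_tring
begin

lemma map_apply [simp]: "f \<in> carrier F \<rightarrow>\<^sub>E carrier F \<Longrightarrow> x \<in> carrier F \<Longrightarrow> f x \<in> carrier F"
  by (rule PiE_mem)

lemma map_closed [simp]:
  "f \<in> carrier F \<rightarrow>\<^sub>E carrier F \<Longrightarrow> g \<in> carrier F \<rightarrow>\<^sub>E carrier F \<Longrightarrow>
    f \<oplus>\<^bsub>map_space F\<^esub> g \<in> carrier F \<rightarrow>\<^sub>E carrier F"
  "f \<in> carrier F \<rightarrow>\<^sub>E carrier F \<Longrightarrow> c \<odot>\<^bsub>map_space F\<^esub> f \<in> carrier F \<rightarrow>\<^sub>E carrier F"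
  "\<zero>\<^bsub>map_space F\<^esub> \<in> carrier F \<rightarrow>\<^sub>E carrier F"
  by (simp_all add: map_space_def restrict_PiE_iff)

lemmas map_eqI = map_space_eqI[where F = F]

lemma map_module: "module complex_field (map_space F)"
proof (rule moduleI[OF cring_complex_field])
  show "abelian_group (map_space F)"
  proof (rule abelian_groupI)
    fix f g assume fg: "f \<in> carrier (map_space F)" "g \<in> carrier (map_space F)"
    show "f \<oplus>\<^bsub>map_space F\<^esub> g \<in> carrier (map_space F)" using fg by simp
    show "f \<oplus>\<^bsub>map_space F\<^esub> g = g \<oplus>\<^bsub>map_space F\<^esub> f"
      by (rule map_eqI) (use fg in \<open>simp_all add: a_comm\<close>)
    fix h assume "h \<in> carrier (map_space F)"
    with fg show "f \<oplus>\<^bsub>map_space F\<^esub> g \<oplus>\<^bsub>map_space F\<^esub> h = f \<oplus>\<^bsub>map_space F\<^esub> (g \<oplus>\<^bsub>map_space F\<^esub> h)"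
      by (intro map_eqI) (simp_all add: a_assoc)
  next
    fix f assume f: "f \<in> carrier (map_space F)"
    show "\<zero>\<^bsub>map_space F\<^esub> \<oplus>\<^bsub>map_space F\<^esub> f = f"
      by (rule map_eqI) (use f in \<open>simp_all\<close>)
    have "(- 1) \<odot>\<^bsub>map_space F\<^esub> f \<oplus>\<^bsub>map_space F\<^esub> f = \<zero>\<^bsub>map_space F\<^esub>"
      by (rule map_eqI) (use f in \<open>simp_all add: smult_minus1 l_neg\<close>)
    then show "\<exists>g\<in>carrier (map_space F). g \<oplus>\<^bsub>map_space F\<^esub> f = \<zero>\<^bsub>map_space F\<^esub>"
      using f by (intro bexI[of _ "(- 1) \<odot>\<^bsub>map_space F\<^esub> f"]) simp_all
  qed simp
  fix a b f assume f: "f \<in> carrier (map_space F)"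
  show "a \<odot>\<^bsub>map_space F\<^esub> f \<in> carrier (map_space F)" using f by simp
  show "(a \<oplus>\<^bsub>complex_field\<^esub> b) \<odot>\<^bsub>map_space F\<^esub> f = a \<odot>\<^bsub>map_space F\<^esub> f \<oplus>\<^bsub>map_space F\<^esub> b \<odot>\<^bsub>map_space F\<^esub> f"
    by (rule map_eqI) (use f in \<open>simp_all add: smult_plus\<close>)
  show "a \<otimes>\<^bsub>complex_field\<^esub> b \<odot>\<^bsub>map_space F\<^esub> f = a \<odot>\<^bsub>map_space F\<^esub> (b \<odot>\<^bsub>map_space F\<^esub> f)"
    by (rule map_eqI) (use f in \<open>simp_all add: smult_smult\<close>)
  show "\<one>\<^bsub>complex_field\<^esub> \<odot>\<^bsub>map_space F\<^esub> f = f"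
    by (rule map_eqI) (use f in \<open>simp_all\<close>)
  fix g assume "g \<in> carrier (map_space F)"
  with f show "a \<odot>\<^bsub>map_space F\<^esub> (f \<oplus>\<^bsub>map_space F\<^esub> g) = a \<odot>\<^bsub>map_space F\<^esub> f \<oplus>\<^bsub>map_space F\<^esub> a \<odot>\<^bsub>map_space F\<^esub> g"
    by (intro map_eqI) (simp_all add: smult_add)
qed

sublocale M: complex_module "map_space F"
  by (intro complex_module.intro map_module)

lemma ip_l_map: "x \<in> carrier F \<Longrightarrow> y \<in> carrier F \<Longrightarrow> ip_l F x y \<in> carrier F \<rightarrow>\<^sub>E carrier F"
  by (auto simp: ip_l_def tprod_closed)

section \<open>The span of the left inner products\<close>

lemma gens_l: "{ip_l F x y | x y. x \<in> carrier F \<and> y \<in> carrier F} \<subseteq> carrier (map_space F)"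
  unfolding map_space_carrier using ip_l_map by blast

lemma span_l_submodule: "submodule (span_l F) complex_field (map_space F)"
  unfolding span_l_def by (rule M.lin_span_submodule[OF gens_l])

lemma span_l_closed:
  "a \<in> span_l F \<Longrightarrow> b \<in> span_l F \<Longrightarrow> a \<oplus>\<^bsub>map_space F\<^esub> b \<in> span_l F"
  "a \<in> span_l F \<Longrightarrow> c \<odot>\<^bsub>map_space F\<^esub> a \<in> span_l F"
  "\<zero>\<^bsub>map_space F\<^esub> \<in> span_l F"
  using subgroup.m_closed[OF submodule.axioms(1)[OF span_l_submodule]]
    subgroup.one_closed[OF submodule.axioms(1)[OF span_l_submodule]]
    submodule.smult_closed[OF span_l_submodule] by simp_all

lemma ip_l_span [simp]: "x \<in> carrier F \<Longrightarrow> y \<in> carrier F \<Longrightarrow> ip_l F x y \<in> span_l F"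
  using M.lin_span_base[of "{ip_l F x y | x y. x \<in> carrier F \<and> y \<in> carrier F}"]
  unfolding span_l_def by blast

lemma span_l_map: "a \<in> span_l F \<Longrightarrow> a \<in> carrier F \<rightarrow>\<^sub>E carrier F"
  using M.lin_span_submodule[OF gens_l] subgroup.subset[OF submodule.axioms(1)[OF span_l_submodule]] by auto

lemma span_l_apply [simp]: "a \<in> span_l F \<Longrightarrow> x \<in> carrier F \<Longrightarrow> a x \<in> carrier F"
  using span_l_map by (blast dest: PiE_mem)

text \<open>Membership in the span is carried along with \<open>P\<close>, so that the closure cases
  may use linearity and boundedness of the operators.\<close>

lemma span_l_induct [consumes 1, case_names ip zero add smult]:
  assumes "a \<in> span_l F" "\<And>x y. x \<in> carrier F \<Longrightarrow> y \<in> carrier F \<Longrightarrow> P (ip_l F x y)"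
    "P \<zero>\<^bsub>map_space F\<^esub>"
    "\<And>a b. a \<in> span_l F \<Longrightarrow> b \<in> span_l F \<Longrightarrow> P a \<Longrightarrow> P b \<Longrightarrow> P (a \<oplus>\<^bsub>map_space F\<^esub> b)"
    "\<And>c a. a \<in> span_l F \<Longrightarrow> P a \<Longrightarrow> P (c \<odot>\<^bsub>map_space F\<^esub> a)"
  shows "P a"
proof -
  have "a \<in> span_l F \<and> P a"
    by (rule M.lin_span_induct[where P = "\<lambda>a. a \<in> span_l F \<and> P a", OF assms(1)[unfolded span_l_def] gens_l])
       (use assms(2-5) span_l_closed in auto)
  then show ?thesis by simp
qed

lemma span_l_linear:
  assumes "a \<in> span_l F"
  shows "\<forall>x\<in>carrier F. \<forall>y\<in>carrier F. a (x \<oplus> y) = a x \<oplus> a y"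
    and "\<forall>c. \<forall>x\<in>carrier F. a (c \<odot> x) = c \<odot> a x"
  using assms
  by (induction rule: span_l_induct)
     (auto simp: tprod_add3 tprod_smult3 a_ac smult_add smult_smult mult.commute)

lemma span_l_add: "a \<in> span_l F \<Longrightarrow> x \<in> carrier F \<Longrightarrow> y \<in> carrier F \<Longrightarrow> a (x \<oplus> y) = a x \<oplus> a y"
  and span_l_smult: "a \<in> span_l F \<Longrightarrow> x \<in> carrier F \<Longrightarrow> a (c \<odot> x) = c \<odot> a x"
  using span_l_linear by blast+

lemma span_l_zero: "a \<in> span_l F \<Longrightarrow> a \<zero> = \<zero>"
  using span_l_smult[of a \<zero> 0] by simp

lemma span_l_diff: "a \<in> span_l F \<Longrightarrow> x \<in> carrier F \<Longrightarrow> y \<in> carrier F \<Longrightarrow> a (x \<ominus> y) = a x \<ominus> a y"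
  by (simp add: minus_smult span_l_add span_l_smult)

lemma span_l_bounded: "a \<in> span_l F \<Longrightarrow> \<exists>K\<ge>0. \<forall>x\<in>carrier F. \<gamma> (a x) \<le> K * \<gamma> x"
proof (induction rule: span_l_induct)
  case (ip x y)
  then show ?case by (intro exI[of _ "\<gamma> x * \<gamma> y"]) (simp add: g_tprod)
next
  case zero then show ?case by (intro exI[of _ 0]) simp
next
  case (add a b)
  then obtain K L where K: "K \<ge> 0" "\<forall>x\<in>carrier F. \<gamma> (a x) \<le> K * \<gamma> x"
    and L: "L \<ge> 0" "\<forall>x\<in>carrier F. \<gamma> (b x) \<le> L * \<gamma> x" by blast
  have "\<gamma> ((a \<oplus>\<^bsub>map_space F\<^esub> b) x) \<le> (K + L) * \<gamma> x" if x: "x \<in> carrier F" for x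
    using p_add[of "a x" "b x"] bspec[OF K(2) x] bspec[OF L(2) x] add(1,2) x by (simp add: distrib_right)
  then show ?case using K(1) L(1) by (intro exI[of _ "K + L"]) simp
next
  case (smult c a)
  then obtain K where "K \<ge> 0" "\<forall>x\<in>carrier F. \<gamma> (a x) \<le> K * \<gamma> x" by blast
  then show ?case using smult(1)
    by (intro exI[of _ "cmod c * K"]) (simp add: p_smult mult.assoc mult_left_mono)
qed

lemma span_l_tprod:
  assumes "a \<in> span_l F"
  shows "\<forall>x\<in>carrier F. \<forall>y\<in>carrier F. \<forall>z\<in>carrier F. tprod F (a x) y z = a (tprod F x y z)"
  using assms
  by (induction rule: span_l_induct)
     (auto simp: tprod_closed tprod_assoc13 tprod_add1 tprod_smult1)

lemma tprod_span1: "a \<in> span_l F \<Longrightarrow> x \<in> carrier F \<Longrightarrow> y \<in> carrier F \<Longrightarrow> z \<in> carrier F \<Longrightarrow>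
    tprod F (a x) y z = a (tprod F x y z)"
  using span_l_tprod by blast

lemma span_l_sg: 
  assumes "a \<in> span_l F" shows "\<forall>x\<in>carrier F. a (sg x) = sg (a x)"
  using assms by (induction rule: span_l_induct)
    (auto simp: tprod_sg sg_add sg_smult tprod_closed sg_smult[of \<zero> 0, simplified])

text \<open>Adjointness through the ternary product. It determines \<open>b\<close> from
  \<open>a\<close> as an operator, whereas a rule for generators would have to be shown independent
  of the way in which \<open>a\<close> is written as a combination of them.\<close>

definition adjrel :: "('a \<Rightarrow> 'a) \<Rightarrow> ('a \<Rightarrow> 'a) \<Rightarrow> bool"
  where "adjrel a b \<longleftrightarrow> (\<forall>x\<in>carrier F. \<forall>y\<in>carrier F. \<forall>z\<in>carrier F. tprod F x (a y) z = tprod F x y (b z))"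

lemma tprod_cancel3:
  assumes "b \<in> carrier F" "b' \<in> carrier F"
    "\<And>x y. x \<in> carrier F \<Longrightarrow> y \<in> carrier F \<Longrightarrow> tprod F x y b = tprod F x y b'"
  shows "b = b'"
proof -
  have "tprod F (b \<ominus> b') (b \<ominus> b') (b \<ominus> b') = \<zero>"
    using assms by (simp add: tprod_diff(3) tprod_closed)
  moreover have "b \<ominus> b' \<in> carrier F" using assms(1,2) by simp
  ultimately have "b \<ominus> b' = \<zero>" using cube_eq_0 by blast
  then show ?thesis using assms(1,2) diff_eq_zero by blast
qed

lemma adjrel_unique:
  assumes "adjrel a b" "adjrel a b'" "b \<in> span_l F" "b' \<in> span_l F"
  shows "b = b'"
proof (rule map_eqI)
  fix z assume z: "z \<in> carrier F"
  show "b z = b' z"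
    by (rule tprod_cancel3) (use assms z in \<open>auto simp: adjrel_def\<close>)
qed (use assms span_l_map in auto)

lemma adjrel_ip: "x \<in> carrier F \<Longrightarrow> y \<in> carrier F \<Longrightarrow> adjrel (ip_l F x y) (ip_l F y x)"
  unfolding adjrel_def by (auto simp: tprod_closed tprod_assoc)

lemma adjrel_zero: "adjrel \<zero>\<^bsub>map_space F\<^esub> \<zero>\<^bsub>map_space F\<^esub>"
  unfolding adjrel_def by auto

lemma adjrel_add: "\<lbrakk>a \<in> span_l F; b \<in> span_l F; a' \<in> span_l F; b' \<in> span_l F; adjrel a b; adjrel a' b'\<rbrakk> \<Longrightarrow>
    adjrel (a \<oplus>\<^bsub>map_space F\<^esub> a') (b \<oplus>\<^bsub>map_space F\<^esub> b')"
  unfolding adjrel_def by (auto simp: tprod_add2 tprod_add3)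

lemma adjrel_smult: "\<lbrakk>a \<in> span_l F; b \<in> span_l F; adjrel a b\<rbrakk> \<Longrightarrow>
    adjrel (c \<odot>\<^bsub>map_space F\<^esub> a) (cnj c \<odot>\<^bsub>map_space F\<^esub> b)"
  unfolding adjrel_def by (auto simp: tprod_smult2 tprod_smult3)

lemma adjrel_exists: "a \<in> span_l F \<Longrightarrow> \<exists>b\<in>span_l F. adjrel a b"
proof (induction rule: span_l_induct)
  case (ip x y) then show ?case by (intro bexI[of _ "ip_l F y x"] adjrel_ip) simp_all
next
  case zero show ?case by (intro bexI[of _ "\<zero>\<^bsub>map_space F\<^esub>"] adjrel_zero span_l_closed)
next
  case (add a b)
  then obtain a' b' where "a' \<in> span_l F" "adjrel a a'" "b' \<in> span_l F" "adjrel b b'" by blast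
  with add show ?case using adjrel_add[of a a' b b'] span_l_closed(1)[of a' b'] by blast
next
  case (smult c a)
  then obtain a' where "a' \<in> span_l F" "adjrel a a'" by blast
  with smult show ?case using adjrel_smult[of a a' c] span_l_closed(2)[of a' "cnj c"] by blast
qed

text \<open>The choice in \<open>star_l\<close> prescribes values on generators, which may be
  linearly dependent; that such a map exists at all is seen from \<open>adjrel\<close>.\<close>

lemma star_l_spec: "conj_linear_on (map_space F) (span_l F) (star_l F) \<and>
    (\<forall>x\<in>carrier F. \<forall>y\<in>carrier F. star_l F (ip_l F x y) = ip_l F y x)"
  unfolding star_l_def
proof (rule someI_ex[of "\<lambda>f. conj_linear_on (map_space F) (span_l F) f \<and>
    (\<forall>x\<in>carrier F. \<forall>y\<in>carrier F. f (ip_l F x y) = ip_l F y x)"])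
  define f where "f a = (SOME b. b \<in> span_l F \<and> adjrel a b)" for a
  have f: "f a \<in> span_l F" "adjrel a (f a)" if "a \<in> span_l F" for a
    using someI_ex[of "\<lambda>b. b \<in> span_l F \<and> adjrel a b"] adjrel_exists[OF that] unfolding f_def by blast+
  have "conj_linear_on (map_space F) (span_l F) f"
    unfolding conj_linear_on_def
  proof (intro conjI ballI allI)
    fix a b assume "a \<in> span_l F" "b \<in> span_l F"
    then show "f (a \<oplus>\<^bsub>map_space F\<^esub> b) = f a \<oplus>\<^bsub>map_space F\<^esub> f b"
      by (intro adjrel_unique[OF f(2) adjrel_add]) (simp_all add: f span_l_closed)
  next
    fix c a assume "a \<in> span_l F"
    then show "f (c \<odot>\<^bsub>map_space F\<^esub> a) = cnj c \<odot>\<^bsub>map_space F\<^esub> f a"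
      by (intro adjrel_unique[OF f(2) adjrel_smult]) (simp_all add: f span_l_closed)
  qed (rule f)
  moreover have "f (ip_l F x y) = ip_l F y x" if "x \<in> carrier F" "y \<in> carrier F" for x y
    using that by (intro adjrel_unique[OF f(2) adjrel_ip]) (simp_all add: f)
  ultimately show "\<exists>f. conj_linear_on (map_space F) (span_l F) f \<and>
    (\<forall>x\<in>carrier F. \<forall>y\<in>carrier F. f (ip_l F x y) = ip_l F y x)" by blast
qed

lemma star_l_ip [simp]: "x \<in> carrier F \<Longrightarrow> y \<in> carrier F \<Longrightarrow> star_l F (ip_l F x y) = ip_l F y x"
  and star_l_closed [simp]: "a \<in> span_l F \<Longrightarrow> star_l F a \<in> span_l F"
  and star_l_add: "a \<in> span_l F \<Longrightarrow> b \<in> span_l F \<Longrightarrow>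
    star_l F (a \<oplus>\<^bsub>map_space F\<^esub> b) = star_l F a \<oplus>\<^bsub>map_space F\<^esub> star_l F b"
  and star_l_smult: "a \<in> span_l F \<Longrightarrow> star_l F (c \<odot>\<^bsub>map_space F\<^esub> a) = cnj c \<odot>\<^bsub>map_space F\<^esub> star_l F a"
  using star_l_spec unfolding conj_linear_on_def by blast+

lemma star_l_zero: "star_l F \<zero>\<^bsub>map_space F\<^esub> = \<zero>\<^bsub>map_space F\<^esub>"
  using star_l_smult[OF span_l_closed(3), of 0] span_l_map[OF star_l_closed[OF span_l_closed(3)]]
    M.smult_0[of "star_l F \<zero>\<^bsub>map_space F\<^esub>"] by simp

text \<open>Conjugate linearity and the values on the generators force the chosen map to be the
  adjoint, whichever choice was made.\<close>

lemma star_l_adjrel: "a \<in> span_l F \<Longrightarrow> adjrel a (star_l F a)"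
  by (induction rule: span_l_induct)
     (simp_all add: adjrel_ip adjrel_zero adjrel_add adjrel_smult star_l_zero star_l_add star_l_smult)

lemma tprod_span2: "a \<in> span_l F \<Longrightarrow> x \<in> carrier F \<Longrightarrow> y \<in> carrier F \<Longrightarrow> z \<in> carrier F \<Longrightarrow>
    tprod F x (a y) z = tprod F x y (star_l F a z)"
  using star_l_adjrel unfolding adjrel_def by blast

lemma star_l_star: "a \<in> span_l F \<Longrightarrow> star_l F (star_l F a) = a"
  by (induction rule: span_l_induct) (simp_all add: star_l_zero star_l_add star_l_smult)

lemma compose_map: "a \<in> carrier F \<rightarrow>\<^sub>E carrier F \<Longrightarrow> b \<in> carrier F \<rightarrow>\<^sub>E carrier F \<Longrightarrow>
    compose (carrier F) a b \<in> carrier F \<rightarrow>\<^sub>E carrier F"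
  by (simp add: compose_def restrict_PiE_iff)

lemma compose_ip: "a \<in> span_l F \<Longrightarrow> x \<in> carrier F \<Longrightarrow> y \<in> carrier F \<Longrightarrow>
    compose (carrier F) a (ip_l F x y) = ip_l F (a x) y"
  by (rule map_eqI) (simp_all add: compose_map compose_eq span_l_map ip_l_map tprod_span1)

text \<open>Induction over the right factor suffices, since \<open>a\<close> composed with
  \<open>ip_l F x y\<close> is again a generator, \<open>ip_l F (a x) y\<close>.\<close>

lemma compose_span [simp]:
  assumes a: "a \<in> span_l F" and b: "b \<in> span_l F"
  shows "compose (carrier F) a b \<in> span_l F"
  using b
proof (induction rule: span_l_induct)
  case (ip x y) then show ?case using a by (simp add: compose_ip)
next
  case zero
  have "compose (carrier F) a \<zero>\<^bsub>map_space F\<^esub> = \<zero>\<^bsub>map_space F\<^esub>"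
    by (rule map_eqI) (use a in \<open>simp_all add: compose_map compose_eq span_l_map span_l_zero\<close>)
  then show ?case by (simp add: span_l_closed)
next
  case (add b c)
  have "compose (carrier F) a (b \<oplus>\<^bsub>map_space F\<^esub> c) = compose (carrier F) a b \<oplus>\<^bsub>map_space F\<^esub> compose (carrier F) a c"
    by (rule map_eqI) (use a add in \<open>simp_all add: compose_map compose_eq span_l_map span_l_add\<close>)
  then show ?case using add by (simp add: span_l_closed)
next
  case (smult c b)
  have "compose (carrier F) a (c \<odot>\<^bsub>map_space F\<^esub> b) = c \<odot>\<^bsub>map_space F\<^esub> compose (carrier F) a b"
    by (rule map_eqI) (use a smult in \<open>simp_all add: compose_map compose_eq span_l_map span_l_smult\<close>)
  then show ?case using smult by (simp add: span_l_closed)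
qed

section \<open>The operator norm\<close>

lemma op_norm_upper:
  assumes a: "a \<in> span_l F" and x: "x \<in> carrier F"
  shows "\<gamma> (a x) \<le> op_norm F \<gamma> a * \<gamma> x"
proof (cases "\<gamma> x = 0")
  case True
  then have "x = \<zero>" using x by (rule g_eq_0[rotated])
  then show ?thesis using a by (simp add: span_l_zero)
next
  case False
  then have pos: "\<gamma> x > 0" using x by (auto simp: order_less_le)
  obtain K where K: "K \<ge> 0" "\<forall>x\<in>carrier F. \<gamma> (a x) \<le> K * \<gamma> x" using span_l_bounded[OF a] by blast
  have "\<gamma> (a y) \<le> K" if "y \<in> carrier F" "\<gamma> y \<le> 1" for y
    using K that by (meson mult_left_le order_trans)
  then have b: "bdd_above {\<gamma> (a x) | x. x \<in> carrier F \<and> \<gamma> x \<le> 1}" by (auto intro!: bdd_aboveI)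
  let ?y = "complex_of_real (1 / \<gamma> x) \<odot> x"
  have "\<gamma> ?y \<le> 1" using x pos by (simp add: p_smult norm_divide)
  then have "\<gamma> (a ?y) \<le> op_norm F \<gamma> a"
    unfolding op_norm_def by (intro cSup_upper[OF _ b]) (use x in auto)
  moreover have "\<gamma> (a ?y) = \<gamma> (a x) / \<gamma> x"
    using a x pos by (simp add: span_l_smult p_smult norm_divide)
  ultimately show ?thesis using pos by (simp add: pos_divide_le_eq)
qed

lemma op_norm_le:
  assumes "K \<ge> 0" "\<And>x. x \<in> carrier F \<Longrightarrow> \<gamma> (a x) \<le> K * \<gamma> x"
  shows "op_norm F \<gamma> a \<le> K"
  unfolding op_norm_def
proof (rule cSup_least)
  show "{\<gamma> (a x) | x. x \<in> carrier F \<and> \<gamma> x \<le> 1} \<noteq> {}"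
    by (auto intro: exI[of _ \<zero>])
  fix r assume "r \<in> {\<gamma> (a x) | x. x \<in> carrier F \<and> \<gamma> x \<le> 1}"
  then show "r \<le> K" using assms by (auto intro: order_trans[OF _ mult_left_le])
qed

lemma op_norm_nonneg [simp]: "a \<in> span_l F \<Longrightarrow> 0 \<le> op_norm F \<gamma> a"
proof -
  assume a: "a \<in> span_l F"
  obtain K where K: "K \<ge> 0" "\<forall>x\<in>carrier F. \<gamma> (a x) \<le> K * \<gamma> x" using span_l_bounded[OF a] by blast
  have "\<gamma> (a y) \<le> K" if "y \<in> carrier F" "\<gamma> y \<le> 1" for y
    using K that by (meson mult_left_le order_trans)
  then have b: "bdd_above {\<gamma> (a x) | x. x \<in> carrier F \<and> \<gamma> x \<le> 1}" by (auto intro!: bdd_aboveI)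
  have "\<gamma> (a \<zero>) \<le> op_norm F \<gamma> a"
    unfolding op_norm_def by (rule cSup_upper[OF _ b]) (auto intro: exI[of _ \<zero>])
  then show ?thesis using a by (simp add: span_l_zero)
qed

text \<open>As for multipliers, the cube replaces a scalar product:
  \<open>(a x, a x, a x) = a (x, x, b x)\<close> with \<open>b\<close> the product of the adjoint of
  \<open>a\<close> with \<open>a\<close>. This gives \<open>N ^ 3 <= M * N\<close> for the norms
  \<open>N\<close> of \<open>a\<close> and \<open>M\<close> of \<open>b\<close>.\<close>

lemma op_norm_cstar:
  assumes a: "a \<in> span_l F"
  shows "(op_norm F \<gamma> a)\<^sup>2 \<le> op_norm F \<gamma> (compose (carrier F) (star_l F a) a)"
proof (cases "op_norm F \<gamma> a = 0")
  case False
  let ?b = "compose (carrier F) (star_l F a) a"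
  let ?N = "op_norm F \<gamma> a" and ?M = "op_norm F \<gamma> ?b"
  have b: "?b \<in> span_l F" using a by simp
  have N: "?N > 0" using False a by (simp add: order_less_le)
  have "\<gamma> (a x) ^ 3 \<le> (?M * ?N) * \<gamma> x ^ 3" if x: "x \<in> carrier F" for x
  proof -
    have "tprod F (a x) (a x) (a x) = a (tprod F x x (?b x))"
      using a x by (simp add: tprod_span1 tprod_span2 compose_def)
    then have "\<gamma> (a x) ^ 3 = \<gamma> (a (tprod F x x (?b x)))" using g_cube[of "a x"] a x by simp
    also have "\<dots> \<le> ?N * \<gamma> (tprod F x x (?b x))"
      using a x b by (intro op_norm_upper) (simp_all add: tprod_closed)
    also have "\<dots> \<le> ?N * (\<gamma> x * \<gamma> x * (?M * \<gamma> x))"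
      by (intro mult_left_mono order_trans[OF g_tprod] op_norm_upper mult_nonneg_nonneg)
         (use a b x in simp_all)
    finally show ?thesis by (simp add: power3_eq_cube mult_ac)
  qed
  then have "root 3 (\<gamma> (a x) ^ 3) \<le> root 3 ((?M * ?N) * \<gamma> x ^ 3)" if "x \<in> carrier F" for x
    using that by simp
  then have "\<gamma> (a x) \<le> root 3 (?M * ?N) * \<gamma> x" if "x \<in> carrier F" for x
    using that by (simp add: real_root_mult odd_real_root_power_cancel)
  then have "?N \<le> root 3 (?M * ?N)" by (intro op_norm_le) (use a b in auto)
  then have "?N ^ 3 \<le> root 3 (?M * ?N) ^ 3" using N by (intro power_mono) auto
  then have "?N ^ 3 \<le> ?M * ?N" by (simp add: odd_real_root_pow)
  then show ?thesis using N by (simp add: power3_eq_cube power2_eq_square)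
qed (use a in simp)

lemma op_norm_compose:
  assumes "a \<in> span_l F" "b \<in> span_l F"
  shows "op_norm F \<gamma> (compose (carrier F) a b) \<le> op_norm F \<gamma> a * op_norm F \<gamma> b"
proof (rule op_norm_le)
  fix x assume x: "x \<in> carrier F"
  have "\<gamma> (a (b x)) \<le> op_norm F \<gamma> a * \<gamma> (b x)" using assms x by (simp add: op_norm_upper)
  also have "\<dots> \<le> op_norm F \<gamma> a * (op_norm F \<gamma> b * \<gamma> x)"
    using assms x by (intro mult_left_mono op_norm_upper) simp_all
  finally show "\<gamma> (compose (carrier F) a b x) \<le> op_norm F \<gamma> a * op_norm F \<gamma> b * \<gamma> x"
    using x by (simp add: compose_def mult.assoc)
qed (use assms in simp)

lemma op_norm_norm: "norm_on (left_alg0 F \<gamma>) (op_norm F \<gamma>)"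
  unfolding norm_on_def seminorm_on_def left_alg0_simps
proof (intro conjI ballI allI impI)
  fix a assume a: "a \<in> span_l F"
  show "0 \<le> op_norm F \<gamma> a" using a by simp
  have le: "op_norm F \<gamma> (c \<odot>\<^bsub>map_space F\<^esub> a) \<le> cmod c * op_norm F \<gamma> a" if "a \<in> span_l F" for a c
    using that op_norm_upper[OF that]
    by (intro op_norm_le) (auto simp: p_smult mult.assoc mult_left_mono)
  show "op_norm F \<gamma> (c \<odot>\<^bsub>map_space F\<^esub> a) = cmod c * op_norm F \<gamma> a" for c
  proof (rule antisym[OF le[OF a]])
    show "cmod c * op_norm F \<gamma> a \<le> op_norm F \<gamma> (c \<odot>\<^bsub>map_space F\<^esub> a)"
    proof (cases "c = 0")
      case False
      have "inverse c \<odot>\<^bsub>map_space F\<^esub> (c \<odot>\<^bsub>map_space F\<^esub> a) = a"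
        using False span_l_map[OF a] by (simp add: M.smult_smult)
      then have "op_norm F \<gamma> a \<le> inverse (cmod c) * op_norm F \<gamma> (c \<odot>\<^bsub>map_space F\<^esub> a)"
        using le[OF span_l_closed(2)[OF a], of "inverse c" c] by (simp add: norm_inverse)
      from mult_left_mono[OF this, of "cmod c"] show ?thesis using False by (simp flip: mult.assoc)
    qed (use a span_l_closed in simp)
  qed
  show "a = \<zero>\<^bsub>map_space F\<^esub>" if "op_norm F \<gamma> a = 0"
  proof (rule map_eqI)
    fix x assume x: "x \<in> carrier F"
    have "\<gamma> (a x) = 0" using op_norm_upper[OF a x] that a x by (auto intro: antisym)
    then show "a x = \<zero>\<^bsub>map_space F\<^esub> x" using a x by (simp add: g_eq_0)
  qed (use a span_l_map in auto)
  fix b assume b: "b \<in> span_l F"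
  show "op_norm F \<gamma> (a \<oplus>\<^bsub>map_space F\<^esub> b) \<le> op_norm F \<gamma> a + op_norm F \<gamma> b"
  proof (rule op_norm_le)
    fix x assume x: "x \<in> carrier F"
    show "\<gamma> ((a \<oplus>\<^bsub>map_space F\<^esub> b) x) \<le> (op_norm F \<gamma> a + op_norm F \<gamma> b) * \<gamma> x"
      using p_add[of "a x" "b x"] op_norm_upper[OF a x] op_norm_upper[OF b x] a b x
      by (simp add: distrib_right)
  qed (use a b in simp)
qed

lemma left_alg0_pre_cstar: "pre_cstar (left_alg0 F \<gamma>)"
proof (intro pre_cstar.intro complex_module.intro pre_cstar_axioms.intro)
  let ?A = "left_alg0 F \<gamma>"
  show "module complex_field ?A"
  proof -
    \<comment> \<open>This record has the linear part of \<open>left_alg0\<close>, so its module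
      laws carry over.\<close>
    have "module complex_field ((map_space F)\<lparr>carrier := span_l F\<rparr>)"
      by (rule submodule.submodule_is_module[OF span_l_submodule map_module])
    then interpret S: complex_module "(map_space F)\<lparr>carrier := span_l F\<rparr>" by (rule complex_module.intro)
    show ?thesis by (rule S.module_cong) simp_all
  qed
  fix a assume "a \<in> carrier ?A" then have a: "a \<in> span_l F" by simp
  show "star ?A a \<in> carrier ?A" using a by simp
  show "star ?A (k \<odot>\<^bsub>?A\<^esub> a) = cnj k \<odot>\<^bsub>?A\<^esub> star ?A a" for k using a by (simp add: star_l_smult)
  show "star ?A (star ?A a) = a" using a by (simp add: star_l_star)
  have cs: "op_norm F \<gamma> b \<le> op_norm F \<gamma> (star_l F b)" if "b \<in> span_l F" for b
  proof (cases "op_norm F \<gamma> b = 0")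
    case False
    then have "op_norm F \<gamma> b > 0" using that by (simp add: order_less_le)
    moreover have "op_norm F \<gamma> b * op_norm F \<gamma> b \<le> op_norm F \<gamma> (star_l F b) * op_norm F \<gamma> b"
      using op_norm_cstar[OF that] op_norm_compose[of "star_l F b" b] that by (simp add: power2_eq_square)
    ultimately show ?thesis by simp
  qed (use that in simp)
  have "op_norm F \<gamma> (star_l F a) = op_norm F \<gamma> a"
    using cs[OF a] cs[OF star_l_closed[OF a]] a by (simp add: star_l_star)
  then show "nrm ?A (star ?A a \<otimes>\<^bsub>?A\<^esub> a) = (nrm ?A a)\<^sup>2"
    using op_norm_cstar[OF a] op_norm_compose[of "star_l F a" a] a by (simp add: power2_eq_square)
  fix b assume "b \<in> carrier ?A" then have b: "b \<in> span_l F" by simp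
  show "a \<otimes>\<^bsub>?A\<^esub> b \<in> carrier ?A" using a b by simp
  show "(k \<odot>\<^bsub>?A\<^esub> a) \<otimes>\<^bsub>?A\<^esub> b = k \<odot>\<^bsub>?A\<^esub> (a \<otimes>\<^bsub>?A\<^esub> b)" "a \<otimes>\<^bsub>?A\<^esub> (k \<odot>\<^bsub>?A\<^esub> b) = k \<odot>\<^bsub>?A\<^esub> (a \<otimes>\<^bsub>?A\<^esub> b)" for k
    unfolding left_alg0_simps
    by (rule map_eqI; use a b in \<open>simp_all add: compose_map compose_eq span_l_map span_l_smult\<close>)+
  show "star ?A (a \<oplus>\<^bsub>?A\<^esub> b) = star ?A a \<oplus>\<^bsub>?A\<^esub> star ?A b" using a b by (simp add: star_l_add)
  show "star ?A (a \<otimes>\<^bsub>?A\<^esub> b) = star ?A b \<otimes>\<^bsub>?A\<^esub> star ?A a"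
    unfolding left_alg0_simps
    by (rule adjrel_unique[OF star_l_adjrel])
       (use a b in \<open>simp_all add: adjrel_def compose_eq tprod_span2\<close>)
  show "nrm ?A (a \<otimes>\<^bsub>?A\<^esub> b) \<le> nrm ?A a * nrm ?A b" using a b by (simp add: op_norm_compose)
  fix c assume "c \<in> carrier ?A" then have c: "c \<in> span_l F" by simp
  show "(a \<otimes>\<^bsub>?A\<^esub> b) \<otimes>\<^bsub>?A\<^esub> c = a \<otimes>\<^bsub>?A\<^esub> (b \<otimes>\<^bsub>?A\<^esub> c)"
    unfolding left_alg0_simps
    by (rule map_eqI) (use a b c in \<open>simp_all add: compose_map compose_eq span_l_map\<close>)
  show "(a \<oplus>\<^bsub>?A\<^esub> b) \<otimes>\<^bsub>?A\<^esub> c = (a \<otimes>\<^bsub>?A\<^esub> c) \<oplus>\<^bsub>?A\<^esub> (b \<otimes>\<^bsub>?A\<^esub> c)"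
    unfolding left_alg0_simps
    by (rule map_eqI) (use a b c in \<open>simp_all add: compose_map compose_eq span_l_map\<close>)
  show "a \<otimes>\<^bsub>?A\<^esub> (b \<oplus>\<^bsub>?A\<^esub> c) = (a \<otimes>\<^bsub>?A\<^esub> b) \<oplus>\<^bsub>?A\<^esub> (a \<otimes>\<^bsub>?A\<^esub> c)"
    unfolding left_alg0_simps
    by (rule map_eqI) (use a b c in \<open>simp_all add: compose_map compose_eq span_l_map span_l_add\<close>)
qed (simp add: op_norm_norm)

end

section \<open>The left Hilbert module\<close>

declare left_alg0_simps [simp del] alg_completion_simps [simp del]

sublocale cstar_tring \<subseteq> L: pre_cstar "left_alg0 F \<gamma>"
  by (rule left_alg0_pre_cstar)

text \<open>\<open>F\<close> without its product, since a bimodule is sought among plain module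
  records.\<close>

definition carrier_module :: "('a, 'm) tring_scheme \<Rightarrow> (complex, 'a) module"
  where "carrier_module F = \<lparr>carrier = carrier F, monoid.mult = undefined, monoid.one = undefined,
    ring.zero = \<zero>\<^bsub>F\<^esub>, ring.add = ring.add F, module.smult = module.smult F\<rparr>"

lemma carrier_module_simps [simp]:
  "carrier (carrier_module F) = carrier F" "ring.zero (carrier_module F) = \<zero>\<^bsub>F\<^esub>"
  "ring.add (carrier_module F) = ring.add F" "module.smult (carrier_module F) = module.smult F"
  "a_minus (carrier_module F) = a_minus F"
  by (simp_all add: carrier_module_def) (intro a_minus_cong; simp)

context cstar_tring
begin

section \<open>The action of the completed left algebra\<close>

abbreviation "A0 \<equiv> left_alg0 F \<gamma>"
abbreviation "AL \<equiv> alg_completion (left_alg0 F \<gamma>)"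
abbreviation "lcauchy s \<equiv> cauchy_in (left_alg0 F \<gamma>) (nrm (left_alg0 F \<gamma>)) s"

lemma A0_carrier: "carrier A0 = span_l F" by (simp add: left_alg0_simps)

lemma lcauchy_span [simp]: "lcauchy s \<Longrightarrow> s n \<in> span_l F"
  using L.cauchyD[of s n] by (simp add: A0_carrier)

lemma op_act: "a \<in> span_l F \<Longrightarrow> x \<in> carrier F \<Longrightarrow> \<gamma> (a x) \<le> nrm A0 a * \<gamma> x"
  using op_norm_upper by (simp add: left_alg0_simps)

lemma nrm_A0_le: "K \<ge> 0 \<Longrightarrow> (\<And>x. x \<in> carrier F \<Longrightarrow> \<gamma> (a x) \<le> K * \<gamma> x) \<Longrightarrow> nrm A0 a \<le> K"
  using op_norm_le by (simp add: left_alg0_simps)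

lemma diff_span [simp]: "a \<in> span_l F \<Longrightarrow> b \<in> span_l F \<Longrightarrow> a \<ominus>\<^bsub>A0\<^esub> b \<in> span_l F"
  using L.minus_closed[of a b] by (simp add: A0_carrier)

lemma diff_act: "a \<in> span_l F \<Longrightarrow> b \<in> span_l F \<Longrightarrow> x \<in> carrier F \<Longrightarrow> (a \<ominus>\<^bsub>A0\<^esub> b) x = a x \<ominus> b x"
  by (simp add: L.minus_smult A0_carrier minus_smult) (simp add: left_alg0_simps)

definition lact :: "(nat \<Rightarrow> 'a \<Rightarrow> 'a) set \<Rightarrow> 'a \<Rightarrow> 'a"
  where "lact X x = (THE y. lim_to (\<lambda>n. rep X n x) y)"

lemma act_cauchy:
  assumes s: "lcauchy s" and x: "x \<in> carrier F"
  shows "cauchy_in F \<gamma> (\<lambda>n. s n x)"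
proof (rule cauchy_of_bound[where D = "\<lambda>m n. \<gamma> x * nrm A0 (s m \<ominus>\<^bsub>A0\<^esub> s n)"])
  show "\<gamma> (s m x \<ominus> s n x) \<le> \<gamma> x * nrm A0 (s m \<ominus>\<^bsub>A0\<^esub> s n)" for m n
    using op_act[of "s m \<ominus>\<^bsub>A0\<^esub> s n" x] s x by (simp add: diff_act mult.commute)
qed (use s x in \<open>auto intro!: L.cauchy_null_mult\<close>)

text \<open>Frees the action from the representative that \<open>rep\<close> selects: two
  representatives differ by a null sequence in operator norm.\<close>

lemma lact_lim:
  assumes s: "lcauchy s" and x: "x \<in> carrier F"
  shows "lim_to (\<lambda>n. s n x) (lact (L.cl s) x)"
proof -
  let ?r = "rep (L.cl s)"
  note r = L.rep_cl[OF s]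
  obtain y where y: "lim_to (\<lambda>n. ?r n x) y" using ex_lim[OF act_cauchy[OF r(1) x]] by blast
  then have "lact (L.cl s) x = y"
    unfolding lact_def by (rule the_equality) (rule lim_unique[OF _ y])
  moreover have "lim_to (\<lambda>n. s n x) y"
  proof (rule lim_toI)
    show "s n x \<in> carrier F" "y \<in> carrier F" for n using s x lim_to_closed(2)[OF y] by simp_all
    show "\<gamma> (s n x \<ominus> y) \<le> nrm A0 (s n \<ominus>\<^bsub>A0\<^esub> ?r n) * \<gamma> x + \<gamma> (?r n x \<ominus> y)" for n
      using p_triangle[of "s n x" "?r n x" y] op_act[of "s n \<ominus>\<^bsub>A0\<^esub> ?r n" x] s r(1) x lim_to_closed(2)[OF y]
      by (simp add: diff_act)
    show "(\<lambda>n. nrm A0 (s n \<ominus>\<^bsub>A0\<^esub> ?r n) * \<gamma> x + \<gamma> (?r n x \<ominus> y)) \<longlonglongrightarrow> 0"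
      using y by (intro tendsto_add_zero tendsto_mult_left_zero r(2)) (simp add: lim_to_def)
  qed
  ultimately show ?thesis by simp
qed

text \<open>Cauchy sequences of operators are bounded, so operator and argument may vary together.
  This is what iterated actions need.\<close>

lemma lact_lim2:
  assumes s: "lcauchy s" and f: "lim_to f y"
  shows "lim_to (\<lambda>n. s n (f n)) (lact (L.cl s) y)"
proof -
  have y: "y \<in> carrier F" and fn: "f n \<in> carrier F" for n using lim_to_closed[OF f] by auto
  note l = lact_lim[OF s y]
  obtain M where M: "M \<ge> 0" "\<And>n. nrm A0 (s n) \<le> M" using L.cauchy_bounded[OF s] by metis
  show ?thesis
  proof (rule lim_toI)
    show "s n (f n) \<in> carrier F" "lact (L.cl s) y \<in> carrier F" for n
      using s fn lim_to_closed(2)[OF l] by simp_all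
    show "\<gamma> (s n (f n) \<ominus> lact (L.cl s) y) \<le> M * \<gamma> (f n \<ominus> y) + \<gamma> (s n y \<ominus> lact (L.cl s) y)" for n
    proof -
      have "\<gamma> (s n (f n) \<ominus> s n y) \<le> nrm A0 (s n) * \<gamma> (f n \<ominus> y)"
        using op_act[of "s n" "f n \<ominus> y"] s fn y by (simp add: span_l_diff)
      also have "\<dots> \<le> M * \<gamma> (f n \<ominus> y)" using M fn y by (intro mult_right_mono) simp_all
      finally show ?thesis
        using p_triangle[of "s n (f n)" "s n y" "lact (L.cl s) y"] s fn y lim_to_closed(2)[OF l] by simp
    qed
    show "(\<lambda>n. M * \<gamma> (f n \<ominus> y) + \<gamma> (s n y \<ominus> lact (L.cl s) y)) \<longlonglongrightarrow> 0"
      using f l by (intro tendsto_add_zero tendsto_mult_right_zero) (simp_all add: lim_to_def)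
  qed
qed

lemma lim_to_tprod:
  assumes f: "lim_to f y" and x: "x \<in> carrier F" "z \<in> carrier F"
  shows "lim_to (\<lambda>n. tprod F x z (f n)) (tprod F x z y)" "lim_to (\<lambda>n. tprod F x (f n) z) (tprod F x y z)"
    "lim_to (\<lambda>n. tprod F (f n) x z) (tprod F y x z)"
proof -
  have y [simp]: "y \<in> carrier F" and fn [simp]: "f n \<in> carrier F" for n using lim_to_closed[OF f] by auto
  have l: "(\<lambda>n. (\<gamma> x * \<gamma> z) * \<gamma> (f n \<ominus> y)) \<longlonglongrightarrow> 0"
    using f by (intro tendsto_mult_right_zero) (simp add: lim_to_def)
  show "lim_to (\<lambda>n. tprod F x z (f n)) (tprod F x z y)"
    by (rule lim_toI[OF _ _ _ l]) (use x g_tprod[of x z "f _ \<ominus> y"] in \<open>simp_all add: tprod_closed tprod_diff(3)[symmetric]\<close>)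
  show "lim_to (\<lambda>n. tprod F x (f n) z) (tprod F x y z)"
    by (rule lim_toI[OF _ _ _ l])
      (use x g_tprod[of x "f _ \<ominus> y" z] in \<open>simp_all add: tprod_closed tprod_diff(2)[symmetric] mult_ac\<close>)
  show "lim_to (\<lambda>n. tprod F (f n) x z) (tprod F y x z)"
    by (rule lim_toI[OF _ _ _ l])
      (use x g_tprod[of "f _ \<ominus> y" x z] in \<open>simp_all add: tprod_closed tprod_diff(1)[symmetric] mult_ac\<close>)
qed

lemma lim_to_sg: "lim_to f y \<Longrightarrow> lim_to (\<lambda>n. sg (f n)) (sg y)"
proof -
  assume f: "lim_to f y"
  have y [simp]: "y \<in> carrier F" and fn [simp]: "f n \<in> carrier F" for n using lim_to_closed[OF f] by auto
  have "sg (f n) \<ominus> sg y = sg (f n \<ominus> y)" for n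
    by (simp add: minus_smult sg_add sg_smult)
  then have "\<gamma> (sg (f n) \<ominus> sg y) = \<gamma> (f n \<ominus> y)" for n by (simp add: g_sg)
  then show ?thesis using f by (simp add: lim_to_def)
qed

lemma lact_closed [simp]: "X \<in> carrier AL \<Longrightarrow> x \<in> carrier F \<Longrightarrow> lact X x \<in> carrier F"
  by (metis L.CE lact_lim lim_to_closed(2))

lemma const_lcauchy [simp]: "a \<in> span_l F \<Longrightarrow> lcauchy (\<lambda>_. a)"
  by (rule L.cauchy_const) (simp add: A0_carrier)

lemma lact_const: "a \<in> span_l F \<Longrightarrow> x \<in> carrier F \<Longrightarrow> lact (L.cl (\<lambda>_. a)) x = a x"
  using lact_lim[OF const_lcauchy, of a x] lim_to_const[of "a x"] lim_unique by simp

section \<open>The twisted left inner product\<close>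

definition lip :: "'a \<Rightarrow> 'a \<Rightarrow> (nat \<Rightarrow> 'a \<Rightarrow> 'a) set"
  where "lip x y = completion_class A0 (nrm A0) (\<lambda>_. ip_l F x (sg y))"

lemma nrm_ip_le: "x \<in> carrier F \<Longrightarrow> y \<in> carrier F \<Longrightarrow> nrm A0 (ip_l F x y) \<le> \<gamma> x * \<gamma> y"
  by (rule nrm_A0_le) (simp_all add: g_tprod)

lemma ip_l_linear:
  "x \<in> carrier F \<Longrightarrow> x' \<in> carrier F \<Longrightarrow> y \<in> carrier F \<Longrightarrow> ip_l F (x \<oplus> x') y = ip_l F x y \<oplus>\<^bsub>A0\<^esub> ip_l F x' y"
  "x \<in> carrier F \<Longrightarrow> y \<in> carrier F \<Longrightarrow> ip_l F (c \<odot> x) y = c \<odot>\<^bsub>A0\<^esub> ip_l F x y"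
  unfolding left_alg0_simps
  by (rule map_eqI; simp add: ip_l_map tprod_add1 tprod_smult1)+

lemma ip_l_diff: "x \<in> carrier F \<Longrightarrow> x' \<in> carrier F \<Longrightarrow> y \<in> carrier F \<Longrightarrow>
    ip_l F (x \<ominus> x') y = ip_l F x y \<ominus>\<^bsub>A0\<^esub> ip_l F x' y"
  by (simp add: minus_smult L.minus_smult A0_carrier ip_l_linear)

lemma ip_l_sg: "x \<in> carrier F \<Longrightarrow> y \<in> carrier F \<Longrightarrow> ip_l F x (sg y) = ip_l F (sg x) y"
  by (rule map_eqI) (simp_all add: ip_l_map tprod_sg)

lemma lip_closed: "x \<in> carrier F \<Longrightarrow> y \<in> carrier F \<Longrightarrow> lip x y \<in> carrier AL"
  unfolding lip_def by (rule L.C_closed) simp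

text \<open>\<open>(x, sg x, x) = sg (x, x, x)\<close> has norm \<open>\<gamma> x ^ 3\<close>.\<close>

lemma nrm_lip:
  assumes x: "x \<in> carrier F" shows "nrm AL (lip x x) = (\<gamma> x)\<^sup>2"
proof -
  have "nrm AL (lip x x) = nrm A0 (ip_l F x (sg x))"
    unfolding lip_def alg_completion_simps using x by (intro L.C_norm_const) (simp add: A0_carrier)
  also have "\<dots> = (\<gamma> x)\<^sup>2"
  proof (rule antisym)
    show "nrm A0 (ip_l F x (sg x)) \<le> (\<gamma> x)\<^sup>2"
      using nrm_ip_le[of x "sg x"] x by (simp add: g_sg power2_eq_square)
    show "(\<gamma> x)\<^sup>2 \<le> nrm A0 (ip_l F x (sg x))"
    proof (cases "\<gamma> x = 0")
      case False
      then have "\<gamma> x > 0" using x by (auto simp: order_less_le)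
      moreover have "\<gamma> x ^ 3 \<le> nrm A0 (ip_l F x (sg x)) * \<gamma> x"
        using op_act[of "ip_l F x (sg x)" x] x by (simp add: tprod_sg g_sg tprod_closed g_cube)
      ultimately show ?thesis by (simp add: power3_eq_cube power2_eq_square)
    qed (use x in \<open>simp add: A0_carrier\<close>)
  qed
  finally show ?thesis .
qed

lemma A0_compose: "a \<otimes>\<^bsub>A0\<^esub> b = compose (carrier F) a b" "star A0 = star_l F"
  by (simp_all add: left_alg0_simps)

text \<open>On \<open>x = u + v\<close> the twisted inner product is that of \<open>u\<close> minus
  that of \<open>v\<close>, which is the sum of the squares of the left inner products of
  \<open>p\<close> and of \<open>q\<close> with themselves. The mixed products vanish, so it is the
  square of the selfadjoint sum \<open>b\<close>.\<close>

lemma lip_positive: assumes x: "x \<in> carrier F" shows "positive_in AL (lip x x)"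
proof -
  obtain u v p q where e: "x = u \<oplus> v" and p: "zs 1 u p" and q: "zs (- 1) v q" using zs_split[OF x] by blast
  have u: "u \<in> Fpos" and v: "v \<in> Fneg" using p q by (auto simp: Fpos_def Fneg_def)
  have c [simp]: "u \<in> carrier F" "v \<in> carrier F" "p \<in> carrier F" "q \<in> carrier F"
    using p q by (auto simp: zs_def)
  interpret O: cstar_tring "opp_tring F" \<gamma> by (rule opp_cstar_tring)
  have zO: "O.zs 1 u p" "O.zs (- 1) v q" using p q by (simp_all add: zs_opp)
  \<comment> \<open>\<open>zs_cross\<close> speaks of operators on the right; for those on the left
    it is read in the opposite ring.\<close>
  have qp: "tprod F q q (tprod F p p z) = \<zero>" and pq: "tprod F p p (tprod F q q z) = \<zero>"
    if z: "z \<in> carrier F" for z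
    using O.zs_cross[OF zO(1,2), of z] O.zs_cross[OF zO(2,1), of z] orth[OF u v] z by simp_all
  define b where "b = ip_l F p p \<oplus>\<^bsub>map_space F\<^esub> ip_l F q q"
  have b: "b \<in> span_l F" by (simp add: b_def span_l_closed)
  have sb: "star_l F b = b" by (simp add: b_def star_l_add)
  have "compose (carrier F) b b = ip_l F x (sg x)"
  proof (rule map_eqI)
    fix z assume z: "z \<in> carrier F"
    have P: "tprod F p p (tprod F p p z) = tprod F u u z" using p z by (simp add: zs_def tprod_closed)
    have Q: "tprod F q q (tprod F q q z) = \<ominus> tprod F v v z"
      using q z by (simp add: zs_def smult_minus1 tprod_closed)
    have "compose (carrier F) b b z = tprod F u u z \<oplus> \<ominus> tprod F v v z"
      using z by (simp add: compose_eq b_def tprod_closed tprod_add3 P Q pq qp)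
    also have "\<dots> = tprod F x (u \<ominus> v) z"
      using orth[OF u v z] z by (simp add: e tprod_diff tprod_add1 tprod_closed) (simp add: a_minus_def tprod_closed)
    also have "u \<ominus> v = sg x" using sg_eq[OF u v] by (simp add: e)
    finally show "compose (carrier F) b b z = ip_l F x (sg x) z" using z by simp
  qed (use b x in \<open>simp_all add: compose_map span_l_map ip_l_map\<close>)
  then have "lip x x = L.cl (\<lambda>_. star A0 b \<otimes>\<^bsub>A0\<^esub> b)"
    by (simp add: lip_def A0_compose sb)
  also have "\<dots> = star AL (L.cl (\<lambda>_. b)) \<otimes>\<^bsub>AL\<^esub> L.cl (\<lambda>_. b)"
    using b by (simp add: L.cl_star L.cl_mult L.cauchy_star)
  finally show ?thesis unfolding positive_in_def using b by (intro bexI[of _ "L.cl (\<lambda>_. b)"] L.C_closed) simp_all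
qed

lemma lact_add_l: "X \<in> carrier AL \<Longrightarrow> Y \<in> carrier AL \<Longrightarrow> x \<in> carrier F \<Longrightarrow>
    lact (X \<oplus>\<^bsub>AL\<^esub> Y) x = lact X x \<oplus> lact Y x"
proof -
  assume "X \<in> carrier AL" "Y \<in> carrier AL" and x: "x \<in> carrier F"
  then obtain s t where s: "lcauchy s" "X = L.cl s" and t: "lcauchy t" "Y = L.cl t" by (meson L.CE)
  have "lim_to (\<lambda>n. (s n \<oplus>\<^bsub>A0\<^esub> t n) x) (lact (L.cl (\<lambda>n. s n \<oplus>\<^bsub>A0\<^esub> t n)) x)"
    by (rule lact_lim[OF L.cauchy_add[OF s(1) t(1)] x])
  moreover have "(s n \<oplus>\<^bsub>A0\<^esub> t n) x = s n x \<oplus> t n x" for n using x by (simp add: left_alg0_simps)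
  ultimately show ?thesis
    using lim_unique[OF _ lim_to_add[OF lact_lim[OF s(1) x] lact_lim[OF t(1) x]]] s t
    by (simp add: L.C_add_cl)
qed

lemma lact_smult_l: "X \<in> carrier AL \<Longrightarrow> x \<in> carrier F \<Longrightarrow> lact (k \<odot>\<^bsub>AL\<^esub> X) x = k \<odot> lact X x"
proof -
  assume "X \<in> carrier AL" and x: "x \<in> carrier F"
  then obtain s where s: "lcauchy s" "X = L.cl s" by (meson L.CE)
  have "lim_to (\<lambda>n. (k \<odot>\<^bsub>A0\<^esub> s n) x) (lact (L.cl (\<lambda>n. k \<odot>\<^bsub>A0\<^esub> s n)) x)"
    by (rule lact_lim[OF L.cauchy_smult[OF s(1)] x])
  moreover have "(k \<odot>\<^bsub>A0\<^esub> s n) x = k \<odot> s n x" for n using x by (simp add: left_alg0_simps)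
  ultimately show ?thesis
    using lim_unique[OF _ lim_to_smult[OF lact_lim[OF s(1) x]]] s by (simp add: L.C_smult_cl)
qed

lemma lact_add_r: "X \<in> carrier AL \<Longrightarrow> x \<in> carrier F \<Longrightarrow> y \<in> carrier F \<Longrightarrow>
    lact X (x \<oplus> y) = lact X x \<oplus> lact X y"
proof -
  assume "X \<in> carrier AL" and x: "x \<in> carrier F" and y: "y \<in> carrier F"
  then obtain s where s: "lcauchy s" "X = L.cl s" by (meson L.CE)
  show ?thesis
    using lim_unique[OF _ lim_to_add[OF lact_lim[OF s(1) x] lact_lim[OF s(1) y]]] lact_lim[OF s(1), of "x \<oplus> y"] s x y
    by (simp add: span_l_add)
qed

lemma lact_smult_r: "X \<in> carrier AL \<Longrightarrow> x \<in> carrier F \<Longrightarrow> lact X (k \<odot> x) = k \<odot> lact X x"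
proof -
  assume "X \<in> carrier AL" and x: "x \<in> carrier F"
  then obtain s where s: "lcauchy s" "X = L.cl s" by (meson L.CE)
  show ?thesis
    using lim_unique[OF _ lim_to_smult[OF lact_lim[OF s(1) x]]] lact_lim[OF s(1), of "k \<odot> x"] s x
    by (simp add: span_l_smult)
qed

lemma lact_mult: "X \<in> carrier AL \<Longrightarrow> Y \<in> carrier AL \<Longrightarrow> x \<in> carrier F \<Longrightarrow>
    lact (X \<otimes>\<^bsub>AL\<^esub> Y) x = lact X (lact Y x)"
proof -
  assume "X \<in> carrier AL" "Y \<in> carrier AL" and x: "x \<in> carrier F"
  then obtain s t where s: "lcauchy s" "X = L.cl s" and t: "lcauchy t" "Y = L.cl t" by (meson L.CE)
  have "lim_to (\<lambda>n. (s n \<otimes>\<^bsub>A0\<^esub> t n) x) (lact (L.cl (\<lambda>n. s n \<otimes>\<^bsub>A0\<^esub> t n)) x)"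
    by (rule lact_lim[OF L.cauchy_mult[OF s(1) t(1)] x])
  moreover have "(s n \<otimes>\<^bsub>A0\<^esub> t n) x = s n (t n x)" for n using x by (simp add: left_alg0_simps compose_eq)
  ultimately show ?thesis
    using lim_unique[OF _ lact_lim2[OF s(1) lact_lim[OF t(1) x]]] s t by (simp add: L.cl_mult)
qed

text \<open>By continuity of the inner product in its first variable, the class of such a sequence
  is again the class of a constant one; \<open>lip\<close> only produces classes of
  constants.\<close>

lemma cl_ip_lim:
  assumes s: "lcauchy s" and f: "lim_to f x" and sf: "\<And>n. s n = ip_l F (f n) y" and y: "y \<in> carrier F"
  shows "L.cl s = L.cl (\<lambda>_. ip_l F x y)"
proof -
  have x: "x \<in> carrier F" and fn: "f n \<in> carrier F" for n using lim_to_closed[OF f] by auto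
  have "(\<lambda>n. nrm A0 (s n \<ominus>\<^bsub>A0\<^esub> ip_l F x y)) \<longlonglongrightarrow> 0"
  proof (rule null_sandwich)
    show "(\<lambda>n. \<gamma> (f n \<ominus> x) * \<gamma> y) \<longlonglongrightarrow> 0"
      using f by (intro tendsto_mult_left_zero) (simp add: lim_to_def)
    show "nrm A0 (s n \<ominus>\<^bsub>A0\<^esub> ip_l F x y) \<le> \<gamma> (f n \<ominus> x) * \<gamma> y" for n
      using nrm_ip_le[of "f n \<ominus> x" y] x fn[of n] y by (simp add: sf ip_l_diff)
    show "0 \<le> nrm A0 (s n \<ominus>\<^bsub>A0\<^esub> ip_l F x y)" for n
      using s x y by (simp add: A0_carrier)
  qed
  then show ?thesis using L.cl_eq_iff[OF s, of "\<lambda>_. ip_l F x y"] x y by simp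
qed

lemma lip_lact: "X \<in> carrier AL \<Longrightarrow> x \<in> carrier F \<Longrightarrow> y \<in> carrier F \<Longrightarrow>
    lip (lact X x) y = X \<otimes>\<^bsub>AL\<^esub> lip x y"
proof -
  assume "X \<in> carrier AL" and x: "x \<in> carrier F" and y: "y \<in> carrier F"
  then obtain s where s: "lcauchy s" "X = L.cl s" by (meson L.CE)
  let ?t = "\<lambda>n. s n \<otimes>\<^bsub>A0\<^esub> ip_l F x (sg y)"
  have c: "lcauchy (\<lambda>_. ip_l F x (sg y))" using x y by simp
  have "L.cl ?t = L.cl (\<lambda>_. ip_l F (lact X x) (sg y))"
    unfolding s(2)
    by (rule cl_ip_lim[OF L.cauchy_mult[OF s(1) c] lact_lim[OF s(1) x]])
       (use s(1) x y in \<open>simp_all add: A0_compose compose_ip\<close>)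
  then show ?thesis unfolding lip_def s(2) L.cl_mult[OF s(1) c] by (simp add: s(2))
qed

text \<open>As \<open>sg\<close> is an involution, every generator \<open>ip_l F x y\<close> is the
  value \<open>lip x (sg y)\<close>; so the span of these values contains the dense image of the
  uncompleted algebra.\<close>

lemma lip_full:
  assumes X: "X \<in> carrier AL" and e: "0 < e"
  shows "\<exists>b\<in>lin_span AL {lip x y | x y. x \<in> carrier F \<and> y \<in> carrier F}. nrm AL (X \<ominus>\<^bsub>AL\<^esub> b) < e"
proof -
  let ?S = "{lip x y | x y. x \<in> carrier F \<and> y \<in> carrier F}"
  have S: "?S \<subseteq> carrier AL" using lip_closed by auto
  note sub = L.C.lin_span_submodule[OF S]
  have "L.cl (\<lambda>_. a) \<in> lin_span AL ?S" if "a \<in> span_l F" for a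
    using that
  proof (induction rule: span_l_induct)
    case (ip x y)
    then have "L.cl (\<lambda>_. ip_l F x y) = lip x (sg y)" by (simp add: lip_def)
    moreover have "lip x (sg y) \<in> ?S" using ip sg_closed by blast
    ultimately show ?case using subsetD[OF L.C.lin_span_base[of ?S]] by simp
  next
    case zero
    have "\<zero>\<^bsub>AL\<^esub> \<in> lin_span AL ?S" using subgroup.one_closed[OF submodule.axioms(1)[OF sub]] by simp
    then show ?case by (simp add: L.C_zero left_alg0_simps)
  next
    case (add a b)
    have "L.cl (\<lambda>_. a) \<oplus>\<^bsub>AL\<^esub> L.cl (\<lambda>_. b) \<in> lin_span AL ?S"
      using subgroup.m_closed[OF submodule.axioms(1)[OF sub]] add by simp
    moreover have "L.cl (\<lambda>_. a) \<oplus>\<^bsub>AL\<^esub> L.cl (\<lambda>_. b) = L.cl (\<lambda>_. a \<oplus>\<^bsub>map_space F\<^esub> b)"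
      using L.C_add_cl[of "\<lambda>_. a" "\<lambda>_. b"] add by (simp add: left_alg0_simps(4))
    ultimately show ?case by simp
  next
    case (smult c a)
    have "c \<odot>\<^bsub>AL\<^esub> L.cl (\<lambda>_. a) \<in> lin_span AL ?S"
      using submodule.smult_closed[OF sub] smult by simp
    moreover have "c \<odot>\<^bsub>AL\<^esub> L.cl (\<lambda>_. a) = L.cl (\<lambda>_. c \<odot>\<^bsub>map_space F\<^esub> a)"
      using L.C_smult_cl[of "\<lambda>_. a" c] smult by (simp add: left_alg0_simps(5))
    ultimately show ?case by simp
  qed
  moreover obtain a where "a \<in> carrier A0" "completion_norm (nrm A0) (X \<ominus>\<^bsub>AL\<^esub> L.cl (\<lambda>_. a)) \<le> e / 2"
    using L.C_approx[OF X, of "e / 2"] e by auto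
  ultimately show ?thesis using e unfolding A0_carrier alg_completion_simps(7)
    by (intro bexI[of _ "L.cl (\<lambda>_. a)"]) simp_all
qed

lemma left_hilbert: "full_left_hilbert_module AL (carrier_module F) lact lip"
proof (intro full_left_hilbert_module.intro full_left_hilbert_module_axioms.intro L.cstar_completion)
  show "module complex_field (carrier_module F)" by (rule module_cong) simp_all
  fix X assume X: "X \<in> carrier AL"
  show "\<exists>b\<in>lin_span AL {lip x y | x y. x \<in> carrier (carrier_module F) \<and> y \<in> carrier (carrier_module F)}.
      nrm AL (X \<ominus>\<^bsub>AL\<^esub> b) < e" if "0 < e" for e
    using lip_full[OF X that] by simp
  fix x assume x': "x \<in> carrier (carrier_module F)" then have x: "x \<in> carrier F" by simp
  show "lact X x \<in> carrier (carrier_module F)" using X x by simp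
  show "lact (k \<odot>\<^bsub>AL\<^esub> X) x = k \<odot>\<^bsub>carrier_module F\<^esub> lact X x" for k using X x by (simp add: lact_smult_l)
  show "lact X (k \<odot>\<^bsub>carrier_module F\<^esub> x) = k \<odot>\<^bsub>carrier_module F\<^esub> lact X x" for k using X x by (simp add: lact_smult_r)
  show "lact (X \<oplus>\<^bsub>AL\<^esub> Y) x = lact X x \<oplus>\<^bsub>carrier_module F\<^esub> lact Y x" if "Y \<in> carrier AL" for Y
    using X that x by (simp add: lact_add_l)
  show "lact (X \<otimes>\<^bsub>AL\<^esub> Y) x = lact X (lact Y x)" if "Y \<in> carrier AL" for Y
    using X that x by (simp add: lact_mult)
  fix y assume "y \<in> carrier (carrier_module F)" then have y: "y \<in> carrier F" by simp
  show "lact X (x \<oplus>\<^bsub>carrier_module F\<^esub> y) = lact X x \<oplus>\<^bsub>carrier_module F\<^esub> lact X y" using X x y by (simp add: lact_add_r)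
  show "lip (lact X x) y = X \<otimes>\<^bsub>AL\<^esub> lip x y" using X x y by (simp add: lip_lact)
next
  fix x assume "x \<in> carrier (carrier_module F)" then have x: "x \<in> carrier F" by simp
  show "positive_in AL (lip x x)" using x by (rule lip_positive)
  show "x = \<zero>\<^bsub>carrier_module F\<^esub>" if z: "lip x x = \<zero>\<^bsub>AL\<^esub>"
  proof -
    have "(\<gamma> x)\<^sup>2 = 0" using nrm_lip[OF x] z by (simp add: alg_completion_simps(7))
    then show ?thesis using g_eq_0[OF x] by simp
  qed
  fix y assume "y \<in> carrier (carrier_module F)" then have y: "y \<in> carrier F" by simp
  show "lip x y \<in> carrier AL" using x y by (rule lip_closed)
  show "lip (k \<odot>\<^bsub>carrier_module F\<^esub> x) y = k \<odot>\<^bsub>AL\<^esub> lip x y" for k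
    using x y by (simp add: lip_def ip_l_linear L.C_smult_cl)
  show "star AL (lip x y) = lip y x"
    using x y by (simp add: lip_def L.cl_star A0_compose) (simp add: ip_l_sg)
  fix z assume "z \<in> carrier (carrier_module F)" then have z: "z \<in> carrier F" by simp
  show "lip (x \<oplus>\<^bsub>carrier_module F\<^esub> y) z = lip x z \<oplus>\<^bsub>AL\<^esub> lip y z"
    using x y z by (simp add: lip_def ip_l_linear L.C_add_cl)
next
  \<comment> \<open>The module norm is the given norm, so its completeness is that of
    \<open>F\<close>.\<close>
  have eq: "sqrt (nrm AL (lip x x)) = \<gamma> x" if "x \<in> carrier F" for x
    using that by (simp add: nrm_lip)
  show "complete_in (carrier_module F) (\<lambda>x. sqrt (nrm AL (lip x x)))"
    unfolding complete_in_def
  proof (intro allI impI)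
    fix s assume s: "cauchy_in (carrier_module F) (\<lambda>x. sqrt (nrm AL (lip x x))) s"
    then have c: "s n \<in> carrier F" for n by (simp add: cauchy_in_def)
    then have "cauchy_in F \<gamma> s" using s by (simp add: cauchy_in_def eq)
    then obtain x where "lim_to s x" using ex_lim by blast
    then show "\<exists>x\<in>carrier (carrier_module F). (\<lambda>n. sqrt (nrm AL (lip (s n \<ominus>\<^bsub>carrier_module F\<^esub> x) (s n \<ominus>\<^bsub>carrier_module F\<^esub> x)))) \<longlonglongrightarrow> 0"
      using c by (auto simp: lim_to_def eq intro!: bexI[of _ x])
  qed
qed

end

section \<open>Opposites and the imprimitivity bimodule\<close>

definition opp_alg :: "'a normed_star_alg \<Rightarrow> 'a normed_star_alg"
  where "opp_alg A = A\<lparr>monoid.mult := \<lambda>a b. b \<otimes>\<^bsub>A\<^esub> a\<rparr>"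

lemma opp_alg_simps [simp]:
  "carrier (opp_alg A) = carrier A" "a \<otimes>\<^bsub>opp_alg A\<^esub> b = b \<otimes>\<^bsub>A\<^esub> a" "ring.zero (opp_alg A) = \<zero>\<^bsub>A\<^esub>"
  "ring.add (opp_alg A) = ring.add A" "module.smult (opp_alg A) = module.smult A"
  "star (opp_alg A) = star A" "nrm (opp_alg A) = nrm A" "a_minus (opp_alg A) = a_minus A"
  by (simp_all add: opp_alg_def) (intro a_minus_cong; simp)

lemma lin_span_opp_alg: "lin_span (opp_alg A) = lin_span A"
proof -
  have "add_monoid (opp_alg A) = add_monoid A" by (simp add: opp_alg_def)
  then have "submodule W complex_field (opp_alg A) = submodule W complex_field A" for W
    by (simp add: submodule_def submodule_axioms_def)
  then show ?thesis by (intro ext) (simp add: lin_span_def)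
qed

lemma (in cstar_algebra) is_pre_cstar: "pre_cstar A"
  by (intro pre_cstar.intro complex_module.intro module_axioms pre_cstar_axioms.intro)
     (simp_all add: mult_closed mult_assoc mult_l_distr mult_r_distr mult_smult_l mult_smult_r
       star_closed star_add star_smult star_mult star_star norm_nrm nrm_mult cstar_identity)

lemma cstar_opp_alg:
  assumes "cstar_algebra A" shows "cstar_algebra (opp_alg A)"
proof -
  interpret cstar_algebra A by (rule assms)
  interpret P: pre_cstar A by (rule is_pre_cstar)
  show ?thesis
  proof (intro cstar_algebra.intro cstar_algebra_axioms.intro)
    show "module complex_field (opp_alg A)" by (rule P.module_cong) simp_all
    show "norm_on (opp_alg A) (nrm (opp_alg A))"
      using norm_nrm by (simp add: norm_on_def seminorm_on_def)
    show "complete_in (opp_alg A) (nrm (opp_alg A))"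
      using complete by (simp add: complete_in_def cauchy_in_def)
    fix a assume a: "a \<in> carrier (opp_alg A)"
    show "nrm (opp_alg A) (star (opp_alg A) a \<otimes>\<^bsub>opp_alg A\<^esub> a) = (nrm (opp_alg A) a)\<^sup>2"
      using cstar_identity[of "star A a"] a by (simp add: star_star)
    fix b assume "b \<in> carrier (opp_alg A)"
    then show "nrm (opp_alg A) (a \<otimes>\<^bsub>opp_alg A\<^esub> b) \<le> nrm (opp_alg A) a * nrm (opp_alg A) b"
      using nrm_mult[of b a] a by (simp add: mult.commute)
  qed (simp_all add: mult_assoc mult_l_distr mult_r_distr mult_smult_l mult_smult_r
       star_add star_smult star_mult star_star)
qed

lemma right_hilbert_of_left:
  assumes "full_left_hilbert_module A X lact lip"
  shows "full_right_hilbert_module (opp_alg A) X (\<lambda>x b. lact b x) (\<lambda>x y. lip y x)"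
proof -
  interpret full_left_hilbert_module A X lact lip by (rule assms)
  interpret P: pre_cstar A by (rule A.is_pre_cstar)
  have set: "{lip y x | x y. x \<in> carrier X \<and> y \<in> carrier X} = {lip x y | x y. x \<in> carrier X \<and> y \<in> carrier X}"
    by blast
  show ?thesis
  proof (intro full_right_hilbert_module.intro full_right_hilbert_module_axioms.intro
      cstar_opp_alg A.cstar_algebra_axioms X.module_axioms)
    fix x assume x: "x \<in> carrier X"
    \<comment> \<open>In the opposite algebra the square \<open>b* b\<close> is that of
      \<open>b*\<close>, which is therefore the witness.\<close>
    obtain b where "b \<in> carrier A" "lip x x = star A b \<otimes>\<^bsub>A\<^esub> b"
      using lip_positive[OF x] unfolding positive_in_def by blast
    then show "positive_in (opp_alg A) (lip x x)"
      unfolding positive_in_def by (intro bexI[of _ "star A b"]) (simp_all add: A.star_star)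
  next
    fix b e assume "b \<in> carrier (opp_alg A)" "0 < (e::real)"
    then show "\<exists>c\<in>lin_span (opp_alg A) {lip y x | x y. x \<in> carrier X \<and> y \<in> carrier X}.
        nrm (opp_alg A) (b \<ominus>\<^bsub>opp_alg A\<^esub> c) < e"
      using lip_full by (simp add: lin_span_opp_alg set)
  qed (use lip_complete in \<open>simp_all add: lact_closed lact_add_l lact_add_r lact_smult_l lact_smult_r
      lact_mult lip_closed lip_add lip_smult lip_lact lip_star lip_definite\<close>)
qed

lemma map_space_opp_tring: "map_space (opp_tring F) = map_space F"
  by (simp add: map_space_def)

lemma ip_l_opp_tring: "ip_l (opp_tring F) x y = ip_r F y x"
  by (simp add: ip_l_def ip_r_def)

lemma span_l_opp_tring: "span_l (opp_tring F) = span_r F"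
proof -
  have "{ip_r F y x | x y. x \<in> carrier F \<and> y \<in> carrier F} = {ip_r F y z | y z. y \<in> carrier F \<and> z \<in> carrier F}"
    by blast
  then show ?thesis by (simp add: span_l_def span_r_def map_space_opp_tring ip_l_opp_tring)
qed

text \<open>The two predicates under the choice operator are equivalent, so the very same map is
  chosen.\<close>

lemma star_l_opp_tring: "star_l (opp_tring F) = star_r F"
proof -
  have "(\<forall>x\<in>carrier F. \<forall>y\<in>carrier F. f (ip_r F y x) = ip_r F x y) \<longleftrightarrow>
      (\<forall>y\<in>carrier F. \<forall>z\<in>carrier F. f (ip_r F y z) = ip_r F z y)" for f
    by blast
  then show ?thesis
    by (simp add: star_l_def star_r_def map_space_opp_tring ip_l_opp_tring span_l_opp_tring)
qed

text \<open>Reversing the ternary product turns the right action into a left one, and reversing the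
  algebra product restores the rule \<open>x (a b) = (x a) b\<close>. The right theory is thus the
  left theory of the opposite ring.\<close>

lemma right_alg0_eq: "right_alg0 F \<gamma> = opp_alg (left_alg0 (opp_tring F) \<gamma>)"
  by (simp add: right_alg0_def left_alg0_def opp_alg_def map_space_opp_tring span_l_opp_tring
      star_l_opp_tring op_norm_def fun_eq_iff)

lemma completion_opp_alg:
  "completion_class (opp_alg A) p = completion_class A p"
  "completion_carrier (opp_alg A) p = completion_carrier A p"
proof -
  have "cauchy_in (opp_alg A) p = cauchy_in A p" by (simp add: fun_eq_iff cauchy_in_def)
  moreover from this have "completion_rel (opp_alg A) p = completion_rel A p"
    by (simp add: completion_rel_def)
  ultimately show "completion_class (opp_alg A) p = completion_class A p"
    "completion_carrier (opp_alg A) p = completion_carrier A p"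
    by (simp_all add: completion_class_def completion_carrier_def fun_eq_iff)
qed

lemma alg_completion_opp_alg: "alg_completion (opp_alg A) = opp_alg (alg_completion A)"
  unfolding alg_completion_def completion_opp_alg opp_alg_simps by (simp add: opp_alg_def)

lemma right_alg_eq: "right_alg F \<gamma> = opp_alg (alg_completion (left_alg0 (opp_tring F) \<gamma>))"
  by (simp add: right_alg_def right_alg0_eq alg_completion_opp_alg)

section \<open>Compatibility of the two sides\<close>

context cstar_tring
begin

lemma lim_to_opp: "seminormed.lim_to (opp_tring F) \<gamma> = lim_to"
proof -
  interpret O: cstar_tring "opp_tring F" \<gamma> by (rule opp_cstar_tring)
  show ?thesis by (simp add: fun_eq_iff O.lim_to_def lim_to_def)
qed

text \<open>Operators in the span commute with \<open>sg\<close> and have adjoints with respect to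
  the product; both sides are limits of this case. Used in the ring and in its opposite, it yields
  the two adjointness laws of a bimodule.\<close>

lemma sg_lact_adjoint:
  assumes X: "X \<in> carrier AL" and [simp]: "x \<in> carrier F" "y \<in> carrier F" "z \<in> carrier F"
  shows "tprod F z (sg (lact X x)) y = tprod F z (sg x) (lact (star AL X) y)"
proof -
  obtain s where s: "lcauchy s" "X = L.cl s" using X by (rule L.CE)
  have 1: "lim_to (\<lambda>n. tprod F z (sg (s n x)) y) (tprod F z (sg (lact X x)) y)"
    unfolding s(2) by (intro lim_to_tprod(2) lim_to_sg lact_lim s(1)) simp_all
  have "lim_to (\<lambda>n. tprod F z (sg x) (star A0 (s n) y)) (tprod F z (sg x) (lact (star AL X) y))"
    unfolding s(2) L.cl_star[OF s(1)] by (intro lim_to_tprod(1) lact_lim L.cauchy_star s(1)) simp_all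
  moreover have "tprod F z (sg (s n x)) y = tprod F z (sg x) (star A0 (s n) y)" for n
    using bspec[OF span_l_sg[of "s n"], of x] tprod_span2[of "s n" z "sg x" y] s(1)
    by (simp add: A0_compose)
  ultimately show ?thesis using lim_unique[OF 1] by simp
qed

text \<open>For a generator \<open>b\<close> this is the associativity
  \<open>(a x, y, z) = a (x, y, z)\<close>.\<close>

lemma span_commute:
  assumes a: "a \<in> span_l F" and b: "b \<in> span_l (opp_tring F)"
  shows "\<forall>x\<in>carrier F. b (a x) = a (b x)"
proof -
  interpret O: cstar_tring "opp_tring F" \<gamma> by (rule opp_cstar_tring)
  show ?thesis using b
  proof (induction rule: O.span_l_induct)
    case (add b c)
    then have "b x \<in> carrier F" "c x \<in> carrier F" if "x \<in> carrier F" for x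
      using O.span_l_apply that by simp_all
    with add a show ?case by (simp add: span_l_add)
  next
    case (smult k b)
    then have "b x \<in> carrier F" if "x \<in> carrier F" for x using O.span_l_apply that by simp
    with smult a show ?case by (simp add: span_l_smult)
  qed (use a in \<open>simp_all add: tprod_span1 span_l_zero\<close>)
qed

lemma imprimitivity:
  "imprimitivity_bimodule AL (right_alg F \<gamma>) (carrier_module F) lact lip
    (\<lambda>x b. cstar_tring.lact (opp_tring F) \<gamma> b x) (\<lambda>x y. cstar_tring.lip (opp_tring F) \<gamma> y x)"
proof -
  interpret O: cstar_tring "opp_tring F" \<gamma> by (rule opp_cstar_tring)
  have cm: "carrier_module (opp_tring F) = carrier_module F" by (simp add: carrier_module_def)
  interpret OA: cstar_algebra O.AL by (rule O.L.cstar_completion)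
  show ?thesis unfolding right_alg_eq
  proof (intro imprimitivity_bimodule.intro imprimitivity_bimodule_axioms.intro left_hilbert)
    show "full_right_hilbert_module (opp_alg O.AL) (carrier_module F) (\<lambda>x b. O.lact b x) (\<lambda>x y. O.lip y x)"
      using right_hilbert_of_left[OF O.left_hilbert] by (simp add: cm)
  next
    fix X x Y assume X: "X \<in> carrier AL" and x': "x \<in> carrier (carrier_module F)" and "Y \<in> carrier (opp_alg O.AL)"
    then have Y: "Y \<in> carrier O.AL" and x: "x \<in> carrier F" by simp_all
    obtain s where s: "lcauchy s" "X = L.cl s" using X by (rule L.CE)
    obtain t where t: "O.lcauchy t" "Y = O.L.cl t" using Y by (rule O.L.CE)
    \<comment> \<open>Both iterated actions are limits of one sequence, because the uncompleted
      operators commute.\<close>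
    have 1: "lim_to (\<lambda>n. t n (s n x)) (O.lact Y (lact X x))"
      using O.lact_lim2[OF t(1), of "\<lambda>n. s n x" "lact X x"] lact_lim[OF s(1) x] s(2) t(2)
      by (simp add: lim_to_opp)
    have 2: "lim_to (\<lambda>n. s n (t n x)) (lact X (O.lact Y x))"
      using lact_lim2[OF s(1), of "\<lambda>n. t n x" "O.lact Y x"] O.lact_lim[OF t(1), of x] x s(2) t(2)
      by (simp add: lim_to_opp)
    have "t n (s n x) = s n (t n x)" for n
      using span_commute[OF lcauchy_span[OF s(1)] O.lcauchy_span[OF t(1)]] x by simp
    then show "O.lact Y (lact X x) = lact X (O.lact Y x)" using lim_unique[OF 1] 2 by simp
  next
    fix X x y assume X: "X \<in> carrier AL" and "x \<in> carrier (carrier_module F)" "y \<in> carrier (carrier_module F)"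
    then have x: "x \<in> carrier F" and y: "y \<in> carrier F" by simp_all
    have Xs: "star AL X \<in> carrier AL" using cstar_algebra.star_closed[OF L.cstar_completion X] .
    have "ip_l (opp_tring F) y (sg (lact X x)) = ip_l (opp_tring F) (lact (star AL X) y) (sg x)"
      by (rule O.map_eqI) (use X Xs x y in \<open>simp_all add: O.ip_l_map[simplified] sg_lact_adjoint\<close>)
    then show "O.lip y (lact X x) = O.lip (lact (star AL X) y) x" by (simp add: O.lip_def sg_opp)
  next
    fix x Y y assume "x \<in> carrier (carrier_module F)" and "Y \<in> carrier (opp_alg O.AL)" and "y \<in> carrier (carrier_module F)"
    then have Y: "Y \<in> carrier O.AL" and x: "x \<in> carrier F" and y: "y \<in> carrier F" by simp_all
    note Ys = OA.star_closed[OF Y]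
    have c: "O.lact Y x \<in> carrier F" "O.lact (star O.AL Y) y \<in> carrier F"
      using O.lact_closed[OF Y] O.lact_closed[OF Ys] x y by simp_all
    have "ip_l F (O.lact Y x) (sg y) = ip_l F x (sg (O.lact (star O.AL Y) y))"
    proof (rule map_eqI)
      fix z assume "z \<in> carrier F"
      then show "ip_l F (O.lact Y x) (sg y) z = ip_l F x (sg (O.lact (star O.AL Y) y)) z"
        using O.sg_lact_adjoint[OF Ys, of y x z] x y by (simp add: sg_opp OA.star_star[OF Y])
    qed (use c x y in \<open>simp_all add: ip_l_map\<close>)
    then show "lip (O.lact Y x) y = lip x (O.lact (star (opp_alg O.AL) Y) y)" by (simp add: lip_def)
  next
    fix x y z assume "x \<in> carrier (carrier_module F)" "y \<in> carrier (carrier_module F)" "z \<in> carrier (carrier_module F)"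
    then have c: "x \<in> carrier F" "y \<in> carrier F" "z \<in> carrier F" by simp_all
    \<comment> \<open>Both sides are \<open>tprod F x (sg y) z\<close>: the twist sits on the middle
      element, which the two inner products share.\<close>
    then show "lact (lip x y) z = O.lact (O.lip z y) x"
      using O.ip_l_span[of z "sg y"] O.lact_const[of "ip_l (opp_tring F) z (sg y)" x]
      by (simp add: lip_def O.lip_def sg_opp lact_const)
  qed
qed

end

text \<open>The bimodule is the completion itself, whose points are classes of sequences in
  \<open>E\<close>; this accounts for the type argument.\<close>

theorem corollary3p20:
  fixes E :: "('a, 'm) tring_scheme" and \<gamma> :: "'a \<Rightarrow> real"
  assumes "admissible_star_tring E" and "\<gamma> \<in> SN E"
  shows "morita_rieffel_equivalent TYPE((nat \<Rightarrow> 'a) set)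
    (left_alg (tring_completion E \<gamma>) (completion_norm \<gamma>))
    (right_alg (tring_completion E \<gamma>) (completion_norm \<gamma>))"
proof -
  interpret seminormed_tring E \<gamma>
    using assms by (intro seminormed_tring.intro seminormed_tring_axioms.intro)
      (auto simp: admissible_star_tring_def)
  interpret F: cstar_tring "tring_completion E \<gamma>" "completion_norm \<gamma>"
    by (rule cstar_tring_completion)
  interpret O: cstar_tring "opp_tring (tring_completion E \<gamma>)" "completion_norm \<gamma>"
    by (rule F.opp_cstar_tring)
  show ?thesis
    unfolding morita_rieffel_equivalent_def
    using F.imprimitivity F.L.cstar_completion cstar_opp_alg[OF O.L.cstar_completion]
    unfolding left_alg_def right_alg_eq by blast
qed

end
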